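(* The decision problem $\mathsf{CRT}$ (given a finite algebra $\mathbf{A}$ and congruences $\theta_1,\ldots,\theta_k$ of $\mathbf{A}$, is $\langle\theta_1,\ldots,\theta_k\rangle$ a Chinese Remainder tuple of $\mathbf{A}$?) is $\mathrm{coNP}$-complete.
   Context: An algebra is a structure of a first-order language with no relation symbols. A congruence of an algebra $\mathbf{A}$ with universe $A$ is an equivalence relation on $A$ compatible with all fundamental operations of $\mathbf{A}$. The congruences of $\mathbf{A}$ form a lattice under inclusion; the join $\theta\vee\delta$ is the transitive closure of $\theta\cup\delta$. A tuple $\langle\theta_1,\ldots,\theta_k\rangle$ of congruences of $\mathbf{A}$ is a Chinese Remainder tuple (CR tuple) of $\mathbf{A}$ if for all $a_1,\ldots,a_k\in A$ with $\langle a_i,a_j\rangle\in\theta_i\vee\theta_j$ for all $i,j\in\{1,\ldots,k\}$ there is $a\in A$ with $\langle a,a_i\rangle\in\theta_i$ for all $i\in\{1,\ldots,k\}$. A fixed reasonable encoding of finite algebras and congruences as strings over a finite alphabet is assumed (e.g. by operation tables and lists of pairs). Reductions are Karp reductions, that is, polynomial-time computable many-one reductions; $\mathrm{coNP}$-completeness is with respect to these. *)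

theory Defs
  imports Main "HOL-Computational_Algebra.Polynomial"
begin

section \<open>Algebras, congruences, Chinese Remainder tuples\<close>

record ('a, 'f) algebra =
  universe :: "'a set"
  symbols :: "'f set"
  arity :: "'f \<Rightarrow> nat"
  interp :: "'f \<Rightarrow> 'a list \<Rightarrow> 'a"

definition tuples :: "'a set \<Rightarrow> nat \<Rightarrow> 'a list set" where
  "tuples A r = {xs. set xs \<subseteq> A \<and> length xs = r}"

definition is_algebra :: "('a, 'f) algebra \<Rightarrow> bool" where
  "is_algebra A \<longleftrightarrow> universe A \<noteq> {} \<and>
     (\<forall>f\<in>symbols A. \<forall>xs\<in>tuples (universe A) (arity A f). interp A f xs \<in> universe A)"

definition congruence :: "('a, 'f) algebra \<Rightarrow> 'a rel \<Rightarrow> bool" where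
  "congruence A \<theta> \<longleftrightarrow> equiv (universe A) \<theta> \<and>
     (\<forall>f\<in>symbols A. \<forall>xs\<in>tuples (universe A) (arity A f). \<forall>ys\<in>tuples (universe A) (arity A f).
        (\<forall>i<arity A f. (xs ! i, ys ! i) \<in> \<theta>) \<longrightarrow> (interp A f xs, interp A f ys) \<in> \<theta>)"

definition cong_join :: "'a rel \<Rightarrow> 'a rel \<Rightarrow> 'a rel" where
  "cong_join \<theta> \<delta> = (\<theta> \<union> \<delta>)\<^sup>+"

definition CR_tuple :: "('a, 'f) algebra \<Rightarrow> 'a rel list \<Rightarrow> bool" where
  "CR_tuple A \<theta>s \<longleftrightarrow>
     (\<forall>\<theta>\<in>set \<theta>s. congruence A \<theta>) \<and>
     (\<forall>as\<in>tuples (universe A) (length \<theta>s).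
        (\<forall>i<length \<theta>s. \<forall>j<length \<theta>s. (as ! i, as ! j) \<in> cong_join (\<theta>s ! i) (\<theta>s ! j)) \<longrightarrow>
        (\<exists>a\<in>universe A. \<forall>i<length \<theta>s. (a, as ! i) \<in> \<theta>s ! i))"


section \<open>Encoding of instances\<close>

text \<open>
  A finite algebra is presented, up to isomorphism and naming of its symbols, by the size \<open>n\<close> of
  its universe \<open>{0..<n}\<close> and a list of pairs (arity, operation table). The table of an \<open>r\<close>-ary
  operation lists its \<open>n ^ r\<close> values, with the argument tuples in lexicographic order: the position
  of a tuple is the number it denotes in base \<open>n\<close>, most significant digit first.
\<close>

type_synonym op_table = "nat \<times> nat list"

definition tuple_index :: "nat \<Rightarrow> nat list \<Rightarrow> nat" where
  "tuple_index n xs = foldl (\<lambda>m x. m * n + x) 0 xs"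

definition table_algebra :: "nat \<Rightarrow> op_table list \<Rightarrow> (nat, nat) algebra" where
  "table_algebra n ops =
     \<lparr>universe = {..<n}, symbols = {..<length ops}, arity = (\<lambda>i. fst (ops ! i)),
      interp = (\<lambda>i xs. snd (ops ! i) ! tuple_index n xs)\<rparr>"

text \<open>
  An instance consists of the presentation of an algebra and a nonempty list of congruences, each
  given as a list of pairs (in any order, possibly with repetitions).
\<close>

type_synonym crt_instance = "nat \<times> op_table list \<times> (nat \<times> nat) list list"

definition valid_instance :: "crt_instance \<Rightarrow> bool" where
  "valid_instance = (\<lambda>(n, ops, cs).
     (\<forall>(r, tab)\<in>set ops. length tab = n ^ r) \<and> is_algebra (table_algebra n ops) \<and>
     cs \<noteq> [] \<and> (\<forall>c\<in>set cs. congruence (table_algebra n ops) (set c)))"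

definition enc_nat :: "nat \<Rightarrow> bool list" where
  "enc_nat m = replicate m True @ [False]"

definition enc_list :: "('a \<Rightarrow> bool list) \<Rightarrow> 'a list \<Rightarrow> bool list" where
  "enc_list e xs = enc_nat (length xs) @ concat (map e xs)"

definition enc_pair :: "('a \<Rightarrow> bool list) \<Rightarrow> ('b \<Rightarrow> bool list) \<Rightarrow> 'a \<times> 'b \<Rightarrow> bool list" where
  "enc_pair e f = (\<lambda>(a, b). e a @ f b)"

definition enc_instance :: "crt_instance \<Rightarrow> bool list" where
  "enc_instance =
     enc_pair enc_nat
       (enc_pair (enc_list (enc_pair enc_nat (enc_list enc_nat)))
                 (enc_list (enc_list (enc_pair enc_nat enc_nat))))"

definition CRT :: "bool list set" where
  "CRT = {enc_instance (n, ops, cs) | n ops cs.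
            valid_instance (n, ops, cs) \<and> CR_tuple (table_algebra n ops) (map set cs)}"

definition prefix_code :: "('a \<Rightarrow> bool list) \<Rightarrow> bool" where
  "prefix_code e \<longleftrightarrow> (\<forall>a b u v. e a @ u = e b @ v \<longrightarrow> a = b \<and> u = v)"

lemma prefix_code_enc_nat: "prefix_code enc_nat"
proof -
  have "enc_nat a @ u = enc_nat b @ v \<Longrightarrow> a = b \<and> u = v" for a b u v
  proof (induction a arbitrary: b)
    case 0
    then show ?case by (cases b) (auto simp: enc_nat_def)
  next
    case (Suc a)
    then show ?case by (cases b) (auto simp: enc_nat_def)
  qed
  then show ?thesis unfolding prefix_code_def by blast
qed

lemma prefix_code_enc_pair:
  assumes "prefix_code e" "prefix_code f"
  shows "prefix_code (enc_pair e f)"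
  unfolding prefix_code_def
proof (intro allI impI)
  fix a b :: "'a \<times> 'b" and u v
  assume eq: "enc_pair e f a @ u = enc_pair e f b @ v"
  obtain a1 a2 b1 b2 where ab: "a = (a1, a2)" "b = (b1, b2)" by (cases a, cases b) auto
  from eq have eq': "e a1 @ (f a2 @ u) = e b1 @ (f b2 @ v)" by (simp add: enc_pair_def ab)
  then have "a1 = b1" and "f a2 @ u = f b2 @ v"
    using assms(1) unfolding prefix_code_def by blast+
  then show "a = b \<and> u = v" using assms(2) unfolding prefix_code_def ab by blast
qed

lemma prefix_code_enc_list:
  assumes e: "prefix_code e"
  shows "prefix_code (enc_list e)"
proof -
  have *: "length xs = length ys \<Longrightarrow> concat (map e xs) @ u = concat (map e ys) @ v \<Longrightarrow> xs = ys \<and> u = v"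
    for xs ys u v
  proof (induction xs ys rule: list_induct2)
    case (Cons x xs y ys)
    then have "e x @ (concat (map e xs) @ u) = e y @ (concat (map e ys) @ v)" by simp
    then have "x = y" "concat (map e xs) @ u = concat (map e ys) @ v"
      using e unfolding prefix_code_def by blast+
    with Cons.IH show ?case by blast
  qed simp
  show ?thesis
    unfolding prefix_code_def
  proof (intro allI impI)
    fix xs ys u v
    assume "enc_list e xs @ u = enc_list e ys @ v"
    then have "enc_nat (length xs) @ (concat (map e xs) @ u) =
               enc_nat (length ys) @ (concat (map e ys) @ v)"
      by (simp add: enc_list_def)
    then have "length xs = length ys" "concat (map e xs) @ u = concat (map e ys) @ v"
      using prefix_code_enc_nat unfolding prefix_code_def by blast+
    then show "xs = ys \<and> u = v" using * by blast
  qed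
qed

lemma inj_enc_instance: "inj enc_instance"
proof -
  have "prefix_code enc_instance"
    unfolding enc_instance_def
    by (intro prefix_code_enc_pair prefix_code_enc_list prefix_code_enc_nat)
  then show ?thesis
    unfolding prefix_code_def inj_def by (metis append_Nil2)
qed


section \<open>Polynomial time and coNP\<close>

text \<open>
  Deterministic multi-tape Turing machines with two-way infinite tapes. States and tape symbols are
  natural numbers. The states are \<open>0, \<dots>, state_count - 1\<close>, with \<open>0\<close> initial, together with the
  halting state \<open>state_count\<close>; symbol \<open>0\<close> is the blank, \<open>1\<close> and \<open>2\<close> are the two bits.
\<close>

datatype direction = Move_Left | Stay | Move_Right

record tm =
  tape_count :: nat
  symbol_count :: nat
  state_count :: nat
  transition :: "nat \<Rightarrow> nat list \<Rightarrow> nat \<times> (nat \<times> direction) list"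

definition is_tm :: "tm \<Rightarrow> bool" where
  "is_tm M \<longleftrightarrow> tape_count M \<ge> 1 \<and> symbol_count M \<ge> 3 \<and>
     (\<forall>q<state_count M. \<forall>ss\<in>tuples {..<symbol_count M} (tape_count M).
        case transition M q ss of (q', acts) \<Rightarrow>
          q' \<le> state_count M \<and> length acts = tape_count M \<and>
          (\<forall>(s, d)\<in>set acts. s < symbol_count M))"

text \<open>A tape is its content together with the position of the head.\<close>

type_synonym tape = "(int \<Rightarrow> nat) \<times> int"
type_synonym config = "nat \<times> tape list"

fun displacement :: "direction \<Rightarrow> int" where
  "displacement Move_Left = -1"
| "displacement Stay = 0"
| "displacement Move_Right = 1"

definition act_on_tape :: "nat \<times> direction \<Rightarrow> tape \<Rightarrow> tape" where
  "act_on_tape = (\<lambda>(s, d) (t, h). (t(h := s), h + displacement d))"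

definition tm_step :: "tm \<Rightarrow> config \<Rightarrow> config" where
  "tm_step M = (\<lambda>(q, tps).
     if q < state_count M then
       (case transition M q (map (\<lambda>(t, h). t h) tps) of
          (q', acts) \<Rightarrow> (q', map2 act_on_tape acts tps))
     else (q, tps))"

definition content :: "bool list \<Rightarrow> int \<Rightarrow> nat" where
  "content w i = (if 0 \<le> i \<and> i < int (length w) then (if w ! nat i then 2 else 1) else 0)"

definition initial :: "tm \<Rightarrow> bool list \<Rightarrow> config" where
  "initial M w = (0, (content w, 0) # replicate (tape_count M - 1) (content [], 0))"

text \<open>
  The input is on the first tape and the output on the last one. Since a halted machine no longer
  changes its configuration, the following means halting within \<open>t\<close> steps.
\<close>

definition computes_in :: "tm \<Rightarrow> nat \<Rightarrow> bool list \<Rightarrow> bool list \<Rightarrow> bool" where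
  "computes_in M t x y \<longleftrightarrow>
     (case (tm_step M ^^ t) (initial M x) of
        (q, tps) \<Rightarrow> q = state_count M \<and> fst (last tps) = content y)"

definition polytime :: "(bool list \<Rightarrow> bool list) \<Rightarrow> bool" where
  "polytime f \<longleftrightarrow>
     (\<exists>M p. is_tm M \<and> (\<forall>x. computes_in M (poly p (length x)) x (f x)))"

definition class_P :: "bool list set set" where
  "class_P = {L. polytime (\<lambda>x. [x \<in> L])}"

definition pair_string :: "bool list \<Rightarrow> bool list \<Rightarrow> bool list" where
  "pair_string x y = concat (map (\<lambda>b. [b, b]) x) @ [False, True] @ y"

definition class_NP :: "bool list set set" where
  "class_NP = {L. \<exists>V\<in>class_P. \<exists>p :: nat poly.
     \<forall>x. x \<in> L \<longleftrightarrow> (\<exists>y. length y \<le> poly p (length x) \<and> pair_string x y \<in> V)}"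

definition class_coNP :: "bool list set set" where
  "class_coNP = {L. - L \<in> class_NP}"

definition karp_reducible :: "bool list set \<Rightarrow> bool list set \<Rightarrow> bool" where
  "karp_reducible L L' \<longleftrightarrow> (\<exists>f. polytime f \<and> (\<forall>x. x \<in> L \<longleftrightarrow> f x \<in> L'))"

definition coNP_complete :: "bool list set \<Rightarrow> bool" where
  "coNP_complete L \<longleftrightarrow> L \<in> class_coNP \<and> (\<forall>L'\<in>class_coNP. karp_reducible L' L)"

end

theory Submission
  imports Defs
begin

text \<open>
  Both halves of the proof write concrete programs in a small loop language over bit strings. A
  program of this language emits a bit string, its loops are bounded on entry, and it has no mutable
  state, so that its output has polynomial length by construction. Programs are compiled once and for
  all to multi-tape Turing machines with polynomial running time (\<open>polytime_sem\<close>). On top of the language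
  there are arithmetic, bounded quantifiers and access to the tokens of a string, that is, the numbers
  that it lists in unary, so that a polynomial-time predicate can be written down as a first-order
  formula.

  Membership (\<open>CRT_coNP\<close>). A string is refuted by a certificate that contains the positions of all
  operations and congruences in the string, capped powers of the size of the universe, and witnesses
  for one violated condition. The positions are determined by recurrences that can be checked locally
  and that make sense for every string, so that syntactically wrong strings are refuted in the same
  way. That two elements are related by the join of two congruences is witnessed by a path
  (\<open>refutes_sound\<close>, \<open>refutes_complete\<close>).

  Hardness (\<open>CRT_hard\<close>). Instances without operations suffice. Consider a constraint problem whose
  constraints are binary and require that labels of two values agree. Its instance has as elements
  the partial solutions with a domain of two variables, and for each variable \<open>l\<close> the congruence that
  identifies elements with the same value at \<open>l\<close>, elements without a value at \<open>l\<close> being alone. A family of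
  elements that is pairwise related by the joins either carries the values of a solution, and then has
  no common element because elements have only two values, or one of its members lacks its value and
  is the common element. Hence the congruences form a Chinese Remainder tuple iff the constraint
  problem has no solution (\<open>CR_iff_not_solution\<close>). The constraint problem is taken from the tableau of
  a machine that verifies certificates. Tape contents are recorded relative to the head positions, which makes each entry a
  function of three neighbours, the state and the symbols that are read, for any number of tapes
  (\<open>around_step\<close>, \<open>run_of_tableau\<close>, \<open>tableau_of_run\<close>).
\<close>

section \<open>A loop language over bit strings\<close>

text \<open>
  Programs act on an environment of bit strings. They have no assignment: a program denotes the bit
  string that it emits, loops run a number of times that is fixed on entry, and the index of a loop
  and the value of a local definition are bound lexically. All values therefore have polynomial
  length, and no cost has to be tracked in the programs themselves. Numbers are represented in unary,
  by the length of a string.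
\<close>

type_synonym env = "nat \<Rightarrow> bool list"

datatype prog =
    Skip
  | Emit bool
  | Var nat
  | Seq prog prog
  | Let nat prog prog
  | For nat prog prog
  | If prog prog prog
  | Drop prog prog

text \<open>
  Binding a variable. Variable \<open>0\<close> is never rebound: it keeps the input, and a binder named \<open>0\<close> binds
  nothing.
\<close>

definition bind :: "nat \<Rightarrow> 'a \<Rightarrow> (nat \<Rightarrow> 'a) \<Rightarrow> nat \<Rightarrow> 'a" where
  "bind v x e = (if v = 0 then e else e(v := x))"

text \<open>
  The output of a program. In \<open>For v P Q\<close>, the body \<open>Q\<close> runs once for each position of the output of
  \<open>P\<close>, with \<open>v\<close> bound to the index in unary; a condition counts as true if its first bit is \<open>True\<close>;
  \<open>Drop P Q\<close> removes from the output of \<open>P\<close> as many bits as \<open>Q\<close> emits, so that as a condition it reads a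
  bit at an index.
\<close>

primrec sem :: "prog \<Rightarrow> env \<Rightarrow> bool list" where
  "sem Skip e = []"
| "sem (Emit b) e = [b]"
| "sem (Var v) e = e v"
| "sem (Seq P Q) e = sem P e @ sem Q e"
| "sem (Let v P Q) e = sem Q (bind v (sem P e) e)"
| "sem (For v P Q) e =
     concat (map (\<lambda>i. sem Q (bind v (replicate i True) e)) [0..<length (sem P e)])"
| "sem (If P Q R) e = (if take 1 (sem P e) = [True] then sem Q e else sem R e)"
| "sem (Drop P Q) e = drop (length (sem Q e)) (sem P e)"

section \<open>Relocatable code for multi-tape machines\<close>

text \<open>
  An instruction concerns one tape: write a symbol and move, move only, or branch on the symbol that
  is read. The offset of a branch is relative to its own position.
\<close>

datatype instr =
    Act nat nat direction
  | Mv nat direction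
  | Branch nat "nat \<Rightarrow> bool" int

type_synonym store = "nat \<Rightarrow> tape"

fun step :: "instr list \<Rightarrow> nat \<times> store \<Rightarrow> nat \<times> store" where
  "step cs (q, \<tau>) = (if q < length cs then
     (case cs ! q of
        Act t w d \<Rightarrow> (Suc q, \<tau>(t := act_on_tape (min 2 w, d) (\<tau> t)))
      | Mv t d \<Rightarrow> (Suc q, \<tau>(t := (fst (\<tau> t), snd (\<tau> t) + displacement d)))
      | Branch t p off \<Rightarrow>
          (if p (fst (\<tau> t) (snd (\<tau> t))) then min (length cs) (nat (int q + off)) else Suc q, \<tau>))
     else (q, \<tau>))"

text \<open>
  The code fragment \<open>c\<close>, wherever it is placed, leads in exactly \<open>n\<close> steps from its first instruction with
  tapes \<open>\<tau>\<close> to the position just after it with tapes \<open>\<tau>'\<close>.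
\<close>

definition runs :: "instr list \<Rightarrow> store \<Rightarrow> nat \<Rightarrow> store \<Rightarrow> bool" where
  "runs c \<tau> n \<tau>' \<longleftrightarrow> (\<forall>pre post.
     (step (pre @ c @ post) ^^ n) (length pre, \<tau>) = (length pre + length c, \<tau>'))"

lemma runs_Nil: "runs [] \<tau> 0 \<tau>"
  by (simp add: runs_def)

lemma runs_append:
  assumes "runs c \<tau> n \<tau>'" "runs c' \<tau>' m \<tau>''"
  shows "runs (c @ c') \<tau> (n + m) \<tau>''"
  unfolding runs_def
proof (intro allI)
  fix pre post
  have 1: "(step (pre @ c @ (c' @ post)) ^^ n) (length pre, \<tau>) = (length pre + length c, \<tau>')"
    using assms(1) by (simp add: runs_def)
  have 2: "(step ((pre @ c) @ c' @ post) ^^ m) (length (pre @ c), \<tau>') =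
           (length (pre @ c) + length c', \<tau>'')"
    using assms(2) unfolding runs_def by blast
  show "(step (pre @ (c @ c') @ post) ^^ (n + m)) (length pre, \<tau>) =
        (length pre + length (c @ c'), \<tau>'')"
    using 1 2 by (simp add: add.commute[of n m] funpow_add add.assoc)
qed

lemma runs_Act: "w \<le> 2 \<Longrightarrow> runs [Act t w d] \<tau> 1 (\<tau>(t := act_on_tape (w, d) (\<tau> t)))"
  by (simp add: runs_def nth_append min_absorb2)

lemma runs_Mv: "runs [Mv t d] \<tau> 1 (\<tau>(t := (fst (\<tau> t), snd (\<tau> t) + displacement d)))"
  by (simp add: runs_def nth_append)

text \<open>
  Code that runs \<open>c\<close> if the symbol read on tape \<open>t\<close> satisfies \<open>p\<close>, and \<open>c'\<close> otherwise.
\<close>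

definition cond :: "nat \<Rightarrow> (nat \<Rightarrow> bool) \<Rightarrow> instr list \<Rightarrow> instr list \<Rightarrow> instr list" where
  "cond t p c c' = Branch t p (int (length c') + 2) # c' @
     Branch 0 (\<lambda>_. True) (int (length c) + 1) # c"

text \<open>
  Code that repeats \<open>c\<close> as long as a nonblank symbol is read on tape \<open>t\<close>.
\<close>

definition while :: "nat \<Rightarrow> instr list \<Rightarrow> instr list" where
  "while t c = Branch t (\<lambda>s. s = 0) (int (length c) + 2) # c @
     [Branch 0 (\<lambda>_. True) (- int (length c) - 1)]"

lemma funpow_comp_eq:
  assumes "(f ^^ n) x = y" "(f ^^ m) y = z"
  shows "(f ^^ (m + n)) x = z"
  using assms by (simp add: funpow_add)

lemma runs_cond_True:
  assumes p: "p (fst (\<tau> t) (snd (\<tau> t)))" and c: "runs c \<tau> n \<tau>'"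
  shows "runs (cond t p c c') \<tau> (n + 1) \<tau>'"
  unfolding runs_def
proof (intro allI)
  fix pre post
  let ?C = "pre @ cond t p c c' @ post"
  let ?pre = "pre @ Branch t p (int (length c') + 2) # c' @ [Branch 0 (\<lambda>_. True) (int (length c) + 1)]"
  have eq: "?C = ?pre @ c @ post" by (simp add: cond_def)
  have 1: "(step ?C ^^ 1) (length pre, \<tau>) = (length ?pre, \<tau>)"
    using p by (simp add: cond_def nth_append nat_add_distrib)
  have 2: "(step ?C ^^ n) (length ?pre, \<tau>) = (length ?pre + length c, \<tau>')"
    unfolding eq using c unfolding runs_def by blast
  show "(step ?C ^^ (n + 1)) (length pre, \<tau>) = (length pre + length (cond t p c c'), \<tau>')"
    using funpow_comp_eq[OF 1 2] by (simp add: cond_def)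
qed

lemma runs_cond_False:
  assumes p: "\<not> p (fst (\<tau> t) (snd (\<tau> t)))" and c: "runs c' \<tau> n \<tau>'"
  shows "runs (cond t p c c') \<tau> (n + 2) \<tau>'"
  unfolding runs_def
proof (intro allI)
  fix pre post
  let ?C = "pre @ cond t p c c' @ post"
  let ?pre = "pre @ [Branch t p (int (length c') + 2)]"
  have eq: "?C = ?pre @ c' @ (Branch 0 (\<lambda>_. True) (int (length c) + 1) # c @ post)"
    by (simp add: cond_def)
  have 1: "(step ?C ^^ 1) (length pre, \<tau>) = (length ?pre, \<tau>)"
    using p by (simp add: cond_def nth_append)
  have 2: "(step ?C ^^ n) (length ?pre, \<tau>) = (length ?pre + length c', \<tau>')"
    unfolding eq using c unfolding runs_def by blast
  have 3: "(step ?C ^^ 1) (length ?pre + length c', \<tau>') = (length pre + length (cond t p c c'), \<tau>')"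
    by (simp add: cond_def nth_append nat_add_distrib)
  show "(step ?C ^^ (n + 2)) (length pre, \<tau>) = (length pre + length (cond t p c c'), \<tau>')"
    using funpow_comp_eq[OF funpow_comp_eq[OF 1 2] 3] by (simp add: numeral_2_eq_2)
qed

lemma runs_while_end:
  assumes "fst (\<tau> t) (snd (\<tau> t)) = 0"
  shows "runs (while t c) \<tau> 1 \<tau>"
  using assms by (simp add: runs_def while_def nth_append nat_add_distrib)

lemma runs_while_step:
  assumes p: "fst (\<tau> t) (snd (\<tau> t)) \<noteq> 0" and c: "runs c \<tau> n \<tau>'"
    and w: "runs (while t c) \<tau>' m \<tau>''"
  shows "runs (while t c) \<tau> (n + m + 2) \<tau>''"
  unfolding runs_def
proof (intro allI)
  fix pre post
  let ?C = "pre @ while t c @ post"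
  let ?pre = "pre @ [Branch t (\<lambda>s. s = 0) (int (length c) + 2)]"
  have eq: "?C = ?pre @ c @ (Branch 0 (\<lambda>_. True) (- int (length c) - 1) # post)"
    by (simp add: while_def)
  have 1: "(step ?C ^^ 1) (length pre, \<tau>) = (length ?pre, \<tau>)"
    using p by (simp add: while_def nth_append)
  have 2: "(step ?C ^^ n) (length ?pre, \<tau>) = (length ?pre + length c, \<tau>')"
    unfolding eq using c unfolding runs_def by blast
  have 3: "(step ?C ^^ 1) (length ?pre + length c, \<tau>') = (length pre, \<tau>')"
    by (simp add: while_def nth_append)
  have 4: "(step ?C ^^ m) (length pre, \<tau>') = (length pre + length (while t c), \<tau>'')"
    using w unfolding runs_def by blast
  show "(step ?C ^^ (n + m + 2)) (length pre, \<tau>) = (length pre + length (while t c), \<tau>'')"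
    using funpow_comp_eq[OF funpow_comp_eq[OF funpow_comp_eq[OF 1 2] 3] 4]
    by (simp add: algebra_simps numeral_2_eq_2)
qed

section \<open>Strings on tapes\<close>

text \<open>
  The content of a tape that holds the string \<open>s\<close> from cell \<open>b\<close> on and is blank elsewhere.
\<close>

definition tape_str :: "int \<Rightarrow> bool list \<Rightarrow> int \<Rightarrow> nat" where
  "tape_str b s i = content s (i - b)"

definition bit :: "bool \<Rightarrow> nat" where "bit x = (if x then 2 else 1)"

lemma bit_le: "bit x \<le> 2" and bit_neq_0[simp]: "bit x \<noteq> 0"
  by (auto simp: bit_def)

lemma tape_str_Nil[simp]: "tape_str b [] = (\<lambda>_. 0)"
  by (auto simp: tape_str_def content_def)

lemma tape_str_0: "tape_str 0 s = content s"
  by (auto simp: tape_str_def)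

lemma tape_str_read_append[simp]: "tape_str b (s @ x # u) (b + int (length s)) = bit x"
  by (simp add: tape_str_def content_def bit_def nth_append)

lemma tape_str_read_Cons[simp]: "tape_str b (x # u) b = bit x"
  by (simp add: tape_str_def content_def bit_def)

lemma tape_str_read_end: "i < b \<or> b + int (length s) \<le> i \<Longrightarrow> tape_str b s i = 0"
  by (auto simp: tape_str_def content_def)

lemma tape_str_read_end'[simp]: "tape_str b s (b + int (length s)) = 0" "tape_str b s (b - 1) = 0"
  by (auto intro: tape_str_read_end)

lemma tape_str_snoc: "(tape_str b s)(b + int (length s) := bit x) = tape_str b (s @ [x])"
proof
  fix i
  consider "i < b" | "i \<ge> b" "i < b + int (length s)" | "i = b + int (length s)" | "i > b + int (length s)"
    by linarith
  then show "((tape_str b s)(b + int (length s) := bit x)) i = tape_str b (s @ [x]) i"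
    by cases (auto simp: tape_str_def content_def bit_def nth_append nat_less_iff)
qed

lemma tape_str_erase: "(tape_str b (x # s))(b := 0) = tape_str (b + 1) s"
proof
  fix i
  consider "i < b" | "i = b" | "i > b" by linarith
  then show "((tape_str b (x # s))(b := 0)) i = tape_str (b + 1) s i"
  proof cases
    case 3
    then have "nat (i - b) = Suc (nat (i - (b + 1)))" by linarith
    then show ?thesis using 3 by (auto simp: tape_str_def content_def)
  qed (auto simp: tape_str_def content_def)
qed

lemma tape_str_push: "(tape_str b s)(b - 1 := bit x) = tape_str (b - 1) (x # s)"
proof
  fix i
  consider "i < b - 1" | "i = b - 1" | "i > b - 1" by linarith
  then show "((tape_str b s)(b - 1 := bit x)) i = tape_str (b - 1) (x # s) i"
  proof cases
    case 3
    then have "nat (i - (b - 1)) = Suc (nat (i - b))" by linarith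
    then show ?thesis using 3 by (auto simp: tape_str_def content_def)
  qed (auto simp: tape_str_def content_def bit_def)
qed

text \<open>
  A string is at home on a tape if the head is on its first symbol. The position is left open, so that
  the tape is a stack with its top at the head: pushing and popping take constant time.
\<close>

definition home :: "bool list \<Rightarrow> tape \<Rightarrow> bool" where
  "home s tp \<longleftrightarrow> (\<exists>b. tp = (tape_str b s, b))"

text \<open>
  A tape to which \<open>s\<close> has been written from cell \<open>b\<close> on, with the head just behind it.
\<close>

definition written :: "int \<Rightarrow> bool list \<Rightarrow> tape" where
  "written b s = (tape_str b s, b + int (length s))"

lemma home_Nil: "home [] tp \<longleftrightarrow> fst tp = (\<lambda>_. 0)"
  by (cases tp) (auto simp: home_def)

lemma home_read: "home s tp \<Longrightarrow> fst tp (snd tp) = (case s of [] \<Rightarrow> 0 | x # _ \<Rightarrow> bit x)"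
  by (auto simp: home_def split: list.splits)

definition emit :: "nat \<Rightarrow> bool \<Rightarrow> instr list" where
  "emit t x = [Act t (bit x) Move_Right]"

definition pop :: "nat \<Rightarrow> instr list" where
  "pop t = [Act t 0 Move_Right]"

definition push :: "nat \<Rightarrow> bool \<Rightarrow> instr list" where
  "push t x = [Mv t Move_Left, Act t (bit x) Stay]"

definition clear :: "nat \<Rightarrow> instr list" where
  "clear t = while t (pop t)"

definition rewind :: "nat \<Rightarrow> instr list" where
  "rewind t = Mv t Move_Left # while t [Mv t Move_Left] @ [Mv t Move_Right]"

definition copy :: "nat \<Rightarrow> nat \<Rightarrow> instr list" where
  "copy r t = while r (cond r (\<lambda>s. s = 2) (emit t True) (emit t False) @ [Mv r Move_Right])"

lemma runs_emit:
  assumes "\<tau> t = written b s"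
  shows "runs (emit t x) \<tau> 1 (\<tau>(t := written b (s @ [x])))"
proof -
  have "act_on_tape (bit x, Move_Right) (\<tau> t) = written b (s @ [x])"
    using assms by (simp add: act_on_tape_def written_def tape_str_snoc)
  then show ?thesis
    using runs_Act[OF bit_le[of x], of t Move_Right \<tau>] by (simp add: emit_def)
qed

lemma runs_pop:
  assumes "home (x # s) (\<tau> t)"
  shows "\<exists>tp. home s tp \<and> runs (pop t) \<tau> 1 (\<tau>(t := tp))"
proof -
  obtain b where b: "\<tau> t = (tape_str b (x # s), b)" using assms by (auto simp: home_def)
  have "act_on_tape (0, Move_Right) (\<tau> t) = (tape_str (b + 1) s, b + 1)"
    by (simp add: b act_on_tape_def tape_str_erase)
  then show ?thesis
    using runs_Act[of 0 t Move_Right \<tau>] by (auto simp: pop_def home_def)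
qed

lemma runs_pop_Nil:
  assumes "home [] (\<tau> t)"
  shows "\<exists>tp. home [] tp \<and> runs (pop t) \<tau> 1 (\<tau>(t := tp))"
proof -
  have "home [] (act_on_tape (0, Move_Right) (\<tau> t))"
    using assms by (cases "\<tau> t") (auto simp: home_Nil act_on_tape_def)
  then show ?thesis
    using runs_Act[of 0 t Move_Right \<tau>] unfolding pop_def by blast
qed

lemma runs_push:
  assumes "home s (\<tau> t)"
  shows "\<exists>tp. home (x # s) tp \<and> runs (push t x) \<tau> 2 (\<tau>(t := tp))"
proof -
  obtain b where b: "\<tau> t = (tape_str b s, b)" using assms by (auto simp: home_def)
  let ?\<tau> = "\<tau>(t := (fst (\<tau> t), snd (\<tau> t) + displacement Move_Left))"
  have "act_on_tape (bit x, Stay) (?\<tau> t) = (tape_str (b - 1) (x # s), b - 1)"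
    by (simp add: b act_on_tape_def tape_str_push)
  then have "runs [Act t (bit x) Stay] ?\<tau> 1 (\<tau>(t := (tape_str (b - 1) (x # s), b - 1)))"
    using runs_Act[OF bit_le[of x], of t Stay ?\<tau>] by simp
  from runs_append[OF runs_Mv this] show ?thesis
    by (auto simp: push_def home_def numeral_2_eq_2)
qed

lemma runs_clear:
  assumes "home s (\<tau> t)"
  shows "\<exists>tp. home [] tp \<and> runs (clear t) \<tau> (3 * length s + 1) (\<tau>(t := tp))"
  using assms
proof (induction s arbitrary: \<tau>)
  case Nil
  then have "runs (clear t) \<tau> 1 \<tau>"
    unfolding clear_def by (intro runs_while_end) (auto simp: home_def)
  with Nil show ?case by (metis fun_upd_triv list.size(3) mult_0_right add_0)
next
  case (Cons x s)
  obtain tp where tp: "home s tp" "runs (pop t) \<tau> 1 (\<tau>(t := tp))"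
    using runs_pop[where \<tau> = \<tau> and t = t, OF Cons.prems] by blast
  obtain tp' where tp': "home [] tp'"
      "runs (clear t) (\<tau>(t := tp)) (3 * length s + 1) (\<tau>(t := tp'))"
    using Cons.IH[of "\<tau>(t := tp)"] tp(1) by (metis fun_upd_same fun_upd_upd)
  have "fst (\<tau> t) (snd (\<tau> t)) \<noteq> 0" using home_read[OF Cons.prems] by simp
  from runs_while_step[OF this tp(2) tp'(2)[unfolded clear_def]]
  have "runs (clear t) \<tau> (1 + (3 * length s + 1) + 2) (\<tau>(t := tp'))"
    unfolding clear_def .
  moreover have "1 + (3 * length s + 1) + 2 = 3 * length (x # s) + 1" by simp
  ultimately show ?case using tp'(1) by metis
qed

lemma runs_rewind:
  assumes "\<tau> t = written b s"
  shows "runs (rewind t) \<tau> (3 * length s + 3) (\<tau>(t := (tape_str b s, b)))"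
proof -
  have *: "runs (while t [Mv t Move_Left]) (\<tau>(t := (tape_str b s, b - 1 + int k))) (3 * k + 1)
          (\<tau>(t := (tape_str b s, b - 1)))" if "k \<le> length s" for k
    using that
  proof (induction k)
    case 0
    show ?case by (simp, rule runs_while_end[simplified]) simp
  next
    case (Suc k)
    let ?\<tau> = "\<tau>(t := (tape_str b s, b - 1 + int (Suc k)))"
    have "tape_str b s (b + int k) \<noteq> 0" using Suc.prems by (simp add: tape_str_def content_def)
    then have 1: "fst (?\<tau> t) (snd (?\<tau> t)) \<noteq> 0" by simp
    have 2: "runs [Mv t Move_Left] ?\<tau> 1 (\<tau>(t := (tape_str b s, b - 1 + int k)))"
      using runs_Mv[of t Move_Left ?\<tau>] by (simp add: algebra_simps)
    have "1 + (3 * k + 1) + 2 = 3 * Suc k + 1" by simp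
    then show ?case using runs_while_step[OF 1 2 Suc.IH] Suc.prems by (metis Suc_leD)
  qed
  have 1: "runs [Mv t Move_Left] \<tau> 1 (\<tau>(t := (tape_str b s, b - 1 + int (length s))))"
    using runs_Mv[of t Move_Left \<tau>] assms by (simp add: written_def algebra_simps)
  have 3: "runs [Mv t Move_Right] (\<tau>(t := (tape_str b s, b - 1))) 1 (\<tau>(t := (tape_str b s, b)))"
    using runs_Mv[of t Move_Right "\<tau>(t := (tape_str b s, b - 1))"] by simp
  have "1 + ((3 * length s + 1) + 1) = 3 * length s + 3" by simp
  then show ?thesis
    using runs_append[OF 1 runs_append[OF *[OF order_refl] 3]]
    by (metis rewind_def append_Cons append_Nil)
qed

lemma runs_copy:
  assumes "r \<noteq> t" "\<tau> r = (tape_str b (s @ u), b + int (length s))" "\<tau> t = written c w"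
  shows "\<exists>n. n \<le> 6 * length u + 1 \<and>
     runs (copy r t) \<tau> n (\<tau>(r := written b (s @ u), t := written c (w @ u)))"
  using assms
proof (induction u arbitrary: s w \<tau>)
  case Nil
  then have eq: "\<tau>(r := written b (s @ []), t := written c (w @ [])) = \<tau>"
    by (auto simp: written_def fun_eq_iff)
  have "runs (copy r t) \<tau> 1 \<tau>"
    unfolding copy_def using Nil by (intro runs_while_end) simp
  then show ?case unfolding eq by (intro exI[of _ 1]) simp
next
  case (Cons x u)
  let ?\<tau> = "\<tau>(t := written c (w @ [x]))"
  let ?\<tau>' = "?\<tau>(r := (tape_str b (s @ x # u), b + int (length (s @ [x]))))"
  have e: "runs (emit t x) \<tau> 1 ?\<tau>" by (rule runs_emit) fact
  have "\<exists>n\<le>3. runs (cond r (\<lambda>s. s = 2) (emit t True) (emit t False)) \<tau> n ?\<tau>"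
  proof (cases x)
    case True
    then show ?thesis
      using runs_cond_True[where p = "\<lambda>s. s = 2" and t = r and \<tau> = \<tau> and c' = "emit t False"] e Cons.prems(2)
      by (intro exI[of _ 2]) (simp add: bit_def numeral_2_eq_2)
  next
    case False
    then show ?thesis
      using runs_cond_False[where p = "\<lambda>s. s = 2" and t = r and \<tau> = \<tau> and c = "emit t True"] e Cons.prems(2)
      by (intro exI[of _ 3]) (simp add: bit_def numeral_3_eq_3)
  qed
  then obtain n where n: "n \<le> 3"
    "runs (cond r (\<lambda>s. s = 2) (emit t True) (emit t False)) \<tau> n ?\<tau>" by blast
  have m: "runs [Mv r Move_Right] ?\<tau> 1 ?\<tau>'"
    using runs_Mv[of r Move_Right ?\<tau>] Cons.prems(1,2) by (simp add: algebra_simps)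
  have "\<exists>n\<le>6 * length u + 1. runs (copy r t) ?\<tau>' n
      (?\<tau>'(r := written b ((s @ [x]) @ u), t := written c ((w @ [x]) @ u)))"
    by (rule Cons.IH) (use Cons.prems(1) in auto)
  then obtain n' where n': "n' \<le> 6 * length u + 1"
    "runs (copy r t) ?\<tau>' n' (\<tau>(r := written b (s @ x # u), t := written c (w @ x # u)))"
    using Cons.prems(1) by (auto simp: fun_upd_twist)
  have nz: "fst (\<tau> r) (snd (\<tau> r)) \<noteq> 0" using Cons.prems(2) by simp
  have "runs (copy r t) \<tau> ((n + 1) + n' + 2) (\<tau>(r := written b (s @ x # u), t := written c (w @ x # u)))"
    using runs_while_step[OF nz runs_append[OF n(2) m] n'(2)[unfolded copy_def]]
    by (simp add: copy_def)
  moreover have "(n + 1) + n' + 2 \<le> 6 * length (x # u) + 1" using n(1) n'(1) by simp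
  ultimately show ?case by blast
qed

section \<open>Compiling the loop language to Turing machines\<close>

text \<open>
  The code for a program, for a map \<open>\<rho>\<close> from variables to the tapes that hold them at home. The output is
  appended to tape \<open>r\<close>, and the tapes from \<open>d\<close> on are free. A loop keeps its index on tape \<open>d\<close> and the number
  of remaining rounds on tape \<open>d + 1\<close>.
\<close>

primrec compile :: "prog \<Rightarrow> (nat \<Rightarrow> nat) \<Rightarrow> nat \<Rightarrow> nat \<Rightarrow> instr list" where
  "compile Skip \<rho> r d = []"
| "compile (Emit x) \<rho> r d = emit r x"
| "compile (Var v) \<rho> r d = copy (\<rho> v) r @ rewind (\<rho> v)"
| "compile (Seq P Q) \<rho> r d = compile P \<rho> r d @ compile Q \<rho> r d"
| "compile (Let v P Q) \<rho> r d =
     (compile P \<rho> d (Suc d) @ rewind d) @ compile Q (bind v d \<rho>) r (Suc d) @ clear d"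
| "compile (For v P Q) \<rho> r d =
     (compile P \<rho> (Suc d) (Suc (Suc d)) @ rewind (Suc d)) @
     while (Suc d) (pop (Suc d) @ compile Q (bind v d \<rho>) r (Suc (Suc d)) @ push d True) @ clear d"
| "compile (If P Q R) \<rho> r d =
     (compile P \<rho> d (Suc d) @ rewind d) @
     cond d (\<lambda>s. s = 2) (clear d @ compile Q \<rho> r d) (clear d @ compile R \<rho> r d)"
| "compile (Drop P Q) \<rho> r d =
     (compile P \<rho> d (Suc d) @ rewind d) @ (compile Q \<rho> (Suc d) (Suc (Suc d)) @ rewind (Suc d)) @
     while (Suc d) (pop (Suc d) @ pop d) @ copy d r @ rewind d @ clear d"

text \<open>
  The situation in which compiled code is started.
\<close>

definition ready :: "(nat \<Rightarrow> nat) \<Rightarrow> nat \<Rightarrow> nat \<Rightarrow> env \<Rightarrow> store \<Rightarrow> bool" where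
  "ready \<rho> r d e \<tau> \<longleftrightarrow> r < d \<and> (\<forall>v. \<rho> v < d \<and> \<rho> v \<noteq> r \<and> home (e v) (\<tau> (\<rho> v))) \<and>
     (\<forall>t\<ge>d. home [] (\<tau> t))"

text \<open>
  The effect of compiled code: tape \<open>r\<close> has become \<open>tp\<close>, the other tapes in use are unchanged and the free
  ones are blank again.
\<close>

definition outcome :: "nat \<Rightarrow> nat \<Rightarrow> tape \<Rightarrow> store \<Rightarrow> store \<Rightarrow> bool" where
  "outcome r d tp \<tau> \<tau>' \<longleftrightarrow> \<tau>' r = tp \<and> (\<forall>t<d. t \<noteq> r \<longrightarrow> \<tau>' t = \<tau> t) \<and> (\<forall>t\<ge>d. home [] (\<tau>' t))"

text \<open>
  The code of \<open>P\<close> appends the output of \<open>P\<close>, and \<open>p\<close> bounds both the running time and the length of the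
  output in terms of the length of the strings in the environment.
\<close>

definition compiles_within :: "prog \<Rightarrow> nat poly \<Rightarrow> bool" where
  "compiles_within P p \<longleftrightarrow> (\<forall>\<rho> r d e \<tau> b s m. ready \<rho> r d e \<tau> \<longrightarrow> \<tau> r = written b s \<longrightarrow>
     (\<forall>v. length (e v) \<le> m) \<longrightarrow>
     (\<exists>n \<tau>'. n \<le> poly p m \<and> runs (compile P \<rho> r d) \<tau> n \<tau>' \<and>
        outcome r d (written b (s @ sem P e)) \<tau> \<tau>')) \<and>
     (\<forall>e m. (\<forall>v. length (e v) \<le> m) \<longrightarrow> length (sem P e) \<le> poly p m)"

lemma compiles_withinD:
  assumes "compiles_within P p" "ready \<rho> r d e \<tau>" "\<tau> r = written b s" "\<forall>v. length (e v) \<le> m"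
  obtains n \<tau>' where "n \<le> poly p m" "runs (compile P \<rho> r d) \<tau> n \<tau>'"
    "outcome r d (written b (s @ sem P e)) \<tau> \<tau>'"
  using assms unfolding compiles_within_def by blast

lemma compiles_within_length: "compiles_within P p \<Longrightarrow> \<forall>v. length (e v) \<le> m \<Longrightarrow> length (sem P e) \<le> poly p m"
  unfolding compiles_within_def by blast

lemma poly_nat_mono: "x \<le> y \<Longrightarrow> poly (p :: nat poly) x \<le> poly p y"
  by (induction p) (auto intro!: add_mono mult_mono)

lemma blank_written: "home [] tp \<Longrightarrow> \<exists>b. tp = written b []"
  by (cases tp) (auto simp: home_Nil written_def)

text \<open>
  Evaluating a subprogram onto the first free tape and rewinding that tape.
\<close>

lemma eval_compiles_within:
  assumes P: "compiles_within P p" and v: "\<forall>v. \<rho> v < d \<and> home (e v) (\<tau> (\<rho> v))"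
    and bl: "\<forall>t\<ge>d. home [] (\<tau> t)" and m: "\<forall>v. length (e v) \<le> m"
  obtains n \<tau>' where "n \<le> 4 * poly p m + 3" "runs (compile P \<rho> d (Suc d) @ rewind d) \<tau> n \<tau>'"
    "home (sem P e) (\<tau>' d)" "\<forall>t<d. \<tau>' t = \<tau> t" "\<forall>t>d. home [] (\<tau>' t)"
proof -
  obtain b where b: "\<tau> d = written b []" using bl blank_written by blast
  have "ready \<rho> d (Suc d) e \<tau>"
    unfolding ready_def using v bl by (metis Suc_leD lessI less_SucI less_irrefl)
  from compiles_withinD[OF P this b m] obtain n \<tau>' where n: "n \<le> poly p m"
    "runs (compile P \<rho> d (Suc d)) \<tau> n \<tau>'"
    and o: "outcome d (Suc d) (written b (sem P e)) \<tau> \<tau>'" by auto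
  let ?\<tau> = "\<tau>'(d := (tape_str b (sem P e), b))"
  have "\<tau>' d = written b (sem P e)" using o by (simp add: outcome_def)
  from runs_append[OF n(2) runs_rewind[where \<tau> = \<tau>' and t = d, OF this]]
  have "runs (compile P \<rho> d (Suc d) @ rewind d) \<tau> (n + (3 * length (sem P e) + 3)) ?\<tau>" .
  moreover have "n + (3 * length (sem P e) + 3) \<le> 4 * poly p m + 3"
    using n(1) compiles_within_length[OF P m] by linarith
  moreover have "home (sem P e) (?\<tau> d)" by (auto simp: home_def)
  moreover have "\<forall>t<d. ?\<tau> t = \<tau> t" "\<forall>t>d. home [] (?\<tau> t)"
    using o by (auto simp: outcome_def)
  ultimately show thesis using that by blast
qed

lemma compiles_within_Skip: "compiles_within Skip 0"
  unfolding compiles_within_def ready_def outcome_def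
  by (auto intro!: exI[of _ 0] intro: runs_Nil)

lemma compiles_within_Emit: "compiles_within (Emit x) 1"
proof -
  have "\<exists>n \<tau>'. n \<le> 1 \<and> runs (emit r x) \<tau> n \<tau>' \<and> outcome r d (written b (s @ [x])) \<tau> \<tau>'"
    if "ready \<rho> r d e \<tau>" "\<tau> r = written b s" for \<rho> r d e \<tau> b s
    using runs_emit[where x = x and \<tau> = \<tau> and t = r, OF that(2)] that(1)
    by (intro exI[of _ 1] exI[of _ "\<tau>(r := written b (s @ [x]))"])
      (auto simp: outcome_def ready_def)
  then show ?thesis unfolding compiles_within_def by simp
qed

lemma compiles_within_Var: "compiles_within (Var v) [:4, 9:]"
proof -
  have "\<exists>n \<tau>'. n \<le> poly [:4, 9:] m \<and> runs (compile (Var v) \<rho> r d) \<tau> n \<tau>' \<and>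
      outcome r d (written b (s @ sem (Var v) e)) \<tau> \<tau>'"
    if r: "ready \<rho> r d e \<tau>" and w: "\<tau> r = written b s" and m: "\<forall>v. length (e v) \<le> m"
    for \<rho> r d e \<tau> b s m
  proof -
    have ne: "\<rho> v \<noteq> r" using r by (auto simp: ready_def)
    obtain c where c: "\<tau> (\<rho> v) = (tape_str c (e v), c)" using r by (auto simp: ready_def home_def)
    let ?\<tau> = "\<tau>(\<rho> v := written c (e v), r := written b (s @ e v))"
    let ?\<tau>' = "?\<tau>(\<rho> v := (tape_str c (e v), c))"
    obtain n where n: "n \<le> 6 * length (e v) + 1" "runs (copy (\<rho> v) r) \<tau> n ?\<tau>"
      using runs_copy[OF ne, of \<tau> c "[]" "e v" b s] c w by auto
    have "?\<tau> (\<rho> v) = written c (e v)" using ne by simp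
    from runs_append[OF n(2) runs_rewind[where \<tau> = ?\<tau> and t = "\<rho> v", OF this]]
    have "runs (compile (Var v) \<rho> r d) \<tau> (n + (3 * length (e v) + 3)) ?\<tau>'" by simp
    moreover have "n + (3 * length (e v) + 3) \<le> poly [:4, 9:] m"
      using n(1) m[rule_format, of v] by simp
    moreover have "outcome r d (written b (s @ sem (Var v) e)) \<tau> ?\<tau>'"
      using r c ne by (auto simp: outcome_def ready_def)
    ultimately show ?thesis by blast
  qed
  moreover have "length (sem (Var v) e) \<le> poly [:4, 9:] m" if "\<forall>v. length (e v) \<le> m" for e m
    using that[rule_format, of v] by simp
  ultimately show ?thesis unfolding compiles_within_def by blast
qed

lemma outcome_ready:
  assumes "ready \<rho> r d e \<tau>" "outcome r d tp \<tau> \<tau>'"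
  shows "ready \<rho> r d e \<tau>'"
  using assms unfolding ready_def outcome_def by metis

lemma compiles_within_Seq:
  assumes P: "compiles_within P p" and Q: "compiles_within Q q"
  shows "compiles_within (Seq P Q) (p + q)"
proof -
  have "\<exists>n \<tau>'. n \<le> poly (p + q) m \<and> runs (compile (Seq P Q) \<rho> r d) \<tau> n \<tau>' \<and>
      outcome r d (written b (s @ sem (Seq P Q) e)) \<tau> \<tau>'"
    if r: "ready \<rho> r d e \<tau>" and w: "\<tau> r = written b s" and m: "\<forall>v. length (e v) \<le> m"
    for \<rho> r d e \<tau> b s m
  proof -
    obtain n1 \<tau>1 where 1: "n1 \<le> poly p m" "runs (compile P \<rho> r d) \<tau> n1 \<tau>1"
      "outcome r d (written b (s @ sem P e)) \<tau> \<tau>1" by (rule compiles_withinD[OF P r w m])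
    have w1: "\<tau>1 r = written b (s @ sem P e)" using 1(3) by (simp add: outcome_def)
    obtain n2 \<tau>2 where 2: "n2 \<le> poly q m" "runs (compile Q \<rho> r d) \<tau>1 n2 \<tau>2"
      "outcome r d (written b ((s @ sem P e) @ sem Q e)) \<tau>1 \<tau>2"
      by (rule compiles_withinD[OF Q outcome_ready[OF r 1(3)] w1 m])
    show ?thesis
      using runs_append[OF 1(2) 2(2)] 1(1,3) 2(1,3)
      by (intro exI[of _ "n1 + n2"] exI[of _ \<tau>2]) (auto simp: outcome_def)
  qed
  then show ?thesis
    using compiles_within_length[OF P] compiles_within_length[OF Q] unfolding compiles_within_def by (auto intro: add_mono)
qed

lemma bind_home:
  assumes "\<forall>v. \<rho> v < d \<and> \<rho> v \<noteq> r \<and> home (e v) (\<tau> (\<rho> v))" "r < d" "d < d'" "home x (\<tau> d)"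
    "\<forall>t\<ge>d'. home [] (\<tau> t)"
  shows "ready (bind v d \<rho>) r d' (bind v x e) \<tau>"
  using assms unfolding ready_def bind_def
  by (auto intro: less_trans)

lemma bind_length:
  "\<forall>v. length (e v) \<le> m \<Longrightarrow> length x \<le> k \<Longrightarrow> \<forall>w. length (bind v x e w) \<le> m + k"
  by (auto simp: bind_def trans_le_add1)

abbreviation id_poly :: "nat poly" where "id_poly \<equiv> [:0, 1:]"

lemma compiles_within_Let:
  assumes P: "compiles_within P p" and Q: "compiles_within Q q"
  shows "compiles_within (Let v P Q) (7 * p + 4 + q \<circ>\<^sub>p (id_poly + p))"
proof -
  let ?p = "7 * p + 4 + q \<circ>\<^sub>p (id_poly + p)"
  have pp: "poly ?p m = 7 * poly p m + 4 + poly q (m + poly p m)" for m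
    by (simp add: poly_pcompose)
  have mm: "\<forall>w. length (bind v (sem P e) e w) \<le> m + poly p m" if "\<forall>v. length (e v) \<le> m" for e m
    using bind_length[OF that compiles_within_length[OF P that]] .
  have "\<exists>n \<tau>'. n \<le> poly ?p m \<and> runs (compile (Let v P Q) \<rho> r d) \<tau> n \<tau>' \<and>
      outcome r d (written b (s @ sem (Let v P Q) e)) \<tau> \<tau>'"
    if r: "ready \<rho> r d e \<tau>" and w: "\<tau> r = written b s" and m: "\<forall>v. length (e v) \<le> m"
    for \<rho> r d e \<tau> b s m
  proof -
    have a: "\<forall>v. \<rho> v < d \<and> home (e v) (\<tau> (\<rho> v))" "\<forall>t\<ge>d. home [] (\<tau> t)"
      using r by (auto simp: ready_def)
    obtain n1 \<tau>1 where 1: "n1 \<le> 4 * poly p m + 3" "runs (compile P \<rho> d (Suc d) @ rewind d) \<tau> n1 \<tau>1"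
      "home (sem P e) (\<tau>1 d)" "\<forall>t<d. \<tau>1 t = \<tau> t" "\<forall>t>d. home [] (\<tau>1 t)"
      by (rule eval_compiles_within[OF P a m])
    have r1: "ready (bind v d \<rho>) r (Suc d) (bind v (sem P e) e) \<tau>1"
      using r 1 by (intro bind_home) (auto simp: ready_def)
    have w1: "\<tau>1 r = written b s" using w r 1(4) by (auto simp: ready_def)
    obtain n2 \<tau>2 where 2: "n2 \<le> poly q (m + poly p m)"
      "runs (compile Q (bind v d \<rho>) r (Suc d)) \<tau>1 n2 \<tau>2"
      "outcome r (Suc d) (written b (s @ sem Q (bind v (sem P e) e))) \<tau>1 \<tau>2"
      by (rule compiles_withinD[OF Q r1 w1 mm[OF m]])
    have rd: "r < d" using r by (simp add: ready_def)
    have h2: "home (sem P e) (\<tau>2 d)" using 2(3) 1(3) rd by (auto simp: outcome_def)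
    obtain tp where 3: "home [] tp" "runs (clear d) \<tau>2 (3 * length (sem P e) + 1) (\<tau>2(d := tp))"
      using runs_clear[where \<tau> = \<tau>2 and t = d, OF h2] by blast
    have "runs (compile (Let v P Q) \<rho> r d) \<tau> (n1 + (n2 + (3 * length (sem P e) + 1))) (\<tau>2(d := tp))"
      using runs_append[OF 1(2) runs_append[OF 2(2) 3(2)]] by simp
    moreover have "n1 + (n2 + (3 * length (sem P e) + 1)) \<le> poly ?p m"
      using 1(1) 2(1) compiles_within_length[OF P m] unfolding pp by linarith
    moreover have "outcome r d (written b (s @ sem (Let v P Q) e)) \<tau> (\<tau>2(d := tp))"
      using 1(4) 2(3) 3(1) rd by (auto simp: outcome_def)
    ultimately show ?thesis by blast
  qed
  moreover have "length (sem (Let v P Q) e) \<le> poly ?p m" if "\<forall>v. length (e v) \<le> m" for e m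
    using compiles_within_length[OF Q mm[OF that]] unfolding pp by simp
  ultimately show ?thesis unfolding compiles_within_def by blast
qed

lemma compiles_within_If:
  assumes P: "compiles_within P p" and Q: "compiles_within Q q" and R: "compiles_within R r'"
  shows "compiles_within (If P Q R) (7 * p + 6 + q + r')"
proof -
  let ?p = "7 * p + 6 + q + r'"
  have "\<exists>n \<tau>'. n \<le> poly ?p m \<and> runs (compile (If P Q R) \<rho> r d) \<tau> n \<tau>' \<and>
      outcome r d (written b (s @ sem (If P Q R) e)) \<tau> \<tau>'"
    if r: "ready \<rho> r d e \<tau>" and w: "\<tau> r = written b s" and m: "\<forall>v. length (e v) \<le> m"
    for \<rho> r d e \<tau> b s m
  proof -
    have a: "\<forall>v. \<rho> v < d \<and> home (e v) (\<tau> (\<rho> v))" "\<forall>t\<ge>d. home [] (\<tau> t)"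
      using r by (auto simp: ready_def)
    obtain n1 \<tau>1 where 1: "n1 \<le> 4 * poly p m + 3" "runs (compile P \<rho> d (Suc d) @ rewind d) \<tau> n1 \<tau>1"
      "home (sem P e) (\<tau>1 d)" "\<forall>t<d. \<tau>1 t = \<tau> t" "\<forall>t>d. home [] (\<tau>1 t)"
      by (rule eval_compiles_within[OF P a m])
    obtain tp where 2: "home [] tp" "runs (clear d) \<tau>1 (3 * length (sem P e) + 1) (\<tau>1(d := tp))"
      using runs_clear[where \<tau> = \<tau>1 and t = d, OF 1(3)] by blast
    let ?\<tau> = "\<tau>1(d := tp)"
    have rd: "r < d" using r by (simp add: ready_def)
    have r2: "ready \<rho> r d e ?\<tau>"
      using r 1 2(1) unfolding ready_def by (auto simp: less_imp_neq)
    have w2: "?\<tau> r = written b s" using w rd 1(4) by auto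
    define B where "B = (take 1 (sem P e) = [True])"
    have B: "B \<longleftrightarrow> fst (\<tau>1 d) (snd (\<tau>1 d)) = 2"
      using home_read[OF 1(3)] by (auto simp: B_def bit_def split: list.splits)
    define C where "C = (if B then Q else R)"
    define c where "c = (if B then q else r')"
    have "compiles_within C c" using Q R by (simp add: C_def c_def)
    then obtain n3 \<tau>3 where 3: "n3 \<le> poly c m"
      "runs (compile C \<rho> r d) ?\<tau> n3 \<tau>3" "outcome r d (written b (s @ sem C e)) ?\<tau> \<tau>3"
      by (rule compiles_withinD[OF _ r2 w2 m])
    have "poly c m \<le> poly q m + poly r' m" by (simp add: c_def)
    let ?n = "3 * length (sem P e) + 1 + n3"
    have C: "runs (clear d @ compile C \<rho> r d) \<tau>1 ?n \<tau>3" using runs_append[OF 2(2) 3(2)] .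
    have "\<exists>k\<le>2. runs (cond d (\<lambda>s. s = 2) (clear d @ compile Q \<rho> r d) (clear d @ compile R \<rho> r d))
        \<tau>1 (?n + k) \<tau>3"
    proof (cases B)
      case True
      have "fst (\<tau>1 d) (snd (\<tau>1 d)) = 2" using True B by simp
      from runs_cond_True[where p = "\<lambda>s. s = 2", OF this C] True show ?thesis
        unfolding C_def by (metis one_le_numeral)
    next
      case False
      have "fst (\<tau>1 d) (snd (\<tau>1 d)) \<noteq> 2" using False B by simp
      from runs_cond_False[where p = "\<lambda>s. s = 2", OF this C] False show ?thesis
        unfolding C_def by (metis order_refl)
    qed
    then obtain k where k: "k \<le> 2"
      "runs (cond d (\<lambda>s. s = 2) (clear d @ compile Q \<rho> r d) (clear d @ compile R \<rho> r d)) \<tau>1 (?n + k) \<tau>3"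
      by blast
    have "runs (compile (If P Q R) \<rho> r d) \<tau> (n1 + (?n + k)) \<tau>3"
      using runs_append[OF 1(2) k(2)] by simp
    moreover have "n1 + (?n + k) \<le> poly ?p m"
      using 1(1) 3(1) k(1) compiles_within_length[OF P m] \<open>poly c m \<le> poly q m + poly r' m\<close> by simp
    moreover have "outcome r d (written b (s @ sem (If P Q R) e)) \<tau> \<tau>3"
      using 1(4) 3(3) rd by (auto simp: outcome_def C_def B_def)
    ultimately show ?thesis by blast
  qed
  moreover have "length (sem (If P Q R) e) \<le> poly ?p m" if "\<forall>v. length (e v) \<le> m" for e m
    using compiles_within_length[OF Q that] compiles_within_length[OF R that] by simp
  ultimately show ?thesis unfolding compiles_within_def by blast
qed

lemma compiles_within_Drop:
  assumes P: "compiles_within P p" and Q: "compiles_within Q q"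
  shows "compiles_within (Drop P Q) (16 * p + 9 * q + 12)"
proof -
  let ?p = "16 * p + 9 * q + 12"
  have "\<exists>n \<tau>'. n \<le> poly ?p m \<and> runs (compile (Drop P Q) \<rho> r d) \<tau> n \<tau>' \<and>
      outcome r d (written b (s @ sem (Drop P Q) e)) \<tau> \<tau>'"
    if r: "ready \<rho> r d e \<tau>" and w: "\<tau> r = written b s" and m: "\<forall>v. length (e v) \<le> m"
    for \<rho> r d e \<tau> b s m
  proof -
    let ?d = "Suc d"
    let ?W = "while ?d (pop ?d @ pop d)"
    have rd: "r < d" using r by (simp add: ready_def)
    have a: "\<forall>v. \<rho> v < d \<and> home (e v) (\<tau> (\<rho> v))" "\<forall>t\<ge>d. home [] (\<tau> t)"
      using r by (auto simp: ready_def)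
    obtain n1 \<tau>1 where 1: "n1 \<le> 4 * poly p m + 3" "runs (compile P \<rho> d ?d @ rewind d) \<tau> n1 \<tau>1"
      "home (sem P e) (\<tau>1 d)" "\<forall>t<d. \<tau>1 t = \<tau> t" "\<forall>t>d. home [] (\<tau>1 t)"
      by (rule eval_compiles_within[OF P a m])
    have a1: "\<forall>v. \<rho> v < ?d \<and> home (e v) (\<tau>1 (\<rho> v))" "\<forall>t\<ge>?d. home [] (\<tau>1 t)"
      using a 1 by (auto simp: less_SucI)
    obtain n2 \<tau>2 where 2: "n2 \<le> 4 * poly q m + 3" "runs (compile Q \<rho> ?d (Suc ?d) @ rewind ?d) \<tau>1 n2 \<tau>2"
      "home (sem Q e) (\<tau>2 ?d)" "\<forall>t<?d. \<tau>2 t = \<tau>1 t" "\<forall>t>?d. home [] (\<tau>2 t)"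
      by (rule eval_compiles_within[OF Q a1 m])
    have loop: "\<exists>tp tp'. home (drop (length v) u) tp \<and> home [] tp' \<and>
        runs ?W \<sigma> (4 * length v + 1) (\<sigma>(d := tp, ?d := tp'))"
      if "home u (\<sigma> d)" "home v (\<sigma> ?d)" for u v \<sigma>
      using that
    proof (induction v arbitrary: u \<sigma>)
      case Nil
      then have "runs ?W \<sigma> 1 \<sigma>" using home_read[OF Nil(2)] by (intro runs_while_end) simp
      then have "runs ?W \<sigma> (4 * length [] + 1) (\<sigma>(d := \<sigma> d, ?d := \<sigma> ?d))"
        unfolding fun_upd_triv by simp
      moreover have "home (drop (length []) u) (\<sigma> d)" "home [] (\<sigma> ?d)" using Nil by simp_all
      ultimately show ?case by blast
    next
      case (Cons x v)
      obtain tp1 where t1: "home v tp1" "runs (pop ?d) \<sigma> 1 (\<sigma>(?d := tp1))"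
        using runs_pop[where \<tau> = \<sigma> and t = ?d, OF Cons.prems(2)] by blast
      let ?\<sigma> = "\<sigma>(?d := tp1)"
      have h: "home u (?\<sigma> d)" using Cons.prems(1) by simp
      have "\<exists>tp. home (drop 1 u) tp \<and> runs (pop d) ?\<sigma> 1 (?\<sigma>(d := tp))"
      proof (cases u)
        case Nil
        then show ?thesis using runs_pop_Nil[where \<tau> = ?\<sigma> and t = d] h by auto
      next
        case (Cons y ys)
        then show ?thesis using runs_pop[where \<tau> = ?\<sigma> and t = d and x = y and s = ys] h by simp
      qed
      then obtain tp2 where t2: "home (drop 1 u) tp2" "runs (pop d) ?\<sigma> 1 (?\<sigma>(d := tp2))"
        by blast
      let ?\<sigma>2 = "?\<sigma>(d := tp2)"
      have "home (drop 1 u) (?\<sigma>2 d)" "home v (?\<sigma>2 ?d)" using t1(1) t2(1) by simp_all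
      from Cons.IH[OF this]
      obtain tp tp' where t3: "home (drop (length v) (drop 1 u)) tp" "home [] tp'"
        "runs ?W ?\<sigma>2 (4 * length v + 1) (?\<sigma>2(d := tp, ?d := tp'))"
        by blast
      have nz: "fst (\<sigma> ?d) (snd (\<sigma> ?d)) \<noteq> 0" using home_read[OF Cons.prems(2)] by simp
      have "runs ?W \<sigma> ((1 + 1) + (4 * length v + 1) + 2) (?\<sigma>2(d := tp, ?d := tp'))"
        by (rule runs_while_step[OF nz runs_append[OF t1(2) t2(2)] t3(3)])
      moreover have "?\<sigma>2(d := tp, ?d := tp') = \<sigma>(d := tp, ?d := tp')" by auto
      moreover have "(1 + 1) + (4 * length v + 1) + 2 = 4 * length (x # v) + 1" by simp
      moreover have "drop (length v) (drop 1 u) = drop (length (x # v)) u" by simp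
      ultimately show ?case using t3(1,2) by metis
    qed
    let ?x = "sem (Drop P Q) e"
    have "home (sem P e) (\<tau>2 d)" using 1(3) 2(4) by simp
    from loop[OF this 2(3)] obtain tp tp' where 3: "home ?x tp" "home [] tp'"
      "runs ?W \<tau>2 (4 * length (sem Q e) + 1) (\<tau>2(d := tp, ?d := tp'))" by auto
    let ?\<tau>3 = "\<tau>2(d := tp, ?d := tp')"
    obtain c where c: "tp = (tape_str c ?x, c)" using 3(1) by (auto simp: home_def)
    let ?\<tau>4 = "?\<tau>3(d := written c ?x, r := written b (s @ ?x))"
    have w3: "?\<tau>3 r = written b s" using w rd 1(4) 2(4) by auto
    obtain n4 where 4: "n4 \<le> 6 * length ?x + 1" "runs (copy d r) ?\<tau>3 n4 ?\<tau>4"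
      using runs_copy[of d r ?\<tau>3 c "[]" ?x b s] rd c w3 by auto
    let ?\<tau>5 = "?\<tau>4(d := (tape_str c ?x, c))"
    have 5: "runs (rewind d) ?\<tau>4 (3 * length ?x + 3) ?\<tau>5"
      using rd by (intro runs_rewind) simp
    have "home ?x (?\<tau>5 d)" by (auto simp: home_def)
    then obtain tp6 where 6: "home [] tp6" "runs (clear d) ?\<tau>5 (3 * length ?x + 1) (?\<tau>5(d := tp6))"
      using runs_clear[where \<tau> = ?\<tau>5 and t = d] by blast
    let ?n = "n1 + (n2 + ((4 * length (sem Q e) + 1) + (n4 + ((3 * length ?x + 3) + (3 * length ?x + 1)))))"
    have "runs (compile (Drop P Q) \<rho> r d) \<tau> ?n (?\<tau>5(d := tp6))"
      unfolding compile.simps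
      by (intro runs_append[OF 1(2)] runs_append[OF 2(2)] runs_append[OF 3(3)] runs_append[OF 4(2)]
          runs_append[OF 5 6(2)])
    moreover have "?n \<le> poly ?p m"
    proof -
      have "length ?x \<le> poly p m" using compiles_within_length[OF P m] by simp
      then show ?thesis
        using 1(1) 2(1) 4(1) compiles_within_length[OF P m] compiles_within_length[OF Q m] by simp
    qed
    moreover have "outcome r d (written b (s @ ?x)) \<tau> (?\<tau>5(d := tp6))"
      using 1(4) 2(4,5) 3(2) 6(1) rd by (auto simp: outcome_def)
    ultimately show ?thesis by blast
  qed
  moreover have "length (sem (Drop P Q) e) \<le> poly ?p m" if "\<forall>v. length (e v) \<le> m" for e m
    using compiles_within_length[OF P that] by simp
  ultimately show ?thesis unfolding compiles_within_def by blast
qed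

lemma compiles_within_For:
  assumes P: "compiles_within P p" and Q: "compiles_within Q q"
  shows "compiles_within (For v P Q) (4 * p + 8 + p * (q \<circ>\<^sub>p (id_poly + p) + 8))"
proof -
  let ?p = "4 * p + 8 + p * (q \<circ>\<^sub>p (id_poly + p) + 8)"
  have pp: "poly ?p m = 4 * poly p m + 8 + poly p m * (poly q (m + poly p m) + 8)" for m
    by (simp add: poly_pcompose)
  have mm: "\<forall>w. length (bind v (replicate i True) e w) \<le> m + poly p m"
    if "\<forall>v. length (e v) \<le> m" "i \<le> length (sem P e)" for e m i
    using bind_length[OF that(1), of "replicate i True" "poly p m"] compiles_within_length[OF P that(1)] that(2)
    by simp
  have "\<exists>n \<tau>'. n \<le> poly ?p m \<and> runs (compile (For v P Q) \<rho> r d) \<tau> n \<tau>' \<and>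
      outcome r d (written b (s @ sem (For v P Q) e)) \<tau> \<tau>'"
    if r: "ready \<rho> r d e \<tau>" and w: "\<tau> r = written b s" and m: "\<forall>v. length (e v) \<le> m"
    for \<rho> r d e \<tau> b s m
  proof -
    let ?d = "Suc d" and ?dd = "Suc (Suc d)"
    define B where "B = poly q (m + poly p m)"
    define N where "N = length (sem P e)"
    let ?body = "\<lambda>i. sem Q (bind v (replicate i True) e)"
    let ?W = "while ?d (pop ?d @ compile Q (bind v d \<rho>) r ?dd @ push d True)"
    have rd: "r < d" using r by (simp add: ready_def)
    have a: "\<forall>v. \<rho> v < ?d \<and> home (e v) (\<tau> (\<rho> v))" "\<forall>t\<ge>?d. home [] (\<tau> t)" "home [] (\<tau> d)"
      using r by (auto simp: ready_def less_SucI)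
    obtain n1 \<tau>1 where 1: "n1 \<le> 4 * poly p m + 3" "runs (compile P \<rho> ?d ?dd @ rewind ?d) \<tau> n1 \<tau>1"
      "home (sem P e) (\<tau>1 ?d)" "\<forall>t<?d. \<tau>1 t = \<tau> t" "\<forall>t>?d. home [] (\<tau>1 t)"
      by (rule eval_compiles_within[OF P a(1,2) m])
    have loop: "\<exists>n \<tau>'. n \<le> length u * (B + 5) + 1 \<and> runs ?W \<sigma> n \<tau>' \<and>
          \<tau>' r = written b (z @ concat (map ?body [i..<N])) \<and>
          (\<forall>t<d. t \<noteq> r \<longrightarrow> \<tau>' t = \<tau> t) \<and> home (replicate N True) (\<tau>' d) \<and> (\<forall>t>d. home [] (\<tau>' t))"
      if "i + length u = N" "home u (\<sigma> ?d)" "\<sigma> r = written b z" "home (replicate i True) (\<sigma> d)"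
        "\<forall>t<d. t \<noteq> r \<longrightarrow> \<sigma> t = \<tau> t" "\<forall>t\<ge>?dd. home [] (\<sigma> t)" for i u \<sigma> z
      using that
    proof (induction u arbitrary: i \<sigma> z)
      case Nil
      have "runs ?W \<sigma> 1 \<sigma>" using home_read[OF Nil(2)] by (intro runs_while_end) simp
      moreover have "home [] (\<sigma> t)" if "t > d" for t
        using Nil.prems(2,6) that by (cases "t = ?d") auto
      ultimately show ?case using Nil by (intro exI[of _ 1] exI[of _ \<sigma>]) auto
    next
      case (Cons x u)
      obtain tp1 where t1: "home u tp1" "runs (pop ?d) \<sigma> 1 (\<sigma>(?d := tp1))"
        using runs_pop[where \<tau> = \<sigma> and t = ?d, OF Cons.prems(2)] by blast
      let ?\<sigma> = "\<sigma>(?d := tp1)"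
      have "home (e v) (?\<sigma> (\<rho> v)) \<and> \<rho> v < d \<and> \<rho> v \<noteq> r" for v
      proof -
        have v: "\<rho> v < d" "\<rho> v \<noteq> r" "home (e v) (\<tau> (\<rho> v))" using r by (auto simp: ready_def)
        then have "?\<sigma> (\<rho> v) = \<tau> (\<rho> v)" using Cons.prems(5) by simp
        with v show ?thesis by simp
      qed
      then have rdy: "ready (bind v d \<rho>) r ?dd (bind v (replicate i True) e) ?\<sigma>"
        using Cons.prems(4,6) rd by (intro bind_home) auto
      have i: "i < N" using Cons.prems(1) by simp
      have wr: "?\<sigma> r = written b z" using Cons.prems(3) rd by simp
      have mi: "\<forall>w. length (bind v (replicate i True) e w) \<le> m + poly p m"
        using mm[OF m, of i] i by (simp add: N_def)
      obtain n2 \<sigma>2 where 2: "n2 \<le> B" "runs (compile Q (bind v d \<rho>) r ?dd) ?\<sigma> n2 \<sigma>2"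
        "outcome r ?dd (written b (z @ ?body i)) ?\<sigma> \<sigma>2"
        unfolding B_def
        by (rule compiles_withinD[OF Q rdy wr mi])
      have h2: "home (replicate i True) (\<sigma>2 d)"
        using 2(3) Cons.prems(4) rd by (auto simp: outcome_def)
      obtain tp3 where 3: "home (True # replicate i True) tp3"
        "runs (push d True) \<sigma>2 2 (\<sigma>2(d := tp3))"
        using runs_push[where \<tau> = \<sigma>2 and t = d and x = True, OF h2] by blast
      let ?\<sigma>3 = "\<sigma>2(d := tp3)"
      have "\<exists>n \<tau>'. n \<le> length u * (B + 5) + 1 \<and> runs ?W ?\<sigma>3 n \<tau>' \<and>
          \<tau>' r = written b ((z @ ?body i) @ concat (map ?body [Suc i..<N])) \<and>
          (\<forall>t<d. t \<noteq> r \<longrightarrow> \<tau>' t = \<tau> t) \<and> home (replicate N True) (\<tau>' d) \<and> (\<forall>t>d. home [] (\<tau>' t))"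
        using 2(3) 3(1) t1(1) rd Cons.prems(1,5,6)
        by (intro Cons.IH) (auto simp: outcome_def)
      then obtain n4 \<tau>4 where 4: "n4 \<le> length u * (B + 5) + 1" "runs ?W ?\<sigma>3 n4 \<tau>4"
        "\<tau>4 r = written b ((z @ ?body i) @ concat (map ?body [Suc i..<N]))"
        "\<forall>t<d. t \<noteq> r \<longrightarrow> \<tau>4 t = \<tau> t" "home (replicate N True) (\<tau>4 d)" "\<forall>t>d. home [] (\<tau>4 t)"
        by blast
      have nz: "fst (\<sigma> ?d) (snd (\<sigma> ?d)) \<noteq> 0" using home_read[OF Cons.prems(2)] by simp
      have "runs ?W \<sigma> ((1 + (n2 + 2)) + n4 + 2) \<tau>4"
        by (rule runs_while_step[OF nz runs_append[OF t1(2) runs_append[OF 2(2) 3(2)]] 4(2)])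
      moreover have "(1 + (n2 + 2)) + n4 + 2 \<le> length (x # u) * (B + 5) + 1"
        using 2(1) 4(1) by simp
      moreover have "\<tau>4 r = written b (z @ concat (map ?body [i..<N]))"
        using 4(3) i by (simp add: upt_conv_Cons)
      ultimately show ?case using 4(4-6) by blast
    qed
    have "\<exists>n \<tau>'. n \<le> length (sem P e) * (B + 5) + 1 \<and> runs ?W \<tau>1 n \<tau>' \<and>
          \<tau>' r = written b (s @ concat (map ?body [0..<N])) \<and>
          (\<forall>t<d. t \<noteq> r \<longrightarrow> \<tau>' t = \<tau> t) \<and> home (replicate N True) (\<tau>' d) \<and> (\<forall>t>d. home [] (\<tau>' t))"
      using 1 a(3) rd w by (intro loop) (auto simp: N_def)
    then obtain n2 \<tau>2 where 2: "n2 \<le> N * (B + 5) + 1" "runs ?W \<tau>1 n2 \<tau>2"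
      "\<tau>2 r = written b (s @ sem (For v P Q) e)"
      "\<forall>t<d. t \<noteq> r \<longrightarrow> \<tau>2 t = \<tau> t" "home (replicate N True) (\<tau>2 d)" "\<forall>t>d. home [] (\<tau>2 t)"
      unfolding N_def sem.simps by blast
    obtain tp where 3: "home [] tp" "runs (clear d) \<tau>2 (3 * N + 1) (\<tau>2(d := tp))"
      using runs_clear[where \<tau> = \<tau>2 and t = d, OF 2(5)] by auto
    have "runs (compile (For v P Q) \<rho> r d) \<tau> (n1 + (n2 + (3 * N + 1))) (\<tau>2(d := tp))"
      unfolding compile.simps by (intro runs_append[OF 1(2)] runs_append[OF 2(2) 3(2)])
    moreover have "n1 + (n2 + (3 * N + 1)) \<le> poly ?p m"
    proof -
      have "N \<le> poly p m" using compiles_within_length[OF P m] by (simp add: N_def)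
      then have "N * (B + 8) \<le> poly p m * (B + 8)" by (rule mult_right_mono) simp
      then show ?thesis using 1(1) 2(1) unfolding pp B_def[symmetric] by (simp add: algebra_simps)
    qed
    moreover have "outcome r d (written b (s @ sem (For v P Q) e)) \<tau> (\<tau>2(d := tp))"
      using 2(3,4,6) 3(1) rd by (auto simp: outcome_def)
    ultimately show ?thesis by blast
  qed
  moreover have "length (sem (For v P Q) e) \<le> poly ?p m" if m: "\<forall>v. length (e v) \<le> m" for e m
  proof -
    let ?B = "poly q (m + poly p m)"
    have "length (sem (For v P Q) e) \<le> sum_list (map (\<lambda>_. ?B) [0..<length (sem P e)])"
      unfolding sem.simps length_concat map_map
      using compiles_within_length[OF Q mm[OF m]] by (intro sum_list_mono) simp
    also have "\<dots> \<le> poly p m * ?B"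
      using compiles_within_length[OF P m] by (simp add: sum_list_triv mult_right_mono)
    also have "\<dots> \<le> poly ?p m" unfolding pp by (simp add: algebra_simps)
    finally show ?thesis .
  qed
  ultimately show ?thesis unfolding compiles_within_def by blast
qed

theorem compiles_within_ex: "\<exists>p. compiles_within P p"
proof (induction P)
qed (blast intro: compiles_within_Skip compiles_within_Emit compiles_within_Var compiles_within_Seq compiles_within_Let compiles_within_For compiles_within_If compiles_within_Drop)+

section \<open>Code as Turing machines\<close>

primrec itape :: "instr \<Rightarrow> nat" where
  "itape (Act t w d) = t"
| "itape (Mv t d) = t"
| "itape (Branch t p off) = t"

text \<open>
  The Turing machine with \<open>k\<close> tapes that executes the code \<open>cs\<close>; a state is a position in the code.
\<close>

definition machine :: "nat \<Rightarrow> instr list \<Rightarrow> tm" where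
  "machine k cs = \<lparr>tape_count = k, symbol_count = 3, state_count = length cs,
     transition = (\<lambda>q ss. let keep = map (\<lambda>s. (s, Stay)) ss in
       (case cs ! q of
          Act t w d \<Rightarrow> (Suc q, keep[t := (min 2 w, d)])
        | Mv t d \<Rightarrow> (Suc q, keep[t := (ss ! t, d)])
        | Branch t p off \<Rightarrow>
            (if p (ss ! t) then min (length cs) (nat (int q + off)) else Suc q, keep)))\<rparr>"

lemma is_tm_machine:
  assumes "0 < k" "\<forall>i\<in>set cs. itape i < k"
  shows "is_tm (machine k cs)"
proof -
  have "case transition (machine k cs) q ss of (q', acts) \<Rightarrow>
          q' \<le> length cs \<and> length acts = k \<and> (\<forall>(s, d)\<in>set acts. s < 3)"
    if q: "q < length cs" and ss: "ss \<in> tuples {..<3} k" for q ss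
  proof -
    have len: "length ss = k" and s3: "\<forall>s\<in>set ss. s < 3" using ss by (auto simp: tuples_def)
    have t: "itape (cs ! q) < k" using assms(2) q by simp
    have upd: "\<forall>(s, d)\<in>set ((map (\<lambda>s. (s, Stay)) ss)[t := (w, d)]). s < 3" if "w < 3" for t w d
      using s3 that by (auto dest!: set_update_subset_insert[THEN subsetD])
    show ?thesis
    proof (cases "cs ! q")
      case (Act t w d)
      then show ?thesis using upd[of "min 2 w" t d] q len by (simp add: machine_def Let_def)
    next
      case (Mv t d)
      have "ss ! t < 3" using s3 t len Mv by simp
      then show ?thesis using upd[of "ss ! t" t d] q len Mv by (simp add: machine_def Let_def)
    next
      case (Branch t p off)
      then show ?thesis using q len s3 by (auto simp: machine_def Let_def)
    qed
  qed
  then show ?thesis using assms(1) by (simp add: is_tm_def machine_def Let_def)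
qed

text \<open>
  The machine configuration for a position in the code and a store, of which it sees \<open>k\<close> tapes.
\<close>

definition view :: "nat \<Rightarrow> nat \<times> store \<Rightarrow> config" where
  "view k c = (fst c, map (snd c) [0..<k])"

lemma act_keep: "map2 act_on_tape (map (\<lambda>s. (s, Stay)) (map (\<lambda>(t, h). t h) tps)) tps = tps"
  by (rule nth_equalityI) (auto simp: act_on_tape_def split: prod.splits)

lemma tm_step_machine:
  assumes k: "\<forall>i\<in>set cs. itape i < k"
  shows "tm_step (machine k cs) (view k (q, \<tau>)) = view k (step cs (q, \<tau>))"
proof (cases "q < length cs")
  case True
  let ?tps = "map \<tau> [0..<k]"
  let ?ss = "map (\<lambda>(t, h). t h) ?tps"
  let ?keep = "map (\<lambda>s. (s, Stay)) ?ss"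
  have upd: "map2 act_on_tape (?keep[t := a]) ?tps = map (\<tau>(t := act_on_tape a (\<tau> t))) [0..<k]"
    if "t < k" for t a
  proof (rule nth_equalityI)
    fix i assume "i < length (map2 act_on_tape (?keep[t := a]) ?tps)"
    then show "map2 act_on_tape (?keep[t := a]) ?tps ! i =
        map (\<tau>(t := act_on_tape a (\<tau> t))) [0..<k] ! i"
      using that by (cases "i = t") (auto simp: act_on_tape_def split: prod.splits)
  qed simp
  have t: "itape (cs ! q) < k" using k True by simp
  have rd: "?ss ! t = fst (\<tau> t) (snd (\<tau> t))" if "t < k" for t
    using that by (simp add: case_prod_beta)
  show ?thesis
  proof (cases "cs ! q")
    case (Act t w d)
    then show ?thesis using True t upd[of t "(min 2 w, d)"]
      by (simp add: tm_step_def view_def machine_def Let_def comp_assoc)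
  next
    case (Mv t d)
    then have "t < k" using t by simp
    then have "act_on_tape (?ss ! t, d) (\<tau> t) = (fst (\<tau> t), snd (\<tau> t) + displacement d)"
      unfolding rd[OF \<open>t < k\<close>] by (cases "\<tau> t") (simp add: act_on_tape_def)
    then show ?thesis using True \<open>t < k\<close> Mv upd[of t "(?ss ! t, d)"]
      by (simp add: tm_step_def view_def machine_def Let_def comp_assoc)
  next
    case (Branch t p off)
    then have "t < k" using t by simp
    then show ?thesis using True Branch rd[of t] act_keep[of ?tps]
      by (simp add: tm_step_def view_def machine_def Let_def comp_assoc)
  qed
next
  case False
  then show ?thesis by (simp add: tm_step_def view_def machine_def)
qed

lemma tm_steps_machine:
  assumes "\<forall>i\<in>set cs. itape i < k"
  shows "(tm_step (machine k cs) ^^ n) (view k c) = view k ((step cs ^^ n) c)"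
proof (induction n)
  case (Suc n)
  then show ?case using tm_step_machine[OF assms] by (metis funpow.simps(2) comp_apply prod.exhaust)
qed simp

lemma step_other:
  assumes "\<forall>i\<in>set cs. itape i \<noteq> t"
  shows "snd (step cs (q, \<tau>)) t = \<tau> t"
proof (cases "q < length cs")
  case True
  then have "itape (cs ! q) \<noteq> t" using assms by simp
  then show ?thesis by (cases "cs ! q") auto
qed simp

lemma runs_other:
  assumes "runs c \<tau> n \<tau>'" "\<forall>i\<in>set c. itape i \<noteq> t"
  shows "\<tau>' t = \<tau> t"
proof -
  have "snd ((step c ^^ n) (q, \<tau>)) t = \<tau> t" for q n
  proof (induction n)
    case (Suc n)
    then show ?case using step_other[OF assms(2)] by (metis funpow.simps(2) comp_apply prod.collapse)
  qed simp
  moreover have "(step c ^^ n) (0, \<tau>) = (length c, \<tau>')"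
    using assms(1) unfolding runs_def by (metis append_Nil append_Nil2 add_0 list.size(3))
  ultimately show ?thesis by (metis snd_conv)
qed

lemma step_halted: "(step cs ^^ n) (length cs, \<tau>) = (length cs, \<tau>)"
  by (induction n) auto

text \<open>
  Everything that a program prints, given its input as the value of all variables, is computable in
  polynomial time. The program runs with its output on tape \<open>1\<close>, and the result is then copied to an
  unused tape, where it starts at cell \<open>0\<close> as required.
\<close>

theorem polytime_sem: "polytime (\<lambda>x. sem P (\<lambda>_. x))"
proof -
  obtain p where p: "compiles_within P p" using compiles_within_ex by blast
  let ?c = "compile P (\<lambda>_. 0) 1 2 @ rewind 1"
  have "\<exists>k\<ge>2. \<forall>i\<in>set ?c. itape i < k"
  proof -
    have "finite (insert 1 (itape ` set ?c))" by simp
    then obtain k where "\<forall>t\<in>insert 1 (itape ` set ?c). t < k"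
      unfolding finite_nat_set_iff_bounded by blast
    then show ?thesis by (intro exI[of _ k]) auto
  qed
  then obtain k where k: "k \<ge> 2" "\<forall>i\<in>set ?c. itape i < k" by blast
  let ?cs = "?c @ copy 1 k"
  let ?M = "machine (Suc k) ?cs"
  have tapes: "\<forall>i\<in>set ?cs. itape i < Suc k"
    using k by (auto simp: copy_def while_def cond_def emit_def less_SucI)
  let ?p = "10 * p + 4"
  have "computes_in ?M (poly ?p (length x)) x (sem P (\<lambda>_. x))" for x
  proof -
    let ?e = "\<lambda>_::nat. x"
    define \<tau> :: store where "\<tau> = (\<lambda>t. if t = 0 then (content x, 0) else (content [], 0))"
    have c0: "content [] = tape_str 0 []" by (rule tape_str_0[symmetric])
    have bl: "home [] (\<tau> t)" if "t \<noteq> 0" for t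
      using that by (auto simp: \<tau>_def home_def c0)
    have "home x (\<tau> 0)" unfolding \<tau>_def home_def tape_str_0[symmetric] by auto
    then have rdy: "ready (\<lambda>_. 0) 1 2 ?e \<tau>" using bl by (auto simp: ready_def)
    have w: "\<tau> 1 = written 0 []" by (simp add: \<tau>_def written_def c0 del: tape_str_Nil)
    obtain n1 \<tau>1 where 1: "n1 \<le> poly p (length x)" "runs (compile P (\<lambda>_. 0) 1 2) \<tau> n1 \<tau>1"
      "outcome 1 2 (written 0 ([] @ sem P ?e)) \<tau> \<tau>1"
      by (rule compiles_withinD[OF p rdy w]) auto
    let ?s = "sem P ?e"
    let ?\<tau>2 = "\<tau>1(1 := (tape_str 0 ?s, 0))"
    have "\<tau>1 1 = written 0 ?s" using 1(3) by (simp add: outcome_def)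
    from runs_append[OF 1(2) runs_rewind[where \<tau> = \<tau>1 and t = 1, OF this]]
    have 2: "runs ?c \<tau> (n1 + (3 * length ?s + 3)) ?\<tau>2" .
    have "?\<tau>2 k = \<tau> k" by (rule runs_other[OF 2]) (use k in auto)
    then have w2: "?\<tau>2 k = written 0 []" using k(1) by (simp add: \<tau>_def written_def c0 del: tape_str_Nil)
    obtain n3 where 3: "n3 \<le> 6 * length ?s + 1"
      "runs (copy 1 k) ?\<tau>2 n3 (?\<tau>2(1 := written 0 ?s, k := written 0 ?s))"
      using runs_copy[of 1 k ?\<tau>2 0 "[]" ?s 0 "[]"] w2 k(1) by auto
    let ?\<tau>3 = "?\<tau>2(1 := written 0 ?s, k := written 0 ?s)"
    let ?n = "n1 + (3 * length ?s + 3) + n3"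
    have r: "runs ?cs \<tau> ?n ?\<tau>3" using runs_append[OF 2 3(2)] by simp
    have len: "length ?s \<le> poly p (length x)" by (rule compiles_within_length[OF p]) simp
    then have "?n \<le> poly ?p (length x)" using 1(1) 3(1) by simp
    then obtain j where j: "poly ?p (length x) = j + ?n" by (metis le_add_diff_inverse2)
    have "(step ?cs ^^ ?n) (0, \<tau>) = (length ?cs, ?\<tau>3)"
      using r unfolding runs_def by (metis append_Nil append_Nil2 add_0 list.size(3))
    then have "(step ?cs ^^ poly ?p (length x)) (0, \<tau>) = (length ?cs, ?\<tau>3)"
      unfolding j by (rule funpow_comp_eq[OF _ step_halted])
    then have fin: "(tm_step ?M ^^ poly ?p (length x)) (view (Suc k) (0, \<tau>)) = view (Suc k) (length ?cs, ?\<tau>3)"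
      using tm_steps_machine[OF tapes] by simp
    have "map \<tau> [0..<Suc k] = \<tau> 0 # map (\<tau> \<circ> Suc) [0..<k]"
      by (metis list.simps(9) map_Suc_upt map_map upt_rec zero_less_Suc)
    moreover have "map (\<tau> \<circ> Suc) [0..<k] = replicate k (content [], 0)"
      by (rule nth_equalityI) (auto simp: \<tau>_def)
    ultimately have "initial ?M x = view (Suc k) (0, \<tau>)"
      by (simp add: initial_def view_def machine_def \<tau>_def)
    then show ?thesis
      using fin by (simp add: computes_in_def view_def machine_def written_def tape_str_0)
  qed
  moreover have "is_tm ?M" by (rule is_tm_machine[OF _ tapes]) simp
  ultimately show ?thesis unfolding polytime_def by blast
qed

section \<open>Arithmetic and logic in the loop language\<close>

text \<open>
  The largest variable that occurs in a program; larger ones are fresh for it.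
\<close>

primrec max_var :: "prog \<Rightarrow> nat" where
  "max_var Skip = 0"
| "max_var (Emit b) = 0"
| "max_var (Var v) = v"
| "max_var (Seq P Q) = max (max_var P) (max_var Q)"
| "max_var (Let v P Q) = max v (max (max_var P) (max_var Q))"
| "max_var (For v P Q) = max v (max (max_var P) (max_var Q))"
| "max_var (If P Q R) = max (max_var P) (max (max_var Q) (max_var R))"
| "max_var (Drop P Q) = max (max_var P) (max_var Q)"

lemma bind_apply[simp]: "bind v x e w = (if v \<noteq> 0 \<and> w = v then x else e w)"
  by (simp add: bind_def)

lemma bind_0[simp]: "bind 0 x e = e"
  by (simp add: bind_def)

lemma sem_cong: "\<forall>v\<le>max_var P. e v = e' v \<Longrightarrow> sem P e = sem P e'"
proof (induction P arbitrary: e e')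
  case (Let v P Q)
  have "sem P e = sem P e'" using Let.prems by (intro Let.IH(1)) simp
  moreover have "sem Q (bind v x e) = sem Q (bind v x e')" for x
    using Let.prems by (intro Let.IH(2)) simp
  ultimately show ?case by simp
next
  case (For v P Q)
  have "sem P e = sem P e'" using For.prems by (intro For.IH(1)) simp
  moreover have "sem Q (bind v x e) = sem Q (bind v x e')" for x
    using For.prems by (intro For.IH(2)) simp
  ultimately show ?case by simp
next
  case (Seq P Q)
  have "sem P e = sem P e'" using Seq.prems by (intro Seq.IH(1)) simp
  moreover have "sem Q e = sem Q e'" using Seq.prems by (intro Seq.IH(2)) simp
  ultimately show ?case by simp
next
  case (If P Q R)
  have "sem P e = sem P e'" using If.prems by (intro If.IH(1)) simp
  moreover have "sem Q e = sem Q e'" using If.prems by (intro If.IH(2)) simp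
  moreover have "sem R e = sem R e'" using If.prems by (intro If.IH(3)) simp
  ultimately show ?case by simp
next
  case (Drop P Q)
  have "sem P e = sem P e'" using Drop.prems by (intro Drop.IH(1)) simp
  moreover have "sem Q e = sem Q e'" using Drop.prems by (intro Drop.IH(2)) simp
  ultimately show ?case by simp
qed simp_all

lemma sem_bind_fresh[simp]: "max_var P < v \<Longrightarrow> sem P (bind v x e) = sem P e"
  by (rule sem_cong) auto

text \<open>
  Outputs read as numbers and as truth values.
\<close>

definition num :: "prog \<Rightarrow> env \<Rightarrow> nat" where
  "num P e = length (sem P e)"

definition holds :: "prog \<Rightarrow> env \<Rightarrow> bool" where
  "holds P e \<longleftrightarrow> take 1 (sem P e) = [True]"

lemma sem_If[simp]: "sem (If P Q R) e = (if holds P e then sem Q e else sem R e)"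
  by (simp add: holds_def)

declare sem.simps(7)[simp del]

lemma num_bind_fresh[simp]: "max_var P < v \<Longrightarrow> num P (bind v x e) = num P e"
  by (simp add: num_def)

lemma num_Var[simp]: "num (Var v) e = length (e v)" by (simp add: num_def)

lemma num_Seq[simp]: "num (Seq P Q) e = num P e + num Q e" by (simp add: num_def)

lemma holds_Let[simp]: "holds (Let v P Q) e = holds Q (bind v (sem P e) e)" by (simp add: holds_def)

lemma num_Emit[simp]: "num (Emit b) e = 1" by (simp add: num_def)

lemma holds_Emit[simp]: "holds (Emit b) e = b" by (simp add: holds_def)

lemma num_Skip[simp]: "num Skip e = 0" by (simp add: num_def)

lemma holds_Skip[simp]: "\<not> holds Skip e" by (simp add: holds_def)

primrec pnat :: "nat \<Rightarrow> prog" where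
  "pnat 0 = Skip"
| "pnat (Suc n) = Seq (Emit True) (pnat n)"

lemma num_pnat[simp]: "num (pnat n) e = n"
  by (induction n) (auto simp: num_def)

definition pnot :: "prog \<Rightarrow> prog" where "pnot P = If P Skip (Emit True)"

definition pand :: "prog \<Rightarrow> prog \<Rightarrow> prog" where "pand P Q = If P Q Skip"

definition por :: "prog \<Rightarrow> prog \<Rightarrow> prog" where "por P Q = If P (Emit True) Q"

lemma holds_If[simp]: "holds (If P Q R) e = (if holds P e then holds Q e else holds R e)"
  by (simp add: holds_def)

lemma holds_logic[simp]:
  "holds (pnot P) e \<longleftrightarrow> \<not> holds P e"
  "holds (pand P Q) e \<longleftrightarrow> holds P e \<and> holds Q e"
  "holds (por P Q) e \<longleftrightarrow> holds P e \<or> holds Q e"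
  by (auto simp: pnot_def pand_def por_def)

definition ones :: "prog \<Rightarrow> prog" where "ones P = For 0 P (Emit True)"

lemma sem_ones[simp]: "sem (ones P) e = replicate (num P e) True"
  by (simp add: ones_def num_def map_replicate_const)

lemma num_Drop[simp]: "num (Drop P Q) e = num P e - num Q e" by (simp add: num_def)

lemma take_1_drop: "take 1 (drop n s) = [True] \<longleftrightarrow> n < length s \<and> s ! n"
proof (cases "n < length s")
  case True
  then have "drop n s = s ! n # drop (Suc n) s" by (simp add: Cons_nth_drop_Suc)
  with True show ?thesis by simp
qed simp

lemma holds_Drop[simp]: "holds (Drop P Q) e \<longleftrightarrow> num Q e < length (sem P e) \<and> sem P e ! num Q e"
  unfolding holds_def sem.simps take_1_drop num_def ..

definition plt :: "prog \<Rightarrow> prog \<Rightarrow> prog" where "plt P Q = Drop (ones Q) P"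

lemma holds_plt[simp]: "holds (plt P Q) e \<longleftrightarrow> num P e < num Q e"
  by (auto simp: plt_def)

definition peq :: "prog \<Rightarrow> prog \<Rightarrow> prog" where
  "peq P Q = pand (pnot (plt P Q)) (pnot (plt Q P))"

lemma holds_peq[simp]: "holds (peq P Q) e \<longleftrightarrow> num P e = num Q e"
  by (auto simp: peq_def)

definition pmul :: "prog \<Rightarrow> prog \<Rightarrow> prog" where "pmul P Q = For 0 P Q"

lemma num_pmul[simp]: "num (pmul P Q) e = num P e * num Q e"
  by (simp add: pmul_def num_def length_concat comp_def sum_list_triv)

text \<open>
  Quantification over the numbers below the value of \<open>P\<close>.
\<close>

definition pex :: "nat \<Rightarrow> prog \<Rightarrow> prog \<Rightarrow> prog" where
  "pex v P Q = For v P (If Q (Emit True) Skip)"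

definition pall :: "nat \<Rightarrow> prog \<Rightarrow> prog \<Rightarrow> prog" where
  "pall v P Q = pnot (pex v P (pnot Q))"

lemma sem_count:
  "concat (map (\<lambda>i. if C i then [True] else []) xs) = replicate (length (filter C xs)) True"
  by (induction xs) auto

lemma holds_pex[simp]:
  "holds (pex v P Q) e \<longleftrightarrow> (\<exists>i<num P e. holds Q (bind v (replicate i True) e))"
proof -
  have "take 1 (replicate n True) = [True] \<longleftrightarrow> n \<noteq> 0" for n by (cases n) auto
  then show ?thesis
    unfolding pex_def holds_def[of "For v P (If Q (Emit True) Skip)"] sem.simps(1,2,6) sem_If sem_count
    by (auto simp: num_def filter_empty_conv)
qed

lemma holds_pall[simp]:
  "holds (pall v P Q) e \<longleftrightarrow> (\<forall>i<num P e. holds Q (bind v (replicate i True) e))"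
  by (simp add: pall_def)

text \<open>
  \<open>P div Q\<close> is the number of \<open>i\<close> below \<open>P\<close> with \<open>(i + 1) * Q \<le> P\<close>.
\<close>

definition pdiv :: "prog \<Rightarrow> prog \<Rightarrow> prog" where
  "pdiv P Q = (let v = Suc (max (max_var P) (max_var Q)) in
     For v P (If (pnot (plt P (pmul (Seq (Emit True) (Var v)) Q))) (Emit True) Skip))"

lemma num_pdiv: "num Q e > 0 \<Longrightarrow> num (pdiv P Q) e = num P e div num Q e"
proof -
  assume Q: "num Q e > 0"
  let ?a = "num P e" and ?b = "num Q e"
  let ?v = "Suc (max (max_var P) (max_var Q))"
  have "num (pdiv P Q) e = length (filter (\<lambda>i. holds (pnot (plt P (pmul (Seq (Emit True) (Var ?v)) Q)))
      (bind ?v (replicate i True) e)) [0..<?a])"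
    unfolding pdiv_def Let_def num_def sem.simps(1,2,6) sem_If sem_count length_replicate ..
  also have "\<dots> = length (filter (\<lambda>i. \<not> ?a < Suc i * ?b) [0..<?a])"
    by (intro arg_cong[where f = length] filter_cong) auto
  also have "\<dots> = card ({i. \<not> ?a < Suc i * ?b} \<inter> set [0..<?a])"
    by (rule distinct_length_filter) simp
  also have "{i. \<not> ?a < Suc i * ?b} \<inter> set [0..<?a] = {..<?a div ?b}"
  proof -
    have "\<not> ?a < Suc i * ?b \<longleftrightarrow> i < ?a div ?b" for i
      using Q by (metis Suc_le_eq less_eq_div_iff_mult_less_eq not_less)
    moreover have "i < ?a" if "i < ?a div ?b" for i
      using that by (meson div_le_dividend less_le_trans)
    ultimately show ?thesis by (auto simp del: mult_Suc)
  qed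
  finally show ?thesis by simp
qed

definition pmod :: "prog \<Rightarrow> prog \<Rightarrow> prog" where
  "pmod P Q = Drop P (pmul (pdiv P Q) Q)"

lemma num_pmod: "num Q e > 0 \<Longrightarrow> num (pmod P Q) e = num P e mod num Q e"
  by (simp add: pmod_def num_pdiv minus_div_mult_eq_mod)

text \<open>
  A bit string as a sequence of tokens: \<open>tok s j\<close> is the number of \<open>True\<close> that come after exactly \<open>j\<close>
  occurrences of \<open>False\<close>, and \<open>ntok s\<close> the number of tokens that are closed by a \<open>False\<close>. Every string has
  these values; missing tokens are \<open>0\<close>.
\<close>

fun tok :: "bool list \<Rightarrow> nat \<Rightarrow> nat" where
  "tok [] j = 0"
| "tok (True # s) j = (if j = 0 then 1 else 0) + tok s j"
| "tok (False # s) 0 = 0"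
| "tok (False # s) (Suc j) = tok s j"

definition ntok :: "bool list \<Rightarrow> nat" where
  "ntok s = length (filter Not s)"

lemma length_filter_upt_Suc:
  "length (filter C [0..<Suc n]) = (if C 0 then 1 else 0) + length (filter (\<lambda>i. C (Suc i)) [0..<n])"
  by (induction n) auto

lemma tok_filter:
  "tok s j = length (filter (\<lambda>i. s ! i \<and> ntok (take i s) = j) [0..<length s])"
  by (induction s j rule: tok.induct)
    (simp_all add: length_filter_upt_Suc ntok_def del: upt_Suc)

lemma ntok_take:
  "i \<le> length s \<Longrightarrow> ntok (take i s) = length (filter (\<lambda>k. \<not> s ! k) [0..<i])"
  by (induction i) (auto simp: ntok_def take_Suc_conv_app_nth)

text \<open>
  The number of \<open>False\<close> among the first \<open>Q\<close> bits of \<open>P\<close>.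
\<close>

definition pzeros :: "prog \<Rightarrow> prog \<Rightarrow> prog" where
  "pzeros P Q = (let v = Suc (max (max_var P) (max_var Q)) in
     For v Q (If (pnot (Drop P (Var v))) (Emit True) Skip))"

lemma num_pzeros: "num Q e \<le> num P e \<Longrightarrow> num (pzeros P Q) e = ntok (take (num Q e) (sem P e))"
proof -
  assume le: "num Q e \<le> num P e"
  let ?v = "Suc (max (max_var P) (max_var Q))"
  have "num (pzeros P Q) e = length (filter (\<lambda>i. holds (pnot (Drop P (Var ?v)))
      (bind ?v (replicate i True) e)) [0..<num Q e])"
    unfolding pzeros_def Let_def num_def sem.simps(1,2,6) sem_If sem_count length_replicate ..
  also have "\<dots> = length (filter (\<lambda>i. \<not> sem P e ! i) [0..<num Q e])"
    using le by (intro arg_cong[where f = length] filter_cong) (auto simp: num_def)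
  also have "\<dots> = ntok (take (num Q e) (sem P e))"
    using le by (subst ntok_take) (auto simp: num_def)
  finally show ?thesis .
qed

definition ptok :: "prog \<Rightarrow> prog \<Rightarrow> prog" where
  "ptok P Q = (let v = Suc (max (max_var P) (max_var Q)) in
     For v P (If (pand (Drop P (Var v)) (peq (pzeros P (Var v)) Q)) (Emit True) Skip))"

lemma num_ptok[simp]: "num (ptok P Q) e = tok (sem P e) (num Q e)"
proof -
  let ?v = "Suc (max (max_var P) (max_var Q))"
  have *: "holds (pand (Drop P (Var ?v)) (peq (pzeros P (Var ?v)) Q)) (bind ?v (replicate i True) e)
      \<longleftrightarrow> sem P e ! i \<and> ntok (take i (sem P e)) = num Q e" if "i < length (sem P e)" for i
    using that num_pzeros[of "Var ?v" "bind ?v (replicate i True) e" P] by (simp add: num_def)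
  have "num (ptok P Q) e = length (filter (\<lambda>i. holds (pand (Drop P (Var ?v))
      (peq (pzeros P (Var ?v)) Q)) (bind ?v (replicate i True) e)) [0..<length (sem P e)])"
    unfolding ptok_def Let_def num_def sem.simps(1,2,6) sem_If sem_count length_replicate ..
  also have "\<dots> = tok (sem P e) (num Q e)"
    unfolding tok_filter using * by (intro arg_cong[where f = length] filter_cong) auto
  finally show ?thesis .
qed

definition pntok :: "prog \<Rightarrow> prog" where "pntok P = pzeros P P"

lemma num_pntok[simp]: "num (pntok P) e = ntok (sem P e)"
  by (simp add: pntok_def num_pzeros) (simp add: num_def)

primrec pmem :: "prog \<Rightarrow> nat list \<Rightarrow> prog" where
  "pmem P [] = Skip"
| "pmem P (c # cs) = por (peq P (pnat c)) (pmem P cs)"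

lemma holds_pmem[simp]: "holds (pmem P cs) e \<longleftrightarrow> num P e \<in> set cs"
  by (induction cs) auto

primrec pmem2 :: "prog \<Rightarrow> prog \<Rightarrow> (nat \<times> nat) list \<Rightarrow> prog" where
  "pmem2 P Q [] = Skip"
| "pmem2 P Q (c # cs) = por (pand (peq P (pnat (fst c))) (peq Q (pnat (snd c)))) (pmem2 P Q cs)"

lemma holds_pmem2[simp]: "holds (pmem2 P Q cs) e \<longleftrightarrow> (num P e, num Q e) \<in> set cs"
  by (induction cs) auto

text \<open>
  Polynomials are computable, by Horner's rule.
\<close>

lemma ex_ppoly: "\<exists>Q. \<forall>e. num Q e = poly p (num P e)"
proof (induction p)
  case 0
  show ?case by (intro exI[of _ Skip]) (simp add: num_def)
next
  case (pCons a p)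
  then obtain Q where "\<forall>e. num Q e = poly p (num P e)" by blast
  then show ?case by (intro exI[of _ "Seq (pnat a) (pmul P Q)"]) simp
qed

section \<open>Instances as token sequences\<close>

definition enc_tokens :: "nat list \<Rightarrow> bool list" where
  "enc_tokens ts = concat (map enc_nat ts)"

lemma enc_tokens_simps[simp]: "enc_tokens [] = []" "enc_tokens (t # ts) = enc_nat t @ enc_tokens ts"
  "enc_tokens (ts @ us) = enc_tokens ts @ enc_tokens us"
  by (simp_all add: enc_tokens_def)

lemma tok_enc_nat: "tok (enc_nat t @ s) j = (case j of 0 \<Rightarrow> t | Suc i \<Rightarrow> tok s i)"
  by (induction t) (auto simp: enc_nat_def split: nat.splits)

lemma tok_enc_tokens: "tok (enc_tokens ts) j = (if j < length ts then ts ! j else 0)"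
proof (induction ts arbitrary: j)
  case (Cons t ts)
  then show ?case by (cases j) (auto simp: tok_enc_nat)
qed simp

lemma ntok_enc_tokens: "ntok (enc_tokens ts) = length ts"
  by (induction ts) (simp_all add: enc_nat_def ntok_def)

lemma enc_tokens_last: "enc_tokens ts \<noteq> [] \<Longrightarrow> \<not> last (enc_tokens ts)"
proof (induction ts)
  case (Cons t ts)
  then show ?case by (cases "enc_tokens ts = []") (auto simp: enc_nat_def)
qed simp

lemma ex_enc_tokens: "s = [] \<or> \<not> last s \<Longrightarrow> \<exists>ts. s = enc_tokens ts"
proof (induction s)
  case (Cons b s)
  show ?case
  proof (cases "s = []")
    case True
    then show ?thesis using Cons.prems by (intro exI[of _ "[0]"]) (simp add: enc_nat_def)
  next
    case False
    then obtain ts where ts: "s = enc_tokens ts" using Cons by auto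
    show ?thesis
    proof (cases b)
      case True
      obtain t us where "ts = t # us" using False ts by (cases ts) auto
      then show ?thesis using ts True by (intro exI[of _ "Suc t # us"]) (simp add: enc_nat_def)
    next
      case False
      then show ?thesis using ts by (intro exI[of _ "0 # ts"]) (simp add: enc_nat_def)
    qed
  qed
qed (intro exI[of _ "[]"], simp)

lemma tokens_of: "s = [] \<or> \<not> last s \<Longrightarrow> s = enc_tokens (map (tok s) [0..<ntok s])"
proof -
  assume "s = [] \<or> \<not> last s"
  then obtain ts where ts: "s = enc_tokens ts" using ex_enc_tokens by blast
  have "map (tok s) [0..<ntok s] = ts"
    by (rule nth_equalityI) (auto simp: ts ntok_enc_tokens tok_enc_tokens)
  then show ?thesis using ts by simp
qed

lemma tok_le: "tok s j \<le> length s"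
  by (induction s j rule: tok.induct) auto

text \<open>
  The token sequences of an operation, of a congruence, and of an instance.
\<close>

definition optoks :: "op_table \<Rightarrow> nat list" where
  "optoks = (\<lambda>(r, tab). r # length tab # tab)"

definition cgtoks :: "(nat \<times> nat) list \<Rightarrow> nat list" where
  "cgtoks c = length c # concat (map (\<lambda>(a, b). [a, b]) c)"

definition itoks :: "crt_instance \<Rightarrow> nat list" where
  "itoks = (\<lambda>(n, ops, cs). n # length ops # concat (map optoks ops) @
     length cs # concat (map cgtoks cs))"

lemma enc_tokens_concat: "enc_tokens (concat xss) = concat (map enc_tokens xss)"
  by (induction xss) auto

lemma enc_instance_itoks: "enc_instance inst = enc_tokens (itoks inst)"
proof -
  have 1: "enc_list enc_nat tab = enc_nat (length tab) @ enc_tokens tab" for tab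
    by (simp add: enc_list_def enc_tokens_def)
  have 2: "enc_pair enc_nat (enc_list enc_nat) = enc_tokens \<circ> optoks"
    by (auto simp: enc_pair_def 1 optoks_def)
  have "enc_pair enc_nat enc_nat = enc_tokens \<circ> (\<lambda>(a, b). [a, b])"
    by (auto simp: enc_pair_def)
  then have 3: "enc_list (enc_pair enc_nat enc_nat) = enc_tokens \<circ> cgtoks"
    by (auto simp: enc_list_def cgtoks_def enc_tokens_concat)
  obtain n ops cs where inst: "inst = (n, ops, cs)" by (cases inst) auto
  show ?thesis
    unfolding inst enc_instance_def 2 3
    by (simp add: enc_pair_def enc_list_def itoks_def enc_tokens_concat)
qed

lemma prefix_code_enc_instance: "prefix_code enc_instance"
  unfolding enc_instance_def
  by (intro prefix_code_enc_pair prefix_code_enc_list prefix_code_enc_nat)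

text \<open>
  Parsing a token sequence \<open>T\<close>: the \<open>j\<close>-th operation starts at token \<open>op_pos T j\<close>, the number of congruences
  is token \<open>cong_count_pos T\<close>, and the \<open>l\<close>-th congruence starts at token \<open>cong_pos T l\<close>. As \<open>T\<close> is total, so
  is the parser; \<open>dec T\<close> is the only instance that \<open>T\<close> can encode.
\<close>

primrec op_pos :: "(nat \<Rightarrow> nat) \<Rightarrow> nat \<Rightarrow> nat" where
  "op_pos T 0 = 2"
| "op_pos T (Suc j) = op_pos T j + 2 + T (op_pos T j + 1)"

definition cong_count_pos :: "(nat \<Rightarrow> nat) \<Rightarrow> nat" where
  "cong_count_pos T = op_pos T (T 1)"

primrec cong_pos :: "(nat \<Rightarrow> nat) \<Rightarrow> nat \<Rightarrow> nat" where
  "cong_pos T 0 = cong_count_pos T + 1"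
| "cong_pos T (Suc l) = cong_pos T l + 1 + 2 * T (cong_pos T l)"

definition dec_op :: "(nat \<Rightarrow> nat) \<Rightarrow> nat \<Rightarrow> op_table" where
  "dec_op T j = (T (op_pos T j), map (\<lambda>i. T (op_pos T j + 2 + i)) [0..<T (op_pos T j + 1)])"

definition dec_cong :: "(nat \<Rightarrow> nat) \<Rightarrow> nat \<Rightarrow> (nat \<times> nat) list" where
  "dec_cong T l = map (\<lambda>i. (T (cong_pos T l + 1 + 2 * i), T (cong_pos T l + 2 + 2 * i))) [0..<T (cong_pos T l)]"

definition dec :: "(nat \<Rightarrow> nat) \<Rightarrow> crt_instance" where
  "dec T = (T 0, map (dec_op T) [0..<T 1], map (dec_cong T) [0..<T (cong_count_pos T)])"

lemma optoks_dec_op: "optoks (dec_op T j) = map T [op_pos T j..<op_pos T (Suc j)]"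
proof -
  have "[op_pos T j..<op_pos T (Suc j)] =
      op_pos T j # Suc (op_pos T j) # map (\<lambda>i. i + (op_pos T j + 2)) [0..<T (op_pos T j + 1)]"
    unfolding map_add_upt by (simp add: upt_conv_Cons add.commute)
  then show ?thesis
    by (simp only: dec_op_def optoks_def prod.case) (simp add: add.commute)
qed

lemma pairs_upt:
  "concat (map (\<lambda>i. [f (2 * i), f (Suc (2 * i))]) [0..<m]) = map f [0..<2 * m]"
  by (induction m) auto

lemma cgtoks_dec_cong: "cgtoks (dec_cong T l) = map T [cong_pos T l..<cong_pos T (Suc l)]"
proof -
  have "[cong_pos T l..<cong_pos T (Suc l)] =
      cong_pos T l # map (\<lambda>i. i + (cong_pos T l + 1)) [0..<2 * T (cong_pos T l)]"
    unfolding map_add_upt by (simp add: upt_conv_Cons add.commute)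
  moreover have "concat (map (\<lambda>(a, b). [a, b]) (dec_cong T l)) =
      map (\<lambda>i. T (i + (cong_pos T l + 1))) [0..<2 * T (cong_pos T l)]"
    unfolding pairs_upt[symmetric] dec_cong_def by (simp add: comp_def add.commute add.left_commute)
  ultimately show ?thesis
    by (simp add: cgtoks_def dec_cong_def comp_def)
qed

lemma upt_split: "a \<le> b \<Longrightarrow> b \<le> c \<Longrightarrow> [a..<c] = [a..<b] @ [b..<c]"
  using upt_add_eq_append[of a b "c - b"] by simp

lemma concat_segments:
  assumes "\<And>j. g j = map T [p j..<p (Suc j)]" "\<And>j. p j \<le> p (Suc j)"
  shows "concat (map g [0..<m]) = map T [p 0..<p m]"
proof (induction m)
  case (Suc m)
  have "p 0 \<le> p m" by (rule lift_Suc_mono_le[where f = p]) (simp_all add: assms(2))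
  then have "[p 0..<p (Suc m)] = [p 0..<p m] @ [p m..<p (Suc m)]"
    using assms(2)[of m] by (rule upt_split)
  with Suc show ?case by (simp add: assms(1))
qed simp

lemma op_pos_mono: "op_pos T 0 \<le> op_pos T j"
  by (induction j) auto

lemma cong_pos_mono: "cong_pos T 0 \<le> cong_pos T l"
  by (induction l) auto

lemma itoks_dec: "itoks (dec T) = map T [0..<cong_pos T (T (cong_count_pos T))]"
proof -
  let ?e = "cong_pos T (T (cong_count_pos T))"
  have 1: "concat (map (\<lambda>j. optoks (dec_op T j)) [0..<T 1]) = map T [2..<cong_count_pos T]"
    using concat_segments[of "\<lambda>j. optoks (dec_op T j)" T "op_pos T"] optoks_dec_op
    by (simp add: cong_count_pos_def)
  have 2: "concat (map (\<lambda>j. cgtoks (dec_cong T j)) [0..<T (cong_count_pos T)]) = map T [cong_count_pos T + 1..<?e]"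
    using concat_segments[of "\<lambda>j. cgtoks (dec_cong T j)" T "cong_pos T"] cgtoks_dec_cong by simp
  have le: "2 \<le> cong_count_pos T" "cong_count_pos T + 1 \<le> ?e"
    using op_pos_mono[of T "T 1"] cong_pos_mono[of T "T (cong_count_pos T)"] by (simp_all add: cong_count_pos_def)
  have "[0..<?e] = [0..<2] @ [2..<cong_count_pos T] @ [cong_count_pos T] @ [cong_count_pos T + 1..<?e]"
    using le upt_split[of 0 2 ?e] upt_split[of 2 "cong_count_pos T" ?e]
      upt_split[of "cong_count_pos T" "cong_count_pos T + 1" ?e] by simp
  moreover have "[0..<2] = [0, Suc 0]" by (simp add: numeral_2_eq_2)
  ultimately show ?thesis
    using 1 2 by (simp add: itoks_def dec_def comp_def)
qed

text \<open>
  Of the token sequences of \<open>inst\<close> and of \<open>dec T\<close> one extends the other, so that the prefix property of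
  the encoding makes the two instances equal.
\<close>

lemma dec_itoks:
  assumes "\<And>j. T j = (if j < length (itoks inst) then itoks inst ! j else 0)"
  shows "dec T = inst"
proof -
  let ?L = "length (itoks inst)" and ?L' = "cong_pos T (T (cong_count_pos T))"
  have 1: "itoks inst = map T [0..<?L]"
    by (rule nth_equalityI) (simp_all add: assms)
  have "\<exists>u v. enc_tokens (map T [0..<?L]) @ u = enc_tokens (map T [0..<?L']) @ v"
  proof (cases "?L \<le> ?L'")
    case True
    then have "enc_tokens (map T [0..<?L']) = enc_tokens (map T [0..<?L]) @ enc_tokens (map T [?L..<?L'])"
      using upt_split[of 0 ?L ?L'] by simp
    then show ?thesis by (metis append_Nil2)
  next
    case False
    then have "enc_tokens (map T [0..<?L]) = enc_tokens (map T [0..<?L']) @ enc_tokens (map T [?L'..<?L])"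
      using upt_split[of 0 ?L' ?L] by simp
    then show ?thesis by (metis append_Nil2)
  qed
  then have "\<exists>u v. enc_instance inst @ u = enc_instance (dec T) @ v"
    unfolding enc_instance_itoks itoks_dec using 1 by simp
  then show ?thesis using prefix_code_enc_instance unfolding prefix_code_def by metis
qed

lemma dec_enc_instance: "dec (tok (enc_instance inst)) = inst"
  by (rule dec_itoks) (simp add: enc_instance_itoks tok_enc_tokens)

text \<open>
  Whether a string encodes an instance is decided by its last bit and by comparing the number of its
  tokens with the position at which parsing ends.
\<close>

lemma enc_dec_iff:
  "x = enc_instance (dec (tok x)) \<longleftrightarrow>
     (x = [] \<or> \<not> last x) \<and> ntok x = cong_pos (tok x) (tok x (cong_count_pos (tok x)))"
  (is "?A \<longleftrightarrow> ?B")
proof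
  assume A: ?A
  then have "x = enc_tokens (map (tok x) [0..<cong_pos (tok x) (tok x (cong_count_pos (tok x)))])"
    by (simp add: enc_instance_itoks itoks_dec)
  then show ?B by (metis enc_tokens_last ntok_enc_tokens length_map length_upt diff_zero)
next
  assume B: ?B
  then have "x = enc_tokens (map (tok x) [0..<ntok x])" using tokens_of by blast
  then show ?A using B by (simp add: enc_instance_itoks itoks_dec)
qed

lemma CRT_iff:
  "x \<in> CRT \<longleftrightarrow> x = enc_instance (dec (tok x)) \<and> valid_instance (dec (tok x)) \<and>
     (case dec (tok x) of (n, ops, cs) \<Rightarrow> CR_tuple (table_algebra n ops) (map set cs))"
  (is "_ \<longleftrightarrow> ?B")
proof
  assume "x \<in> CRT"
  then obtain n ops cs where x: "x = enc_instance (n, ops, cs)" "valid_instance (n, ops, cs)"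
    "CR_tuple (table_algebra n ops) (map set cs)" unfolding CRT_def by blast
  then show ?B using dec_enc_instance[of "(n, ops, cs)"] by simp
next
  assume ?B
  then show "x \<in> CRT" unfolding CRT_def by (cases "dec (tok x)") auto
qed

section \<open>Short refutations of membership in CRT\<close>

lemma tuple_index_snoc: "tuple_index n (xs @ [x]) = tuple_index n xs * n + x"
  by (simp add: tuple_index_def)

lemma tuple_index_less: "set xs \<subseteq> {..<n} \<Longrightarrow> tuple_index n xs < n ^ length xs"
proof (induction xs rule: rev_induct)
  case (snoc x xs)
  then have "tuple_index n xs * n + x < n ^ length xs * n"
  proof -
    have "tuple_index n xs < n ^ length xs" "x < n" using snoc by auto
    then have "tuple_index n xs * n + x < Suc (tuple_index n xs) * n" by simp
    also have "\<dots> \<le> n ^ length xs * n"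
      using \<open>tuple_index n xs < n ^ length xs\<close> by (intro mult_right_mono) auto
    finally show ?thesis .
  qed
  then show ?case by (simp add: tuple_index_snoc mult.commute)
qed (simp add: tuple_index_def)

text \<open>
  The value at \<open>xs\<close> of the \<open>j\<close>-th operation.
\<close>

definition table_value :: "(nat \<Rightarrow> nat) \<Rightarrow> nat \<Rightarrow> nat list \<Rightarrow> nat" where
  "table_value T j xs = T (op_pos T j + 2 + tuple_index (T 0) xs)"

text \<open>
  Membership as a conjunction of conditions on the tokens, each of which has short refutations.
\<close>

lemma CRT_iff_conditions:
  assumes T_def: "T = tok x" and n_def: "n = T 0" and kc_def: "kc = T (cong_count_pos T)"
    and R_def: "R = (\<lambda>l. set (dec_cong T l))" and r_def: "r = (\<lambda>j. T (op_pos T j))"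
  shows "x \<in> CRT \<longleftrightarrow>
    (x = [] \<or> \<not> last x) \<and> ntok x = cong_pos T kc \<and>
    (\<forall>j<T 1. T (op_pos T j + 1) = n ^ r j) \<and> 0 < n \<and>
    (\<forall>j<T 1. \<forall>xs\<in>tuples {..<n} (r j). table_value T j xs < n) \<and> 0 < kc \<and>
    (\<forall>l<kc. R l \<subseteq> {..<n} \<times> {..<n}) \<and> (\<forall>l<kc. \<forall>a<n. (a, a) \<in> R l) \<and>
    (\<forall>l<kc. sym (R l)) \<and> (\<forall>l<kc. trans (R l)) \<and>
    (\<forall>l<kc. \<forall>j<T 1. \<forall>xs\<in>tuples {..<n} (r j). \<forall>ys\<in>tuples {..<n} (r j).
       (\<forall>i<r j. (xs ! i, ys ! i) \<in> R l) \<longrightarrow> (table_value T j xs, table_value T j ys) \<in> R l) \<and>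
    (\<forall>as\<in>tuples {..<n} kc. (\<forall>l<kc. \<forall>l'<kc. (as ! l, as ! l') \<in> cong_join (R l) (R l')) \<longrightarrow>
       (\<exists>a<n. \<forall>l<kc. (a, as ! l) \<in> R l))"
    (is "_ \<longleftrightarrow> ?W1 \<and> ?W2 \<and> ?tab \<and> ?ne \<and> ?cl \<and> ?k \<and> ?sub \<and> ?refl \<and> ?sym \<and> ?trans \<and> ?comp \<and> ?CR")
proof -
  define ops where "ops = map (dec_op T) [0..<T 1]"
  define cs where "cs = map (dec_cong T) [0..<kc]"
  let ?A = "table_algebra n ops"
  have dec: "dec T = (n, ops, cs)"
    by (simp add: dec_def ops_def cs_def n_def kc_def)
  have tab: "(\<forall>(r, tab)\<in>set ops. length tab = n ^ r) \<longleftrightarrow> ?tab"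
    by (auto simp: ops_def dec_op_def r_def)
  have univ: "universe ?A = {..<n}" "symbols ?A = {..<T 1}"
    by (simp_all add: table_algebra_def ops_def)
  have ar: "arity ?A j = r j" if "j < T 1" for j
    using that by (simp add: table_algebra_def ops_def dec_op_def r_def)
  have val: "interp ?A j xs = table_value T j xs" if "j < T 1" "xs \<in> tuples {..<n} (r j)" ?tab for j xs
  proof -
    have "tuple_index n xs < n ^ r j" using that(2) tuple_index_less[of xs n] by (auto simp: tuples_def)
    then show ?thesis using that(1,3)
      by (simp add: table_algebra_def ops_def dec_op_def table_value_def n_def)
  qed
  have cong: "congruence ?A (R l) \<longleftrightarrow> R l \<subseteq> {..<n} \<times> {..<n} \<and> (\<forall>a<n. (a, a) \<in> R l) \<and>
      sym (R l) \<and> trans (R l) \<and>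
      (\<forall>j<T 1. \<forall>xs\<in>tuples {..<n} (r j). \<forall>ys\<in>tuples {..<n} (r j).
       (\<forall>i<r j. (xs ! i, ys ! i) \<in> R l) \<longrightarrow> (table_value T j xs, table_value T j ys) \<in> R l)"
    if ?tab for l
    unfolding congruence_def equiv_def refl_on_def univ
    using ar val that by auto
  have alg: "is_algebra ?A \<longleftrightarrow> ?ne \<and> ?cl" if ?tab
    unfolding is_algebra_def univ using ar val that by auto
  have cs: "(\<forall>c\<in>set cs. congruence ?A (set c)) \<longleftrightarrow> (\<forall>l<kc. congruence ?A (R l))"
    by (auto simp: cs_def R_def)
  have len: "length (map set cs) = kc" "\<And>l. l < kc \<Longrightarrow> map set cs ! l = R l"
    by (simp_all add: cs_def R_def)
  have valid: "valid_instance (n, ops, cs) \<longleftrightarrow> ?tab \<and> ?ne \<and> ?cl \<and> ?k \<and> ?sub \<and> ?refl \<and> ?sym \<and> ?trans \<and> ?comp"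
  proof (cases ?tab)
    case True
    have "cs \<noteq> [] \<longleftrightarrow> ?k" by (simp add: cs_def)
    then show ?thesis
      unfolding valid_instance_def prod.case tab alg[OF True] cs cong[OF True] using True by blast
  next
    case False
    then show ?thesis unfolding valid_instance_def prod.case tab by blast
  qed
  have CR: "CR_tuple ?A (map set cs) \<longleftrightarrow> ?CR" if "valid_instance (n, ops, cs)"
  proof -
    have "\<forall>\<theta>\<in>set (map set cs). congruence ?A \<theta>"
      using that unfolding valid_instance_def by auto
    then show ?thesis unfolding CR_tuple_def univ len(1) using len(2) by (auto simp: Bex_def)
  qed
  have "x \<in> CRT \<longleftrightarrow> (?W1 \<and> ?W2) \<and> valid_instance (n, ops, cs) \<and> ?CR"
    using CRT_iff[of x] enc_dec_iff[of x] CR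
    unfolding T_def[symmetric] kc_def[symmetric] dec prod.case by blast
  then show ?thesis unfolding valid by blast
qed

text \<open>
  A certificate is a family of arrays: \<open>A 0\<close> and \<open>A 1\<close> list the positions of the operations and of the
  congruences, and \<open>A 2\<close> the powers of the size of the universe, capped just above the length \<open>N\<close> of the
  input. The arrays \<open>A 3\<close> and \<open>A 5\<close> hold argument tuples, with the values that computing their indices in an operation table runs
  through in \<open>A 4\<close> and \<open>A 6\<close>. The elements that violate the Chinese Remainder condition are in \<open>A 7\<close>, and \<open>A 8\<close>
  holds the paths which show that they are pairwise related by the joins.
\<close>

type_synonym arrays = "nat \<Rightarrow> nat \<Rightarrow> nat"

text \<open>
  The arrays \<open>A 0\<close>, \<open>A 1\<close>, \<open>A 2\<close> satisfy the recurrences that determine them.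
\<close>

definition consistent :: "(nat \<Rightarrow> nat) \<Rightarrow> nat \<Rightarrow> arrays \<Rightarrow> bool" where
  "consistent T N A \<longleftrightarrow>
     A 0 0 = 2 \<and> (\<forall>j<T 1. A 0 (j + 1) = A 0 j + 2 + T (A 0 j + 1)) \<and>
     A 1 0 = A 0 (T 1) + 1 \<and> (\<forall>l<T (A 0 (T 1)). A 1 (l + 1) = A 1 l + 1 + 2 * T (A 1 l)) \<and>
     A 2 0 = 1 \<and> (\<forall>i<N. T 0 * A 2 i < N + 1 \<and> A 2 (i + 1) = T 0 * A 2 i \<or>
       \<not> T 0 * A 2 i < N + 1 \<and> A 2 (i + 1) = N + 1)"

text \<open>
  The pair \<open>(a, b)\<close> is listed in the \<open>l\<close>-th congruence.
\<close>

definition mem :: "(nat \<Rightarrow> nat) \<Rightarrow> arrays \<Rightarrow> nat \<Rightarrow> nat \<Rightarrow> nat \<Rightarrow> bool" where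
  "mem T A l a b \<longleftrightarrow> (\<exists>i<T (A 1 l). T (A 1 l + 1 + 2 * i) = a \<and> T (A 1 l + 2 + 2 * i) = b)"

text \<open>
  The array \<open>A s\<close> holds a tuple of arguments for the \<open>j\<close>-th operation, and \<open>A s'\<close> the computation of its
  index by Horner's rule.
\<close>

definition trace :: "(nat \<Rightarrow> nat) \<Rightarrow> arrays \<Rightarrow> nat \<Rightarrow> nat \<Rightarrow> nat \<Rightarrow> bool" where
  "trace T A j s s' \<longleftrightarrow> A s' 0 = 0 \<and>
     (\<forall>i<T (A 0 j). A s i < T 0 \<and> A s' (i + 1) = A s' i * T 0 + A s i)"

text \<open>
  The table entry at the index that \<open>A s'\<close> ends with.
\<close>

definition entry :: "(nat \<Rightarrow> nat) \<Rightarrow> arrays \<Rightarrow> nat \<Rightarrow> nat \<Rightarrow> nat" where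
  "entry T A j s' = T (A 0 j + 2 + A s' (T (A 0 j)))"

text \<open>
  The ways to fail: no encoding, an empty universe or an empty list of congruences; a table of wrong
  length or with an entry outside the universe; a list of pairs that is no equivalence; an equivalence
  that is incompatible with an operation; no Chinese Remainder tuple.
\<close>

definition bad_syntax :: "bool list \<Rightarrow> arrays \<Rightarrow> bool" where
  "bad_syntax x A \<longleftrightarrow> (let T = tok x; kc = T (A 0 (T 1)) in
     (\<exists>i<length x. i + 1 = length x \<and> x ! i) \<or> ntok x \<noteq> A 1 kc \<or> T 0 = 0 \<or> kc = 0)"

definition bad_table :: "(nat \<Rightarrow> nat) \<Rightarrow> arrays \<Rightarrow> bool" where
  "bad_table T A \<longleftrightarrow> (\<exists>j<T 1. T (A 0 j + 1) \<noteq> A 2 (T (A 0 j)) \<or>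
     trace T A j 3 4 \<and> \<not> entry T A j 4 < T 0)"

definition bad_equiv :: "(nat \<Rightarrow> nat) \<Rightarrow> arrays \<Rightarrow> bool" where
  "bad_equiv T A \<longleftrightarrow> (\<exists>l<T (A 0 (T 1)).
     (\<exists>i<T (A 1 l). \<not> (T (A 1 l + 1 + 2 * i) < T 0 \<and> T (A 1 l + 2 + 2 * i) < T 0)) \<or>
     (\<exists>a<T 0. \<not> mem T A l a a \<or>
       (\<exists>b<T 0. mem T A l a b \<and> (\<not> mem T A l b a \<or>
         (\<exists>c<T 0. mem T A l b c \<and> \<not> mem T A l a c)))))"

definition bad_compat :: "(nat \<Rightarrow> nat) \<Rightarrow> arrays \<Rightarrow> bool" where
  "bad_compat T A \<longleftrightarrow> (\<exists>l<T (A 0 (T 1)). \<exists>j<T 1. trace T A j 3 4 \<and> trace T A j 5 6 \<and>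
     (\<forall>i<T (A 0 j). mem T A l (A 3 i) (A 5 i)) \<and> \<not> mem T A l (entry T A j 4) (entry T A j 6))"

text \<open>
  A relation on \<open>n\<close> elements has at most \<open>n * n\<close> pairs, so that paths of length \<open>n * n\<close> suffice. The path for
  the pair \<open>(l, l')\<close> is the segment of \<open>A 8\<close> that has \<open>n * n + 1\<close> entries and the number \<open>l * kc + l'\<close>, where
  \<open>kc\<close> is the number of congruences.
\<close>

definition bad_CR :: "(nat \<Rightarrow> nat) \<Rightarrow> arrays \<Rightarrow> bool" where
  "bad_CR T A \<longleftrightarrow>
     (\<forall>l<T (A 0 (T 1)). A 7 l < T 0 \<and> (\<forall>l'<T (A 0 (T 1)).
        A 8 ((l * T (A 0 (T 1)) + l') * (T 0 * T 0 + 1)) = A 7 l \<and>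
        A 8 ((l * T (A 0 (T 1)) + l') * (T 0 * T 0 + 1) + T 0 * T 0) = A 7 l' \<and>
        (\<forall>s<T 0 * T 0.
          mem T A l (A 8 ((l * T (A 0 (T 1)) + l') * (T 0 * T 0 + 1) + s))
                    (A 8 ((l * T (A 0 (T 1)) + l') * (T 0 * T 0 + 1) + s + 1)) \<or>
          mem T A l' (A 8 ((l * T (A 0 (T 1)) + l') * (T 0 * T 0 + 1) + s))
                     (A 8 ((l * T (A 0 (T 1)) + l') * (T 0 * T 0 + 1) + s + 1))))) \<and>
     (\<forall>a<T 0. \<exists>l<T (A 0 (T 1)). \<not> mem T A l a (A 7 l))"

definition refutes :: "bool list \<Rightarrow> arrays \<Rightarrow> bool" where
  "refutes x A \<longleftrightarrow> consistent (tok x) (length x) A \<and>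
     (bad_syntax x A \<or> bad_table (tok x) A \<or> bad_equiv (tok x) A \<or> bad_compat (tok x) A \<or>
      bad_CR (tok x) A)"

lemma consistent_positions:
  assumes "consistent T N A"
  shows "j \<le> T 1 \<Longrightarrow> A 0 j = op_pos T j" "A 0 (T 1) = cong_count_pos T"
    "l \<le> T (cong_count_pos T) \<Longrightarrow> A 1 l = cong_pos T l" "i \<le> N \<Longrightarrow> A 2 i = min (T 0 ^ i) (N + 1)"
proof -
  show P: "A 0 j = op_pos T j" if "j \<le> T 1" for j
    using that assms by (induction j) (auto simp: consistent_def)
  show C: "A 0 (T 1) = cong_count_pos T" unfolding cong_count_pos_def by (rule P) simp
  show "l \<le> T (cong_count_pos T) \<Longrightarrow> A 1 l = cong_pos T l"
    using assms unfolding consistent_def C by (induction l) auto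
  show "i \<le> N \<Longrightarrow> A 2 i = min (T 0 ^ i) (N + 1)"
  proof (induction i)
    case 0
    then show ?case using assms by (simp add: consistent_def)
  next
    case (Suc i)
    then have IH: "A 2 i = min (T 0 ^ i) (N + 1)" and i: "i < N" by auto
    have step: "A 2 (Suc i) = min (T 0 * A 2 i) (N + 1)"
      using assms i unfolding consistent_def by (auto simp: min_def not_less)
    show ?case
    proof (cases "T 0 ^ i \<le> N + 1 \<or> T 0 = 0")
      case True
      then show ?thesis unfolding step IH by auto
    next
      case False
      then have "1 * (N + 1) \<le> T 0 * (N + 1)" "T 0 * (N + 1) \<le> T 0 * T 0 ^ i"
        by (intro mult_right_mono mult_left_mono; simp)+
      then show ?thesis unfolding step IH using False by (simp add: min_def)
    qed
  qed
qed

lemma mem_iff: "A 1 l = cong_pos T l \<Longrightarrow> mem T A l a b \<longleftrightarrow> (a, b) \<in> set (dec_cong T l)"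
  by (auto simp: mem_def dec_cong_def)

lemma trace_entry:
  assumes "A 0 j = op_pos T j" "trace T A j s s'"
  shows "map (A s) [0..<T (op_pos T j)] \<in> tuples {..<T 0} (T (op_pos T j))"
    "entry T A j s' = table_value T j (map (A s) [0..<T (op_pos T j)])"
proof -
  have "A s' i = tuple_index (T 0) (map (A s) [0..<i])" if "i \<le> T (op_pos T j)" for i
    using that assms
  proof (induction i)
    case 0
    then show ?case by (simp add: trace_def tuple_index_def)
  next
    case (Suc i)
    then show ?case by (simp add: trace_def tuple_index_snoc)
  qed
  then show "entry T A j s' = table_value T j (map (A s) [0..<T (op_pos T j)])"
    by (simp add: entry_def table_value_def assms(1))
  show "map (A s) [0..<T (op_pos T j)] \<in> tuples {..<T 0} (T (op_pos T j))"
    using assms by (auto simp: tuples_def trace_def)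
qed

lemma last_bit: "(\<exists>i<length x. i + 1 = length x \<and> x ! i) \<longleftrightarrow> \<not> (x = [] \<or> \<not> last x)"
  by (cases x rule: rev_cases) (auto simp: nth_append)

lemma path_trancl:
  fixes m :: nat
  assumes "\<And>s. s < m \<Longrightarrow> (g s, g (s + 1)) \<in> R" "0 < m"
  shows "(g 0, g m) \<in> R\<^sup>+"
proof -
  have "(g 0, g m) \<in> R ^^ m" unfolding relpow_fun_conv using assms(1) by (intro exI[of _ g]) auto
  then show ?thesis using assms(2) trancl_power by blast
qed

text \<open>
  No validity has to be checked by a refutation: if \<open>x\<close> is in \<open>CRT\<close> then it is valid, and each way to
  fail is contradicted.
\<close>

lemma refutes_sound:
  assumes "refutes x A"
  shows "x \<notin> CRT"
proof
  assume x: "x \<in> CRT"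
  let ?T = "tok x"
  define n where "n = ?T 0"
  define kc where "kc = ?T (cong_count_pos ?T)"
  define R where "R = (\<lambda>l. set (dec_cong ?T l))"
  define r where "r = (\<lambda>j. ?T (op_pos ?T j))"
  note C = x[unfolded CRT_iff_conditions[OF refl n_def kc_def R_def r_def]]
  have cons: "consistent ?T (length x) A" using assms by (simp add: refutes_def)
  note pos = consistent_positions[OF cons, folded kc_def n_def]
  have mem: "mem ?T A l a b \<longleftrightarrow> (a, b) \<in> R l" if "l < kc" for l a b
    using mem_iff[of A l ?T] pos(3)[of l] that by (simp add: R_def)
  have tr: "map (A s) [0..<r j] \<in> tuples {..<n} (r j)"
    "entry ?T A j s' = table_value ?T j (map (A s) [0..<r j])" if "j < ?T 1" "trace ?T A j s s'" for j s s'
    using trace_entry[OF pos(1) that(2)] that(1) by (simp_all add: r_def n_def)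
  have "\<not> bad_syntax x A"
    unfolding bad_syntax_def Let_def last_bit pos(2) kc_def[symmetric] n_def[symmetric]
    using C pos(3)[of kc] by simp
  moreover have "\<not> bad_table ?T A"
  proof
    assume "bad_table ?T A"
    then obtain j where j: "j < ?T 1" and
      "?T (A 0 j + 1) \<noteq> A 2 (?T (A 0 j)) \<or> trace ?T A j 3 4 \<and> \<not> entry ?T A j 4 < n"
      unfolding bad_table_def n_def by blast
    moreover have "?T (A 0 j + 1) = A 2 (?T (A 0 j))"
    proof -
      have "n ^ r j = ?T (op_pos ?T j + 1)" using C j by simp
      also have "\<dots> \<le> length x" by (rule tok_le)
      finally have "n ^ r j \<le> length x" .
      then have "A 2 (r j) = n ^ r j" using pos(4)[of "r j"] tok_le[of x "op_pos ?T j"] by (simp add: r_def)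
      then show ?thesis using C j pos(1)[of j] by (simp add: r_def)
    qed
    ultimately have "trace ?T A j 3 4" "\<not> entry ?T A j 4 < n" by blast+
    then show False using C tr[OF j] j by metis
  qed
  moreover have "\<not> bad_equiv ?T A"
  proof
    assume "bad_equiv ?T A"
    then obtain l where l: "l < kc" and *:
      "(\<exists>i<?T (A 1 l). \<not> (?T (A 1 l + 1 + 2 * i) < n \<and> ?T (A 1 l + 2 + 2 * i) < n)) \<or>
       (\<exists>a<n. \<not> mem ?T A l a a \<or> (\<exists>b<n. mem ?T A l a b \<and> (\<not> mem ?T A l b a \<or>
         (\<exists>c<n. mem ?T A l b c \<and> \<not> mem ?T A l a c))))"
      unfolding bad_equiv_def pos(2) kc_def[symmetric] n_def[symmetric] by blast
    have R: "R l \<subseteq> {..<n} \<times> {..<n}" "\<forall>a<n. (a, a) \<in> R l" "sym (R l)" "trans (R l)"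
      using C l by blast+
    have "mem ?T A l (?T (A 1 l + 1 + 2 * i)) (?T (A 1 l + 2 + 2 * i))" if "i < ?T (A 1 l)" for i
      using that by (auto simp: mem_def)
    then have "?T (A 1 l + 1 + 2 * i) < n \<and> ?T (A 1 l + 2 + 2 * i) < n" if "i < ?T (A 1 l)" for i
      using that R(1) unfolding mem[OF l] by blast
    with * show False unfolding mem[OF l] using R(2-4) by (meson symE transE)
  qed
  moreover have "\<not> bad_compat ?T A"
  proof
    assume "bad_compat ?T A"
    then obtain l j where l: "l < kc" and j: "j < ?T 1" and t: "trace ?T A j 3 4" "trace ?T A j 5 6"
      and *: "\<forall>i<?T (A 0 j). mem ?T A l (A 3 i) (A 5 i)"
        "\<not> mem ?T A l (entry ?T A j 4) (entry ?T A j 6)"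
      unfolding bad_compat_def pos(2) kc_def[symmetric] by blast
    have "?T (A 0 j) = r j" using pos(1)[of j] j by (simp add: r_def)
    then have "\<forall>i<r j. (map (A 3) [0..<r j] ! i, map (A 5) [0..<r j] ! i) \<in> R l"
      using *(1) unfolding mem[OF l] by simp
    then have "(table_value ?T j (map (A 3) [0..<r j]), table_value ?T j (map (A 5) [0..<r j])) \<in> R l"
      using C l j tr(1)[OF j t(1)] tr(1)[OF j t(2)] by blast
    then show False using *(2) unfolding mem[OF l] tr(2)[OF j t(1)] tr(2)[OF j t(2)] by blast
  qed
  moreover have "\<not> bad_CR ?T A"
  proof
    assume B: "bad_CR ?T A"
    note B = B[unfolded bad_CR_def pos(2), folded kc_def n_def]
    let ?as = "map (A 7) [0..<kc]"
    have t: "?as \<in> tuples {..<n} kc" using B by (auto simp: tuples_def)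
    have j: "(A 7 l, A 7 l') \<in> cong_join (R l) (R l')" if l: "l < kc" "l' < kc" for l l'
    proof -
      let ?o = "(l * kc + l') * (n * n + 1)"
      have *: "A 8 ?o = A 7 l" "A 8 (?o + n * n) = A 7 l'"
        "\<forall>s<n * n. mem ?T A l (A 8 (?o + s)) (A 8 (?o + s + 1)) \<or>
           mem ?T A l' (A 8 (?o + s)) (A 8 (?o + s + 1))"
        using B l by blast+
      then have "(A 8 (?o + s), A 8 (?o + (s + 1))) \<in> R l \<union> R l'" if "s < n * n" for s
        using that unfolding mem[OF l(1)] mem[OF l(2)] by (auto simp: add.assoc)
      then show ?thesis using path_trancl[of "n * n" "\<lambda>s. A 8 (?o + s)" "R l \<union> R l'"] C *(1,2)
        by (simp add: cong_join_def)
    qed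
    have "\<forall>l<kc. \<forall>l'<kc. (?as ! l, ?as ! l') \<in> cong_join (R l) (R l')" using j by simp
    moreover have "\<forall>as\<in>tuples {..<n} kc. (\<forall>l<kc. \<forall>l'<kc. (as ! l, as ! l') \<in> cong_join (R l) (R l')) \<longrightarrow>
       (\<exists>a<n. \<forall>l<kc. (a, as ! l) \<in> R l)" using C by blast
    ultimately obtain a where "a < n" "\<forall>l<kc. (a, ?as ! l) \<in> R l" using t by blast
    then show False using B mem by auto
  qed
  ultimately show False using assms by (simp add: refutes_def)
qed

text \<open>
  Arrays with values at most \<open>V\<close> that vanish from index \<open>L\<close> on; the bounds below are for an input of
  length \<open>N\<close>.
\<close>

definition bounded :: "nat \<Rightarrow> nat \<Rightarrow> arrays \<Rightarrow> bool" where
  "bounded L V A \<longleftrightarrow> (\<forall>s i. A s i \<le> V \<and> (L \<le> i \<longrightarrow> A s i = 0))"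

definition Lbound :: "nat \<Rightarrow> nat" where "Lbound N = N * N * (N * N + 1) + N + 2"

definition Vbound :: "nat \<Rightarrow> nat" where "Vbound N = 2 + N * (N + 2) + 1 + N * (2 * N + 1) + N"

text \<open>
  The arrays that every certificate contains, together with given witnesses \<open>W\<close>.
\<close>

definition certificate :: "(nat \<Rightarrow> nat) \<Rightarrow> nat \<Rightarrow> (nat \<Rightarrow> nat \<Rightarrow> nat) \<Rightarrow> arrays" where
  "certificate T N W = (\<lambda>s i.
     if s = 0 then (if i \<le> T 1 then op_pos T i else 0)
     else if s = 1 then (if i \<le> T (cong_count_pos T) then cong_pos T i else 0)
     else if s = 2 then (if i \<le> N then min (T 0 ^ i) (N + 1) else 0)
     else W s i)"

lemma certificate_apply[simp]:
  "j \<le> T 1 \<Longrightarrow> certificate T N W 0 j = op_pos T j"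
  "l \<le> T (cong_count_pos T) \<Longrightarrow> certificate T N W (Suc 0) l = cong_pos T l"
  "i \<le> N \<Longrightarrow> certificate T N W 2 i = min (T 0 ^ i) (N + 1)"
  "2 < s \<Longrightarrow> certificate T N W s i = W s i"
  by (auto simp: certificate_def)

lemma op_pos_le: "(\<And>i. T i \<le> N) \<Longrightarrow> op_pos T j \<le> 2 + j * (N + 2)"
proof (induction j)
  case (Suc j)
  then have "op_pos T j \<le> 2 + j * (N + 2)" "T (op_pos T j + 1) \<le> N" by auto
  then show ?case by simp
qed simp

lemma cong_pos_le: "(\<And>i. T i \<le> N) \<Longrightarrow> cong_pos T l \<le> cong_count_pos T + 1 + l * (2 * N + 1)"
proof (induction l)
  case (Suc l)
  then have "cong_pos T l \<le> cong_count_pos T + 1 + l * (2 * N + 1)" "T (cong_pos T l) \<le> N" by auto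
  then show ?case by simp
qed simp

lemma certificate_consistent:
  "consistent T N (certificate T N W)"
proof -
  have c: "certificate T N W 0 (T 1) = cong_count_pos T" by (simp add: cong_count_pos_def)
  have z: "T 0 * min (T 0 ^ i) (N + 1) < N + 1 \<and> min (T 0 ^ (i + 1)) (N + 1) = T 0 * min (T 0 ^ i) (N + 1) \<or>
     \<not> T 0 * min (T 0 ^ i) (N + 1) < N + 1 \<and> min (T 0 ^ (i + 1)) (N + 1) = N + 1" for i
  proof (cases "T 0 ^ i \<le> N + 1 \<or> T 0 = 0")
    case True
    then show ?thesis by (auto simp: min_def)
  next
    case False
    then have "1 * (N + 1) \<le> T 0 * (N + 1)" "T 0 * (N + 1) \<le> T 0 * T 0 ^ i"
      by (intro mult_right_mono mult_left_mono; simp)+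
    then show ?thesis using False by (simp add: min_def)
  qed
  show ?thesis
    unfolding consistent_def c using z by (auto simp: cong_count_pos_def)
qed

lemma certificate_bounded:
  assumes T: "\<And>i. T i \<le> N" and W: "\<And>s i. W s i \<le> N" "\<And>s i. Lbound N \<le> i \<Longrightarrow> W s i = 0"
  shows "bounded (Lbound N) (Vbound N) (certificate T N W)"
proof -
  have p: "op_pos T j \<le> 2 + N * (N + 2)" if "j \<le> N" for j
  proof -
    have "j * (N + 2) \<le> N * (N + 2)" using that by (rule mult_right_mono) simp
    then show ?thesis using op_pos_le[of T N j] T by simp
  qed
  then have c: "cong_count_pos T \<le> 2 + N * (N + 2)" unfolding cong_count_pos_def using T by blast
  have q: "cong_pos T l \<le> 2 + N * (N + 2) + 1 + N * (2 * N + 1)" if "l \<le> N" for l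
  proof -
    have "l * (2 * N + 1) \<le> N * (2 * N + 1)" using that by (rule mult_right_mono) simp
    then show ?thesis using cong_pos_le[of T N l] T c by simp
  qed
  have "certificate T N W s i \<le> Vbound N" for s i
    unfolding certificate_def Vbound_def
    using p[of i] q[of i] T[of 1] T[of "cong_count_pos T"] W(1)[of s i] by auto
  moreover have "certificate T N W s i = 0" if i: "Lbound N \<le> i" for s i
  proof -
    have "N < i" using i by (simp add: Lbound_def)
    then have "\<not> i \<le> T 1" "\<not> i \<le> T (cong_count_pos T)" "\<not> i \<le> N"
      using T[of 1] T[of "cong_count_pos T"] by simp_all
    then show ?thesis using W(2)[OF i] by (simp add: certificate_def)
  qed
  ultimately show ?thesis unfolding bounded_def by blast
qed

lemma radix_div: "s < m \<Longrightarrow> (a * m + s) div m = (a :: nat)"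
  by simp

lemma radix_mod: "s < m \<Longrightarrow> (a * m + s) mod m = (s :: nat)"
  by simp

text \<open>
  Shorter paths are prolonged by repeating their last point, as the relation is reflexive.
\<close>

lemma relpow_path:
  fixes n :: nat
  assumes R: "R \<subseteq> {..<n} \<times> {..<n}" and rf: "\<forall>a<n. (a, a) \<in> R" and ab: "(a, b) \<in> R\<^sup>+"
  shows "\<exists>g. g 0 = a \<and> g (n * n) = b \<and> (\<forall>s<n * n. (g s, g (s + 1)) \<in> R) \<and> (\<forall>s. g s < n)"
proof -
  have fin: "finite R" using R by (rule finite_subset) simp
  have "card R \<le> card ({..<n} \<times> {..<n})" using R by (intro card_mono) auto
  then have c: "card R \<le> n * n" by simp
  from ab obtain k where "0 < k" "(a, b) \<in> R ^^ k" unfolding trancl_power by blast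
  then have "(a, b) \<in> (\<Union>k\<in>{k. 0 < k \<and> k \<le> card R}. R ^^ k)"
    using relpow_finite_bounded1[OF fin] by blast
  then obtain m where m: "0 < m" "m \<le> n * n" "(a, b) \<in> R ^^ m" using c by auto
  then obtain f where f: "f 0 = a" "f m = b" "\<forall>i<m. (f i, f (Suc i)) \<in> R"
    unfolding relpow_fun_conv by blast
  let ?g = "\<lambda>s. f (min s m)"
  have fn: "f i < n" if "i \<le> m" for i
  proof (cases "i = m")
    case True
    have "(f (m - 1), f (Suc (m - 1))) \<in> R" using f(3) m(1) by (metis diff_less zero_less_one)
    then show ?thesis using R True m(1) by auto
  next
    case False
    then have "(f i, f (Suc i)) \<in> R" using f(3) that by simp
    then show ?thesis using R by auto
  qed
  have "(?g s, ?g (s + 1)) \<in> R" for s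
  proof (cases "s < m")
    case True
    then show ?thesis using f(3) by simp
  next
    case False
    then show ?thesis using rf fn[of m] by (simp add: min_def)
  qed
  then show ?thesis using f m fn by (intro exI[of _ ?g]) auto
qed

text \<open>
  The ways to fail are excluded one after the other. Once the lengths of the tables are known to be powers
  of the size of the universe, they bound the indices of tuples, so that the remaining witnesses fit
  into the certificate.
\<close>

lemma refutes_complete:
  assumes "x \<notin> CRT"
  shows "\<exists>A. refutes x A \<and> bounded (Lbound (length x)) (Vbound (length x)) A"
proof -
  define T where "T = tok x"
  define N where "N = length x"
  define n where "n = T 0"
  define kc where "kc = T (cong_count_pos T)"
  define R where "R = (\<lambda>l. set (dec_cong T l))"
  define r where "r = (\<lambda>j. T (op_pos T j))"
  note iff = CRT_iff_conditions[OF T_def n_def kc_def R_def r_def]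
  have TN: "T i \<le> N" for i unfolding T_def N_def by (rule tok_le)
  let ?C = "certificate T N"
  have cons: "consistent T N (?C W)" for W by (rule certificate_consistent)
  have bdd: "bounded (Lbound N) (Vbound N) (?C W)"
    if "\<And>s i. W s i \<le> N" "\<And>s i. Lbound N \<le> i \<Longrightarrow> W s i = 0" for W
    using certificate_bounded[of T N W] TN that by blast
  have c: "?C W 0 (T (Suc 0)) = cong_count_pos T" for W by (simp add: cong_count_pos_def)
  have mem: "mem T (?C W) l a b \<longleftrightarrow> (a, b) \<in> R l" if "l < kc" for W l a b
    using mem_iff[of "?C W" l T a b] that by (simp add: R_def kc_def)
  have fin: "\<exists>A. refutes x A \<and> bounded (Lbound (length x)) (Vbound (length x)) A"
    if "bad_syntax x (?C W) \<or> bad_table T (?C W) \<or> bad_equiv T (?C W) \<or> bad_compat T (?C W) \<or> bad_CR T (?C W)"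
      "\<And>s i. W s i \<le> N" "\<And>s i. Lbound N \<le> i \<Longrightarrow> W s i = 0" for W
    using that cons[of W] bdd[of W] unfolding refutes_def T_def N_def by blast
  define Z :: "nat \<Rightarrow> nat \<Rightarrow> nat" where "Z = (\<lambda>_ _. 0)"
  have Z: "Z s i \<le> N" "Z s i = 0" for s i by (simp_all add: Z_def)
  note finZ = fin[of Z, OF _ Z(1) Z(2)]
  \<comment> \<open>the arrays that present a tuple, and the values that computing its index runs through\<close>
  define tup :: "nat list \<Rightarrow> nat \<Rightarrow> nat" where
    "tup = (\<lambda>xs i. if i < length xs then xs ! i else 0)"
  define idx :: "nat list \<Rightarrow> nat \<Rightarrow> nat" where
    "idx = (\<lambda>xs i. if i \<le> length xs then tuple_index n (take i xs) else 0)"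
  have tupN: "tup xs i \<le> N" if "set xs \<subseteq> {..<n}" for xs i
  proof (cases "i < length xs")
    case True
    then have "xs ! i \<in> {..<n}" using that by (intro subsetD[OF that]) simp
    then show ?thesis using TN[of 0] by (simp add: tup_def n_def)
  qed (simp add: tup_def)
  have L: "N < Lbound N" by (simp add: Lbound_def)
  show ?thesis
  proof (rule ccontr)
    assume no: "\<not> ?thesis"
    then have nb: "\<not> bad_syntax x (?C Z)" "\<not> bad_table T (?C Z)" "\<not> bad_equiv T (?C Z)" using finZ by blast+
    have 1: "x = [] \<or> \<not> last x" "ntok x = cong_pos T kc" "0 < n" "0 < kc"
      using nb(1) unfolding bad_syntax_def Let_def last_bit by (auto simp: T_def[symmetric] c kc_def n_def)
    have 2: "\<forall>j<T 1. T (op_pos T j + 1) = n ^ r j"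
    proof (intro allI impI)
      fix j assume j: "j < T 1"
      then have "T (op_pos T j + 1) = min (n ^ r j) (N + 1)"
        using nb(2) TN[of "op_pos T j"] unfolding bad_table_def by (auto simp: r_def n_def)
      then show "T (op_pos T j + 1) = n ^ r j" using TN[of "op_pos T j + 1"] by (simp add: min_def split: if_splits)
    qed
    have rN: "r j \<le> N" for j using TN by (simp add: r_def)
    have idxN: "idx xs i \<le> N" if "j < T 1" "xs \<in> tuples {..<n} (r j)" for j xs i
    proof (cases "i \<le> length xs")
      case True
      have xs: "set xs \<subseteq> {..<n}" "length xs = r j" using that(2) by (auto simp: tuples_def)
      have "tuple_index n (take i xs) < n ^ length (take i xs)"
        using xs set_take_subset[of i xs] by (intro tuple_index_less) blast
      also have "\<dots> \<le> n ^ r j" using 1(3) xs(2) by (intro power_increasing) auto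
      also have "\<dots> \<le> N" using 2 that(1) TN[of "op_pos T j + 1"] by simp
      finally show ?thesis by (simp add: idx_def)
    qed (simp add: idx_def)
    have sup: "tup xs i = 0" "idx xs i = 0" if "Lbound N \<le> i" "xs \<in> tuples {..<n} (r j)" for xs i j
      using that rN[of j] L by (auto simp: tup_def idx_def tuples_def)
    have tr: "trace T (?C W) j s s'" "entry T (?C W) j s' = table_value T j xs"
      if "j < T 1" "xs \<in> tuples {..<n} (r j)" "2 < s" "2 < s'" "W s = tup xs" "W s' = idx xs" for W j s s' xs
    proof -
      have xs: "set xs \<subseteq> {..<n}" "length xs = r j" using that(2) by (auto simp: tuples_def)
      have "tup xs i < n" if "i < r j" for i
      proof -
        have "xs ! i \<in> {..<n}" using xs(1) by (rule subsetD) (simp add: xs(2) that)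
        then show ?thesis using xs that by (simp add: tup_def)
      qed
      then show "trace T (?C W) j s s'"
        using that xs(2) unfolding trace_def
        by (auto simp: r_def n_def[symmetric] idx_def tup_def take_Suc_conv_app_nth tuple_index_snoc)
          (simp add: tuple_index_def)
      show "entry T (?C W) j s' = table_value T j xs"
        using that xs(2) by (simp add: entry_def table_value_def idx_def r_def n_def)
    qed
    have 3: "\<forall>j<T 1. \<forall>xs\<in>tuples {..<n} (r j). table_value T j xs < n"
    proof (intro allI ballI impI, rule ccontr)
      fix j xs assume j: "j < T 1" and xs: "xs \<in> tuples {..<n} (r j)" and "\<not> table_value T j xs < n"
      let ?W = "Z(3 := tup xs, 4 := idx xs)"
      have "bad_table T (?C ?W)"
        using tr[OF j xs, of 3 4 ?W] j \<open>\<not> table_value T j xs < n\<close> unfolding bad_table_def n_def[symmetric] by auto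
      moreover have "?W s i \<le> N" "Lbound N \<le> i \<Longrightarrow> ?W s i = 0" for s i
        using tupN[of xs i] idxN[OF j xs, of i] sup[OF _ xs, of i] Z xs by (auto simp: tuples_def)
      ultimately show False using fin[of ?W] no by blast
    qed
    have ne: "\<not> (\<exists>i<T (cong_pos T l). \<not> (T (cong_pos T l + 1 + 2 * i) < n \<and> T (cong_pos T l + 2 + 2 * i) < n))"
      "\<not> (\<exists>a<n. (a, a) \<notin> R l \<or> (\<exists>b<n. (a, b) \<in> R l \<and> ((b, a) \<notin> R l \<or>
         (\<exists>c<n. (b, c) \<in> R l \<and> (a, c) \<notin> R l))))" if "l < kc" for l
    proof -
      have "\<not> ((\<exists>i<T (?C Z 1 l). \<not> (T (?C Z 1 l + 1 + 2 * i) < T 0 \<and> T (?C Z 1 l + 2 + 2 * i) < T 0)) \<or>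
     (\<exists>a<T 0. \<not> mem T (?C Z) l a a \<or>
       (\<exists>b<T 0. mem T (?C Z) l a b \<and> (\<not> mem T (?C Z) l b a \<or>
         (\<exists>c<T 0. mem T (?C Z) l b c \<and> \<not> mem T (?C Z) l a c)))))"
        using nb(3) that unfolding bad_equiv_def by (auto simp: c kc_def)
      moreover have "?C Z 1 l = cong_pos T l" using that by (simp add: kc_def)
      ultimately show "\<not> (\<exists>i<T (cong_pos T l). \<not> (T (cong_pos T l + 1 + 2 * i) < n \<and> T (cong_pos T l + 2 + 2 * i) < n))"
        "\<not> (\<exists>a<n. (a, a) \<notin> R l \<or> (\<exists>b<n. (a, b) \<in> R l \<and> ((b, a) \<notin> R l \<or>
         (\<exists>c<n. (b, c) \<in> R l \<and> (a, c) \<notin> R l))))"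
        unfolding mem[OF that] n_def[symmetric] by auto
    qed
    have 4: "\<forall>l<kc. R l \<subseteq> {..<n} \<times> {..<n}" using ne(1) by (fastforce simp: R_def dec_cong_def)
    have 5: "\<forall>l<kc. \<forall>a<n. (a, a) \<in> R l" using ne(2) by blast
    have 6: "\<forall>l<kc. sym (R l)" using ne(2) 4 unfolding sym_def by blast
    have 7: "\<forall>l<kc. trans (R l)" using ne(2) 4 unfolding trans_def by blast
    have 8: "\<forall>l<kc. \<forall>j<T 1. \<forall>xs\<in>tuples {..<n} (r j). \<forall>ys\<in>tuples {..<n} (r j).
       (\<forall>i<r j. (xs ! i, ys ! i) \<in> R l) \<longrightarrow> (table_value T j xs, table_value T j ys) \<in> R l"
    proof (intro allI ballI impI, rule ccontr)
      fix l j xs ys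
      assume l: "l < kc" and j: "j < T 1" and xs: "xs \<in> tuples {..<n} (r j)"
        and ys: "ys \<in> tuples {..<n} (r j)" and *: "\<forall>i<r j. (xs ! i, ys ! i) \<in> R l"
        "(table_value T j xs, table_value T j ys) \<notin> R l"
      let ?W = "Z(3 := tup xs, 4 := idx xs, 5 := tup ys, 6 := idx ys)"
      have len: "length xs = r j" "length ys = r j" using xs ys by (auto simp: tuples_def)
      have e: "T (?C ?W 0 j) = r j" using j by (simp add: r_def)
      have "\<forall>i<r j. mem T (?C ?W) l (?C ?W 3 i) (?C ?W 5 i)"
        unfolding mem[OF l] using *(1) len by (simp add: tup_def)
      moreover have "\<not> mem T (?C ?W) l (entry T (?C ?W) j 4) (entry T (?C ?W) j 6)"
        unfolding mem[OF l] using tr(2)[OF j xs, of 3 4 ?W] tr(2)[OF j ys, of 5 6 ?W] *(2) by simp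
      moreover have "trace T (?C ?W) j 3 4" "trace T (?C ?W) j 5 6"
        using tr(1)[OF j xs, of 3 4 ?W] tr(1)[OF j ys, of 5 6 ?W] by simp_all
      moreover have "l < T (?C ?W 0 (T 1))" using l c by (simp add: kc_def)
      ultimately have "bad_compat T (?C ?W)" unfolding bad_compat_def using j e by metis
      moreover have "?W s i \<le> N" "Lbound N \<le> i \<Longrightarrow> ?W s i = 0" for s i
        using tupN[of xs i] idxN[OF j xs, of i] sup[OF _ xs, of i] Z xs
          tupN[of ys i] idxN[OF j ys, of i] sup[OF _ ys, of i] ys by (auto simp: tuples_def)
      ultimately show False using fin[of ?W] no by blast
    qed
    have 9: "\<forall>as\<in>tuples {..<n} kc. (\<forall>l<kc. \<forall>l'<kc. (as ! l, as ! l') \<in> cong_join (R l) (R l')) \<longrightarrow>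
       (\<exists>a<n. \<forall>l<kc. (a, as ! l) \<in> R l)"
    proof (intro ballI impI, rule ccontr)
      fix as
      assume as: "as \<in> tuples {..<n} kc"
        and j: "\<forall>l<kc. \<forall>l'<kc. (as ! l, as ! l') \<in> cong_join (R l) (R l')"
        and none: "\<not> (\<exists>a<n. \<forall>l<kc. (a, as ! l) \<in> R l)"
      let ?M = "n * n + 1"
      have "\<exists>g. g 0 = as ! l \<and> g (n * n) = as ! l' \<and> (\<forall>s<n * n. (g s, g (s + 1)) \<in> R l \<union> R l') \<and> (\<forall>s. g s < n)"
        if "l < kc" "l' < kc" for l l'
      proof (rule relpow_path)
        show "(as ! l, as ! l') \<in> (R l \<union> R l')\<^sup>+" using j that by (simp add: cong_join_def)
        show "R l \<union> R l' \<subseteq> {..<n} \<times> {..<n}" using 4 that by blast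
        show "\<forall>a<n. (a, a) \<in> R l \<union> R l'" using 5 that by blast
      qed
      then obtain g where g: "\<And>l l'. l < kc \<Longrightarrow> l' < kc \<Longrightarrow> g l l' 0 = as ! l \<and> g l l' (n * n) = as ! l' \<and>
          (\<forall>s<n * n. (g l l' s, g l l' (s + 1)) \<in> R l \<union> R l') \<and> (\<forall>s. g l l' s < n)" by metis
      define G where "G = (\<lambda>i. if i < kc * kc * ?M then g (i div ?M div kc) (i div ?M mod kc) (i mod ?M) else 0)"
      have G: "G ((l * kc + l') * ?M + s) = g l l' s" if "l < kc" "l' < kc" "s \<le> n * n" for l l' s
      proof -
        have "l * kc + l' < kc * kc"
        proof -
          have "l * kc + l' < Suc l * kc" using that by simp
          also have "\<dots> \<le> kc * kc" using that by (intro mult_right_mono) auto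
          finally show ?thesis .
        qed
        then have "Suc (l * kc + l') * ?M \<le> kc * kc * ?M" by (intro mult_right_mono) auto
        then have "(l * kc + l') * ?M + s < kc * kc * ?M" using that(3) by simp
        moreover have "((l * kc + l') * ?M + s) div ?M = l * kc + l'" "((l * kc + l') * ?M + s) mod ?M = s"
          using that(3) by (intro radix_div radix_mod; simp)+
        ultimately show ?thesis using that by (simp add: G_def)
      qed
      let ?W = "Z(7 := tup as, 8 := G)"
      have len: "length as = kc" "set as \<subseteq> {..<n}" using as by (auto simp: tuples_def)
      have c': "T (?C ?W 0 (T 1)) = kc" using c by (simp add: kc_def)
      have W: "?C ?W 7 = tup as" "?C ?W 8 = G" by (simp_all add: fun_eq_iff)
      have A: "tup as l < n" if "l < kc" for l
      proof -
        have "as ! l \<in> {..<n}" using len(2) by (rule subsetD) (simp add: len(1) that)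
        then show ?thesis using len that by (simp add: tup_def)
      qed
      have B: "G ((l * kc + l') * ?M) = tup as l \<and> G ((l * kc + l') * ?M + n * n) = tup as l' \<and>
          (\<forall>s<n * n. (G ((l * kc + l') * ?M + s), G ((l * kc + l') * ?M + s + 1)) \<in> R l \<or>
            (G ((l * kc + l') * ?M + s), G ((l * kc + l') * ?M + s + 1)) \<in> R l')"
        if l: "l < kc" "l' < kc" for l l'
      proof -
        have "G ((l * kc + l') * ?M + s + 1) = g l l' (s + 1)" if "s < n * n" for s
          using G[OF l, of "s + 1"] that by (simp add: add.assoc)
        then show ?thesis
          using g[OF l] G[OF l] G[OF l, of 0] l len(1) by (auto simp: tup_def)
      qed
      have D: "\<exists>l<kc. (a, tup as l) \<notin> R l" if "a < n" for a
        using none that len(1) by (auto simp: tup_def)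
      have "bad_CR T (?C ?W)"
        unfolding bad_CR_def c' W n_def[symmetric]
        by (rule conjI, use A B mem in simp, use D mem in blast)
      moreover have "?W s i \<le> N \<and> (Lbound N \<le> i \<longrightarrow> ?W s i = 0)" for s i
      proof -
        have kN: "kc \<le> N" "n \<le> N" using TN by (simp_all add: kc_def n_def)
        have "G i \<le> N"
        proof (cases "i < kc * kc * ?M")
          case True
          have "i div ?M < kc * kc" using True by (intro less_mult_imp_div_less)
          then have "i div ?M div kc < kc" "i div ?M mod kc < kc"
            using 1(4) by (auto intro: less_mult_imp_div_less)
          then have "G i < n" using g True unfolding G_def by simp
          then show ?thesis using kN by simp
        qed (simp add: G_def)
        moreover have "G i = 0" if "Lbound N \<le> i"
        proof -
          have "kc * kc * ?M \<le> N * N * (N * N + 1)" using kN by (intro mult_mono add_mono) auto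
          then have "\<not> i < kc * kc * ?M" using that by (simp add: Lbound_def)
          then show ?thesis by (simp add: G_def)
        qed
        moreover have "tup as i = 0" if "Lbound N \<le> i" using that kN(1) L len(1) by (simp add: tup_def)
        ultimately show ?thesis using tupN[OF len(2), of i] Z by auto
      qed
      ultimately show False using fin[of ?W] no by blast
    qed
    have "x \<in> CRT" unfolding iff using 1 2 3 4 5 6 7 8 9 by blast
    with assms show False by blast
  qed
qed

section \<open>A verifier, and membership in coNP\<close>

text \<open>
  Nine arrays are interleaved in the tokens of one string.
\<close>

definition arr :: "bool list \<Rightarrow> arrays" where
  "arr y s i = tok y (9 * i + s)"

lemma ex_array_string:
  assumes A: "bounded L V A"
  shows "\<exists>y. length y \<le> 9 * L * (V + 1) \<and> (\<forall>s<9. \<forall>i. arr y s i = A s i)"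
proof -
  define f where "f = (\<lambda>m. A (m mod 9) (m div 9))"
  let ?y = "enc_tokens (map f [0..<9 * L])"
  have "length ?y = sum_list (map (\<lambda>m. f m + 1) [0..<9 * L])"
    by (simp add: enc_tokens_def length_concat comp_def enc_nat_def)
  also have "\<dots> \<le> sum_list (map (\<lambda>m. V + 1) [0..<9 * L])"
    using A by (intro sum_list_mono) (simp add: f_def bounded_def)
  also have "\<dots> = 9 * L * (V + 1)" by (simp add: sum_list_triv)
  finally have "length ?y \<le> 9 * L * (V + 1)" .
  moreover have "arr ?y s i = A s i" if "s < 9" for s i
  proof (cases "i < L")
    case True
    then have "9 * i + s < 9 * L" using that by simp
    then show ?thesis using that by (simp add: arr_def tok_enc_tokens f_def)
  next
    case False
    then have "\<not> 9 * i + s < 9 * L" "A s i = 0" using A by (simp_all add: bounded_def)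
    then show ?thesis by (simp add: arr_def tok_enc_tokens)
  qed
  ultimately show ?thesis by blast
qed

lemma refutes_cong:
  assumes "\<And>s i. s < 9 \<Longrightarrow> A s i = B s i" "refutes x A"
  shows "refutes x B"
proof -
  have "A s = B s" if "s < 9" for s using assms(1)[OF that] by (simp add: fun_eq_iff)
  then have *: "A 0 = B 0" "A 1 = B 1" "A 2 = B 2" "A 3 = B 3" "A 4 = B 4" "A 5 = B 5" "A 6 = B 6"
    "A 7 = B 7" "A 8 = B 8" by simp_all
  show ?thesis
    using assms(2)
    unfolding refutes_def consistent_def bad_syntax_def bad_table_def bad_equiv_def bad_compat_def
      bad_CR_def trace_def entry_def mem_def * .
qed

lemma not_CRT_iff:
  "x \<notin> CRT \<longleftrightarrow> (\<exists>y. length y \<le> 9 * Lbound (length x) * (Vbound (length x) + 1) \<and> refutes x (arr y))"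
proof
  assume "x \<notin> CRT"
  then obtain A where A: "refutes x A" "bounded (Lbound (length x)) (Vbound (length x)) A"
    using refutes_complete by blast
  from ex_array_string[OF A(2)] obtain y where
    y: "length y \<le> 9 * Lbound (length x) * (Vbound (length x) + 1)" "\<And>s i. s < 9 \<Longrightarrow> arr y s i = A s i"
    by blast
  then show "\<exists>y. length y \<le> 9 * Lbound (length x) * (Vbound (length x) + 1) \<and> refutes x (arr y)"
    using refutes_cong[OF _ A(1)] by metis
qed (use refutes_sound in blast)

subsection \<open>The verifier\<close>

abbreviation psucc :: "prog \<Rightarrow> prog" where "psucc P \<equiv> Seq P (Emit True)"

abbreviation padd :: "prog \<Rightarrow> nat \<Rightarrow> prog" where "padd P n \<equiv> Seq P (pnat n)"

text \<open>
  In the verifier, variable \<open>1\<close> holds the instance and variable \<open>2\<close> the certificate.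
\<close>

definition p_token :: "prog \<Rightarrow> prog" where "p_token P = ptok (Var 1) P"

definition p_array :: "nat \<Rightarrow> prog \<Rightarrow> prog" where
  "p_array s P = ptok (Var 2) (Seq (pmul (pnat 9) P) (pnat s))"

lemma num_p_token[simp]: "num (p_token P) e = tok (e 1) (num P e)"
  by (simp add: p_token_def)

lemma num_p_array[simp]: "num (p_array s P) e = arr (e 2) s (num P e)"
  by (simp add: p_array_def arr_def)

definition p_consistent :: prog where
  "p_consistent =
     pand (peq (p_array 0 (pnat 0)) (pnat 2))
    (pand (pall 3 (p_token (pnat 1)) (peq (p_array 0 (padd (Var 3) 1))
             (Seq (padd (p_array 0 (Var 3)) 2) (p_token (padd (p_array 0 (Var 3)) 1)))))
    (pand (peq (p_array 1 (pnat 0)) (padd (p_array 0 (p_token (pnat 1))) 1))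
    (pand (pall 3 (p_token (p_array 0 (p_token (pnat 1)))) (peq (p_array 1 (padd (Var 3) 1))
             (Seq (padd (p_array 1 (Var 3)) 1) (pmul (pnat 2) (p_token (p_array 1 (Var 3)))))))
    (pand (peq (p_array 2 (pnat 0)) (pnat 1))
          (pall 3 (Var 1) (por
            (pand (plt (pmul (p_token (pnat 0)) (p_array 2 (Var 3))) (padd (Var 1) 1))
                  (peq (p_array 2 (padd (Var 3) 1)) (pmul (p_token (pnat 0)) (p_array 2 (Var 3)))))
            (pand (pnot (plt (pmul (p_token (pnat 0)) (p_array 2 (Var 3))) (padd (Var 1) 1)))
                  (peq (p_array 2 (padd (Var 3) 1)) (padd (Var 1) 1)))))))))"

lemma holds_p_consistent[simp]:
  "holds p_consistent e \<longleftrightarrow> consistent (tok (e 1)) (length (e 1)) (arr (e 2))"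
  by (simp add: p_consistent_def consistent_def)

definition p_mem :: "prog \<Rightarrow> prog \<Rightarrow> prog \<Rightarrow> prog" where
  "p_mem l a b = (let v = Suc (max 2 (max (max_var l) (max (max_var a) (max_var b)))) in
     pex v (p_token (p_array 1 l)) (pand
       (peq (p_token (Seq (padd (p_array 1 l) 1) (pmul (pnat 2) (Var v)))) a)
       (peq (p_token (Seq (padd (p_array 1 l) 2) (pmul (pnat 2) (Var v)))) b)))"

lemma holds_p_mem[simp]:
  "holds (p_mem l a b) e \<longleftrightarrow> mem (tok (e 1)) (arr (e 2)) (num l e) (num a e) (num b e)"
  by (simp add: p_mem_def Let_def mem_def max_def)

definition p_trace :: "nat \<Rightarrow> nat \<Rightarrow> nat \<Rightarrow> prog" where
  "p_trace j s s' = pand (peq (p_array s' (pnat 0)) (pnat 0))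
     (pall (Suc (max 2 j)) (p_token (p_array 0 (Var j))) (let i = Var (Suc (max 2 j)) in
       pand (plt (p_array s i) (p_token (pnat 0)))
            (peq (p_array s' (padd i 1)) (Seq (pmul (p_array s' i) (p_token (pnat 0))) (p_array s i)))))"

lemma holds_p_trace[simp]:
  "holds (p_trace j s s') e \<longleftrightarrow> trace (tok (e 1)) (arr (e 2)) (length (e j)) s s'"
  by (simp add: p_trace_def Let_def trace_def max_def)

definition p_entry :: "nat \<Rightarrow> nat \<Rightarrow> prog" where
  "p_entry j s' = p_token (Seq (padd (p_array 0 (Var j)) 2) (p_array s' (p_token (p_array 0 (Var j)))))"

lemma num_p_entry[simp]:
  "num (p_entry j s') e = entry (tok (e 1)) (arr (e 2)) (length (e j)) s'"
  by (simp add: p_entry_def entry_def)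

abbreviation p_n :: prog where "p_n \<equiv> p_token (pnat 0)"

abbreviation p_kc :: prog where "p_kc \<equiv> p_token (p_array 0 (p_token (pnat 1)))"

definition p_bad_syntax :: prog where
  "p_bad_syntax =
     por (pex 3 (Var 1) (pand (peq (padd (Var 3) 1) (Var 1)) (Drop (Var 1) (Var 3))))
    (por (pnot (peq (pntok (Var 1)) (p_array 1 p_kc)))
    (por (peq p_n (pnat 0)) (peq p_kc (pnat 0))))"

lemma holds_p_bad_syntax[simp]:
  "holds p_bad_syntax e \<longleftrightarrow> bad_syntax (e 1) (arr (e 2))"
  by (auto simp: p_bad_syntax_def bad_syntax_def Let_def)

definition p_bad_table :: prog where
  "p_bad_table = pex 3 (p_token (pnat 1)) (por
     (pnot (peq (p_token (padd (p_array 0 (Var 3)) 1)) (p_array 2 (p_token (p_array 0 (Var 3))))))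
     (pand (p_trace 3 3 4) (pnot (plt (p_entry 3 4) p_n))))"

lemma holds_p_bad_table[simp]:
  "holds p_bad_table e \<longleftrightarrow> bad_table (tok (e 1)) (arr (e 2))"
  by (simp add: p_bad_table_def bad_table_def)

definition p_bad_equiv :: prog where
  "p_bad_equiv = pex 3 p_kc (por
     (pex 4 (p_token (p_array 1 (Var 3))) (pnot (pand
        (plt (p_token (Seq (padd (p_array 1 (Var 3)) 1) (pmul (pnat 2) (Var 4)))) p_n)
        (plt (p_token (Seq (padd (p_array 1 (Var 3)) 2) (pmul (pnat 2) (Var 4)))) p_n))))
     (pex 4 p_n (por (pnot (p_mem (Var 3) (Var 4) (Var 4)))
       (pex 5 p_n (pand (p_mem (Var 3) (Var 4) (Var 5)) (por (pnot (p_mem (Var 3) (Var 5) (Var 4)))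
         (pex 6 p_n (pand (p_mem (Var 3) (Var 5) (Var 6)) (pnot (p_mem (Var 3) (Var 4) (Var 6)))))))))))"

lemma holds_p_bad_equiv[simp]:
  "holds p_bad_equiv e \<longleftrightarrow> bad_equiv (tok (e 1)) (arr (e 2))"
  by (simp add: p_bad_equiv_def bad_equiv_def)

definition p_bad_compat :: prog where
  "p_bad_compat = pex 3 p_kc (pex 4 (p_token (pnat 1)) (pand (p_trace 4 3 4) (pand (p_trace 4 5 6)
     (pand (pall 5 (p_token (p_array 0 (Var 4))) (p_mem (Var 3) (p_array 3 (Var 5)) (p_array 5 (Var 5))))
           (pnot (p_mem (Var 3) (p_entry 4 4) (p_entry 4 6)))))))"

lemma holds_p_bad_compat[simp]:
  "holds p_bad_compat e \<longleftrightarrow> bad_compat (tok (e 1)) (arr (e 2))"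
  by (simp add: p_bad_compat_def bad_compat_def)

definition p_bad_CR :: prog where
  "p_bad_CR = (let nn = pmul p_n p_n;
       off = pmul (Seq (pmul (Var 3) p_kc) (Var 4)) (padd nn 1);
       cur = p_array 8 (Seq off (Var 5)); nxt = p_array 8 (padd (Seq off (Var 5)) 1) in
     pand (pall 3 p_kc (pand (plt (p_array 7 (Var 3)) p_n) (pall 4 p_kc
            (pand (peq (p_array 8 off) (p_array 7 (Var 3)))
            (pand (peq (p_array 8 (Seq off nn)) (p_array 7 (Var 4)))
                  (pall 5 nn (por (p_mem (Var 3) cur nxt) (p_mem (Var 4) cur nxt))))))))
          (pall 3 p_n (pex 4 p_kc (pnot (p_mem (Var 4) (Var 3) (p_array 7 (Var 4)))))))"

lemma holds_p_bad_CR[simp]: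
  "holds p_bad_CR e \<longleftrightarrow> bad_CR (tok (e 1)) (arr (e 2))"
  by (simp add: p_bad_CR_def bad_CR_def Let_def del: mult_Suc_right add_mult_distrib2)

definition p_refutes :: prog where
  "p_refutes = pand p_consistent (por p_bad_syntax (por p_bad_table (por p_bad_equiv
     (por p_bad_compat p_bad_CR))))"

lemma holds_p_refutes[simp]: "holds p_refutes e \<longleftrightarrow> refutes (e 1) (arr (e 2))"
  by (simp add: p_refutes_def refutes_def)

subsection \<open>Splitting a pair of strings\<close>

text \<open>
  As all bits before it are doubled, the separator is the first pair of unequal bits at an even position.
\<close>

definition sep :: "bool list \<Rightarrow> nat \<Rightarrow> bool" where
  "sep z j \<longleftrightarrow> 2 * j + 1 < length z \<and> \<not> z ! (2 * j) \<and> z ! (2 * j + 1)"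

lemma nth_doubled: "i < length x \<Longrightarrow>
  (concat (map (\<lambda>b. [b, b]) x) @ s) ! (2 * i) = x ! i \<and>
  (concat (map (\<lambda>b. [b, b]) x) @ s) ! (2 * i + 1) = x ! i"
proof (induction x arbitrary: i)
  case (Cons b x)
  then show ?case by (cases i) auto
qed simp

lemma length_doubled: "length (concat (map (\<lambda>b. [b, b]) x)) = 2 * length x"
  by (induction x) auto

lemma sep_pair:
  assumes "j \<le> length x"
  shows "sep (pair_string x y) j \<longleftrightarrow> j = length x"
proof (cases "j = length x")
  case True
  then show ?thesis by (simp add: sep_def pair_string_def nth_append length_doubled)
next
  case False
  then show ?thesis using nth_doubled[of j x "[False, True] @ y"] assms
    by (simp add: sep_def pair_string_def)
qed

lemma ex_sep_pair: "(\<exists>j<Suc i. sep (pair_string x y) j) \<longleftrightarrow> length x \<le> i"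
proof
  assume "\<exists>j<Suc i. sep (pair_string x y) j"
  then show "length x \<le> i" using sep_pair[of _ x y] by (metis leI less_SucE less_imp_le not_le_imp_less less_le_trans not_less_eq)
next
  assume "length x \<le> i"
  then show "\<exists>j<Suc i. sep (pair_string x y) j" using sep_pair[of "length x" x y]
    by (intro exI[of _ "length x"]) simp
qed

definition p_sep :: "prog \<Rightarrow> prog" where
  "p_sep j = pand (plt (padd (pmul (pnat 2) j) 1) (Var 0))
     (pand (pnot (Drop (Var 0) (pmul (pnat 2) j))) (Drop (Var 0) (padd (pmul (pnat 2) j) 1)))"

lemma holds_p_sep[simp]: "holds (p_sep j) e \<longleftrightarrow> sep (e 0) (num j e)"
  by (auto simp: p_sep_def sep_def)

definition p_fst :: prog where
  "p_fst = For 1 (Var 0) (If (pex 2 (psucc (Var 1)) (p_sep (Var 2))) Skip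
     (If (Drop (Var 0) (pmul (pnat 2) (Var 1))) (Emit True) (Emit False)))"

definition p_snd :: prog where
  "p_snd = For 1 (Var 0) (If (pex 2 (Var 1) (pand (p_sep (Var 2))
       (plt (padd (pmul (pnat 2) (Var 2)) 1) (Var 1))))
     (If (Drop (Var 0) (Var 1)) (Emit True) (Emit False)) Skip)"

lemma concat_if_upt:
  "concat (map (\<lambda>i. if i < a then [f i] else []) [0..<N]) = map f [0..<min a N]"
  "concat (map (\<lambda>i. if a \<le> i then [f i] else []) [0..<N]) = map f [a..<N]"
  by (induction N) (auto simp: min_def le_Suc_eq not_le less_Suc_eq)

lemma length_pair_string: "length (pair_string x y) = 2 * length x + 2 + length y"
  by (simp add: pair_string_def length_doubled)

lemma sem_p_fst: "sem p_fst (\<lambda>_. pair_string x y) = x"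
proof -
  let ?z = "pair_string x y"
  have "sem p_fst (\<lambda>_. ?z) =
      concat (map (\<lambda>i. if i < length x then [x ! i] else []) [0..<length ?z])"
    unfolding p_fst_def sem.simps(6)
  proof (intro arg_cong[where f = concat] map_cong)
    fix i assume "i \<in> set [0..<length ?z]"
    show "sem (If (pex 2 (psucc (Var 1)) (p_sep (Var 2))) Skip
     (If (Drop (Var 0) (pmul (pnat 2) (Var 1))) (Emit True) (Emit False)))
       (bind 1 (replicate i True) (\<lambda>_. ?z)) = (if i < length x then [x ! i] else [])"
      using ex_sep_pair[of i x y] nth_doubled[of i x "[False, True] @ y"] length_pair_string[of x y]
      by (auto simp: pair_string_def)
  qed simp
  also have "\<dots> = map ((!) x) [0..<length x]"
    unfolding concat_if_upt by (simp add: length_pair_string)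
  finally show ?thesis by (simp add: map_nth)
qed

lemma sem_p_snd: "sem p_snd (\<lambda>_. pair_string x y) = y"
proof -
  let ?z = "pair_string x y" and ?a = "2 * length x + 2"
  have "sem p_snd (\<lambda>_. ?z) =
      concat (map (\<lambda>i. if ?a \<le> i then [?z ! i] else []) [0..<length ?z])"
    unfolding p_snd_def sem.simps(6)
  proof (intro arg_cong[where f = concat] map_cong)
    fix i assume i: "i \<in> set [0..<length ?z]"
    have "(\<exists>j<i. sep ?z j \<and> 2 * j + 1 < i) \<longleftrightarrow> ?a \<le> i"
    proof
      assume "\<exists>j<i. sep ?z j \<and> 2 * j + 1 < i"
      then obtain j where j: "sep ?z j" "2 * j + 1 < i" by blast
      then have "length x \<le> j" using sep_pair[of j x y] by (cases "j \<le> length x") auto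
      with j show "?a \<le> i" by simp
    next
      assume "?a \<le> i"
      then show "\<exists>j<i. sep ?z j \<and> 2 * j + 1 < i"
        using sep_pair[of "length x" x y] by (intro exI[of _ "length x"]) auto
    qed
    then show "sem (If (pex 2 (Var 1) (pand (p_sep (Var 2))
       (plt (padd (pmul (pnat 2) (Var 2)) 1) (Var 1))))
     (If (Drop (Var 0) (Var 1)) (Emit True) (Emit False)) Skip)
       (bind 1 (replicate i True) (\<lambda>_. ?z)) = (if ?a \<le> i then [?z ! i] else [])"
      using i by auto
  qed simp
  also have "\<dots> = map ((!) ?z) [?a..<length ?z]"
    by (rule concat_if_upt(2))
  also have "\<dots> = drop ?a ?z"
    by (rule nth_equalityI) (simp_all add: add.commute)
  also have "\<dots> = y" by (simp add: pair_string_def length_doubled)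
  finally show ?thesis .
qed

definition verifier :: prog where
  "verifier = Let 1 p_fst (Let 2 p_snd (If p_refutes (Emit True) (Emit False)))"

lemma sem_p_snd_bind: "sem p_snd (bind (Suc 0) x e) = sem p_snd e"
proof -
  have "bind (Suc 0) u (bind (Suc 0) x e) = bind (Suc 0) u e" for u by (simp add: bind_def)
  then show ?thesis by (simp add: p_snd_def)
qed

lemma sem_verifier: "sem verifier (\<lambda>_. pair_string x y) = [refutes x (arr y)]"
  by (simp add: verifier_def sem_p_fst sem_p_snd_bind sem_p_snd)

theorem CRT_coNP: "CRT \<in> class_coNP"
proof -
  define V where "V = {z. holds verifier (\<lambda>_. z)}"
  have "sem verifier (\<lambda>_. z) = [z \<in> V]" for z
    by (simp add: V_def verifier_def)
  then have "V \<in> class_P" using polytime_sem[of verifier] by (simp add: class_P_def)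
  moreover have "\<exists>p. \<forall>N. poly p N = 9 * Lbound N * (Vbound N + 1)"
  proof -
    let ?X = "[:0, 1:] :: nat poly"
    have "poly (9 * (?X * ?X * (?X * ?X + 1) + ?X + 2) *
        (2 + ?X * (?X + 2) + 1 + ?X * (2 * ?X + 1) + ?X + 1)) N = 9 * Lbound N * (Vbound N + 1)" for N
      unfolding Lbound_def Vbound_def by (simp only: poly_mult poly_add poly_pCons poly_numeral poly_1 poly_0) simp
    then show ?thesis by blast
  qed
  then obtain p where p: "\<And>N. poly p N = 9 * Lbound N * (Vbound N + 1)" by blast
  have "pair_string x y \<in> V \<longleftrightarrow> refutes x (arr y)" for x y
    by (simp add: V_def holds_def sem_verifier)
  then have "\<forall>x. x \<in> - CRT \<longleftrightarrow> (\<exists>y. length y \<le> poly p (length x) \<and> pair_string x y \<in> V)"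
    using not_CRT_iff by (simp add: p)
  ultimately show ?thesis unfolding class_coNP_def class_NP_def by blast
qed

section \<open>From constraint satisfaction to Chinese Remainder tuples\<close>

lemma mixed_radix_less: "a < A \<Longrightarrow> b < B \<Longrightarrow> a * B + b < A * (B::nat)"
proof -
  assume "a < A" "b < B"
  then have "a * B + b < Suc a * B" by simp
  also have "\<dots> \<le> A * B" using \<open>a < A\<close> by (intro mult_right_mono) auto
  finally show ?thesis .
qed

text \<open>
  A constraint problem with variables \<open>0, \<dots>, k - 1\<close> and values below \<open>d\<close>. Each variable has its legal
  values, and for different \<open>i\<close>, \<open>j\<close> the value \<open>u\<close> of \<open>i\<close> and the value \<open>v\<close> of \<open>j\<close> must agree in their labels
  \<open>lab i j u = lab j i v\<close>. The assumption \<open>copies\<close> says that, given \<open>i\<close> and \<open>j\<close>, every variable \<open>m\<close> has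
  a partner different from \<open>i\<close> and \<open>j\<close> such that their labels determine the value of \<open>m\<close>; it is met by having
  several copies of each variable.

  The corresponding instance has no operations. Its elements are the quadruples \<open>(i, j, u, v)\<close>, read
  off a number in mixed radix. A quadruple is genuine if it is a partial solution with two variables;
  then it has the value \<open>u\<close> at \<open>i\<close>, the value \<open>v\<close> at \<open>j\<close>, and no value at other variables. The remaining
  quadruples have no values at all. Two different elements are in the congruence \<open>theta l\<close> iff they have
  the same value at \<open>l\<close>. So a choice of classes of the congruences, pairwise related by the joins, is
  either a solution or consists of the classes of one element.
\<close>

locale csp =
  fixes k d :: nat and legal :: "nat \<Rightarrow> nat \<Rightarrow> bool" and lab :: "nat \<Rightarrow> nat \<Rightarrow> nat \<Rightarrow> 'l"
  assumes k: "k \<ge> 5"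
    and copies: "\<And>m i j. m < k \<Longrightarrow> \<exists>m'<k. m' \<noteq> m \<and> m' \<noteq> i \<and> m' \<noteq> j \<and>
      (\<forall>u w. lab m m' u = lab m m' w \<longrightarrow> u = w)"
begin

definition num_elems where "num_elems = k * k * d * d"

definition ei where "ei e = e div (d * d) div k"
definition ej where "ej e = e div (d * d) mod k"
definition eu where "eu e = e div d mod d"
definition ev where "ev e = e mod d"

definition genuine :: "nat \<Rightarrow> bool" where
  "genuine e \<longleftrightarrow> ei e \<noteq> ej e \<and> legal (ei e) (eu e) \<and> legal (ej e) (ev e) \<and>
     lab (ei e) (ej e) (eu e) = lab (ej e) (ei e) (ev e)"

definition val :: "nat \<Rightarrow> nat \<Rightarrow> nat \<Rightarrow> bool" where
  "val e l w \<longleftrightarrow> genuine e \<and> (l = ei e \<and> w = eu e \<or> l = ej e \<and> w = ev e)"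

definition theta :: "nat \<Rightarrow> nat rel" where
  "theta l = {(e, e'). e < num_elems \<and> e' < num_elems \<and> (e = e' \<or> (\<exists>w. val e l w \<and> val e' l w))}"

definition solution :: "(nat \<Rightarrow> nat) \<Rightarrow> bool" where
  "solution s \<longleftrightarrow> (\<forall>i<k. s i < d \<and> legal i (s i)) \<and>
     (\<forall>i<k. \<forall>j<k. i \<noteq> j \<longrightarrow> lab i j (s i) = lab j i (s j))"

lemma val_unique: "val e l w \<Longrightarrow> val e l w' \<Longrightarrow> w = w'"
  by (auto simp: val_def genuine_def)

lemma val_less: "e < num_elems \<Longrightarrow> val e l w \<Longrightarrow> w < d"
proof -
  assume "e < num_elems" "val e l w"
  then have "0 < d" unfolding num_elems_def by (intro gr0I) simp
  then show "w < d" using \<open>val e l w\<close> by (auto simp: val_def eu_def ev_def)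
qed

lemma val_legal: "val e l w \<Longrightarrow> legal l w"
  by (auto simp: val_def genuine_def)

lemma val_agree: "val e i u \<Longrightarrow> val e j v \<Longrightarrow> i \<noteq> j \<Longrightarrow> lab i j u = lab j i v"
  by (auto simp: val_def genuine_def)

lemma ex_element:
  assumes "i < k" "j < k" "u < d" "v < d"
  shows "\<exists>e<num_elems. ei e = i \<and> ej e = j \<and> eu e = u \<and> ev e = v"
proof (intro exI conjI)
  let ?e = "((i * k + j) * d + u) * d + v"
  have "(i * k + j) * d + u < k * k * d"
    using assms by (intro mixed_radix_less)
  then show "?e < num_elems" unfolding num_elems_def using assms by (intro mixed_radix_less)
  have 1: "?e div d = (i * k + j) * d + u" using assms by simp
  have "?e div (d * d) = i * k + j"
    unfolding div_mult2_eq 1 using assms by simp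
  then show "ei ?e = i" "ej ?e = j" using assms by (simp_all add: ei_def ej_def)
  show "eu ?e = u" "ev ?e = v" unfolding eu_def ev_def 1 using assms by simp_all
qed

lemma equiv_theta: "equiv {..<num_elems} (theta l)"
proof (rule equivI)
  show "theta l \<subseteq> {..<num_elems} \<times> {..<num_elems}" by (auto simp: theta_def)
  show "refl_on {..<num_elems} (theta l)" by (auto simp: theta_def refl_on_def)
  show "sym (theta l)" by (auto simp: theta_def sym_def)
  show "trans (theta l)"
  proof (rule transI)
    fix x y z assume "(x, y) \<in> theta l" "(y, z) \<in> theta l"
    then show "(x, z) \<in> theta l"
      using val_unique[of y l] unfolding theta_def by blast
  qed
qed

text \<open>
  An invariant of the join of \<open>theta i\<close> and \<open>theta j\<close>: the label of the value at \<open>i\<close> or at \<open>j\<close>, which is the same for a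
  genuine element that has both, and the element itself if it has neither.
\<close>

definition join_label :: "nat \<Rightarrow> nat \<Rightarrow> nat \<Rightarrow> 'l + nat" where
  "join_label i j e = (if \<exists>u. val e i u then Inl (lab i j (THE u. val e i u))
     else if \<exists>v. val e j v then Inl (lab j i (THE v. val e j v)) else Inr e)"

lemma the_val: "val e l w \<Longrightarrow> (THE u. val e l u) = w"
  using val_unique by blast

lemma join_label1: "val e i u \<Longrightarrow> join_label i j e = Inl (lab i j u)"
  unfolding join_label_def using the_val by auto

lemma join_label2: "i \<noteq> j \<Longrightarrow> val e j v \<Longrightarrow> join_label i j e = Inl (lab j i v)"
  unfolding join_label_def using the_val val_agree by (metis (no_types))

lemma join_label3: "\<nexists>u. val e i u \<Longrightarrow> \<nexists>v. val e j v \<Longrightarrow> join_label i j e = Inr e"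
  by (simp add: join_label_def)

lemma join_label_eq_Inr: "join_label i j e = Inr x \<Longrightarrow> e = x"
  by (simp add: join_label_def split: if_splits)

lemma join_label_join:
  assumes "i \<noteq> j" "(x, y) \<in> cong_join (theta i) (theta j)"
  shows "join_label i j x = join_label i j y"
  using assms(2) unfolding cong_join_def
proof (induction rule: trancl_induct)
  case (base y)
  then show ?case using join_label1 join_label2[OF assms(1)] by (auto simp: theta_def)
next
  case (step y z)
  then have "join_label i j y = join_label i j z" using join_label1 join_label2[OF assms(1)] by (auto simp: theta_def)
  with step show ?case by simp
qed

lemma congruence_theta: "congruence (table_algebra num_elems []) (theta l)"
  using equiv_theta by (simp add: congruence_def table_algebra_def)

text \<open>
  The values of a solution are carried by genuine elements, and for each pair of variables by a common
  one. An element has at most two values and therefore cannot carry all of them.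
\<close>

lemma solution_imp_not_CR:
  assumes s: "solution s"
  shows "\<not> CR_tuple (table_algebra num_elems []) (map theta [0..<k])"
proof
  assume CR: "CR_tuple (table_algebra num_elems []) (map theta [0..<k])"
  have el: "\<exists>e<num_elems. val e i (s i) \<and> val e j (s j)" if ij: "i < k" "j < k" "i \<noteq> j" for i j
  proof -
    have sd: "s i < d" "s j < d" "legal i (s i)" "legal j (s j)" "lab i j (s i) = lab j i (s j)"
      using s ij by (auto simp: solution_def)
    obtain e where "e < num_elems" "ei e = i" "ej e = j" "eu e = s i" "ev e = s j"
      using ex_element[OF ij(1,2) sd(1,2)] by blast
    then show ?thesis using sd ij by (intro exI[of _ e]) (auto simp: val_def genuine_def)
  qed
  have "\<exists>e<num_elems. val e i (s i)" if "i < k" for i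
  proof -
    have "(if i = 0 then 1 else 0) < k" "i \<noteq> (if i = 0 then 1 else 0)" using k by auto
    then show ?thesis using el[OF that] by blast
  qed
  then obtain a where a: "\<And>i. i < k \<Longrightarrow> a i < num_elems \<and> val (a i) i (s i)" by metis
  let ?as = "map a [0..<k]"
  have join: "(a i, a j) \<in> cong_join (theta i) (theta j)" if "i < k" "j < k" for i j
  proof (cases "i = j")
    case True
    then show ?thesis using a[of i] that unfolding cong_join_def
      by (intro r_into_trancl) (auto simp: theta_def)
  next
    case False
    then obtain e where e: "e < num_elems" "val e i (s i)" "val e j (s j)" using el \<open>i < k\<close> \<open>j < k\<close> by blast
    have "(a i, e) \<in> theta i" "(e, a j) \<in> theta j"
      using e a[OF \<open>i < k\<close>] a[OF \<open>j < k\<close>] by (auto simp: theta_def)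
    then show ?thesis unfolding cong_join_def
      by (meson UnI1 UnI2 r_into_trancl trancl_trans)
  qed
  have "?as \<in> tuples {..<num_elems} k" using a by (auto simp: tuples_def)
  with CR join obtain b where b: "b < num_elems" "\<forall>i<k. (b, a i) \<in> theta i"
    unfolding CR_tuple_def by (force simp: table_algebra_def)
  have "\<exists>w. val b i w" if "i < k" for i
    using b(2) a[OF that] that by (auto simp: theta_def)
  then have "i \<in> {ei b, ej b}" if "i < k" for i using that by (auto simp: val_def)
  then have "{..<k} \<subseteq> {ei b, ej b}" by auto
  then have "k \<le> card {ei b, ej b}" using card_mono[of "{ei b, ej b}" "{..<k}"] by simp
  then show False using k by (simp add: card_insert_if split: if_splits)
qed

text \<open>
  Let elements \<open>a 0, \<dots>, a (k - 1)\<close> be pairwise related by the joins. Some \<open>a l\<close> has no value at \<open>l\<close>, since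
  otherwise the values of the \<open>a l\<close> at \<open>l\<close> would form a solution. Then \<open>a l\<close> is the common element: it equals every \<open>a m\<close> for which it has no value at \<open>m\<close>, and at the other \<open>m\<close> its value is
  fixed by a copy of \<open>m\<close>.
\<close>

lemma not_solution_imp_CR:
  assumes no: "\<nexists>s. solution s"
  shows "CR_tuple (table_algebra num_elems []) (map theta [0..<k])"
proof -
  have "\<exists>b<num_elems. \<forall>i<k. (b, a i) \<in> theta i"
    if a: "\<And>i. i < k \<Longrightarrow> a i < num_elems"
      and join: "\<And>i j. i < k \<Longrightarrow> j < k \<Longrightarrow> (a i, a j) \<in> cong_join (theta i) (theta j)"
    for a
  proof -
    have inv: "join_label i j (a i) = join_label i j (a j)" if "i < k" "j < k" "i \<noteq> j" for i j
      using join_label_join[OF that(3) join[OF that(1,2)]] .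
    \<comment> \<open>otherwise the values of the \<open>a l\<close> form a solution\<close>
    have "\<exists>l<k. \<nexists>w. val (a l) l w"
    proof (rule ccontr)
      assume "\<not> ?thesis"
      then obtain s where s: "\<And>l. l < k \<Longrightarrow> val (a l) l (s l)" by metis
      have "lab i j (s i) = lab j i (s j)" if "i < k" "j < k" "i \<noteq> j" for i j
        using inv[OF that] join_label1[OF s[OF that(1)]] join_label2[OF that(3) s[OF that(2)]] by simp
      then have "solution s"
        using s a val_less val_legal unfolding solution_def by blast
      with no show False by blast
    qed
    then obtain l where l: "l < k" "\<nexists>w. val (a l) l w" by blast
    have same: "a m = a l" if "l < k" "\<nexists>w. val (a l) l w" "m < k" "\<nexists>w. val (a l) m w" for l m
    proof (cases "m = l")
      case False
      then have "join_label l m (a m) = Inr (a l)"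
        using inv[OF that(1,3)] join_label3[OF that(2,4)] by simp
      then show ?thesis by (rule join_label_eq_Inr)
    qed simp
    let ?e = "a l"
    have "(?e, a m) \<in> theta m" if m: "m < k" for m
    proof (cases "\<exists>w. val ?e m w")
      case False
      then show ?thesis using same[OF l m] a[OF l(1)] by (auto simp: theta_def)
    next
      case True
      then obtain w where w: "val ?e m w" by blast
      obtain m' where m': "m' < k" "m' \<noteq> m" "m' \<noteq> ei ?e" "m' \<noteq> ej ?e"
        and inj: "\<And>u w. lab m m' u = lab m m' w \<Longrightarrow> u = w"
        using copies[OF m] by metis
      have "\<nexists>w. val ?e m' w" using m' by (auto simp: val_def)
      then have am': "a m' = ?e" using same[OF l m'(1)] by blast
      have eq: "join_label m' m (a m) = Inl (lab m m' w)"
        using inv[OF m'(1) m m'(2)] join_label2[OF m'(2) w] am' by simp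
      show ?thesis
      proof (cases "\<exists>w'. val (a m) m w'")
        case True
        then obtain w' where w': "val (a m) m w'" by blast
        then have "lab m m' w' = lab m m' w" using join_label2[OF m'(2) w'] eq by simp
        then have "w' = w" by (rule inj)
        then show ?thesis using w w' a[OF l(1)] a[OF m] by (auto simp: theta_def)
      next
        case False
        \<comment> \<open>at some \<open>x\<close> neither element has a value, which makes both equal to \<open>a x\<close>\<close>
        have "\<not> {..<k} \<subseteq> {ei ?e, ej ?e, ei (a m), ej (a m)}"
        proof
          assume "{..<k} \<subseteq> {ei ?e, ej ?e, ei (a m), ej (a m)}"
          from card_mono[OF _ this] have "k \<le> card {ei ?e, ej ?e, ei (a m), ej (a m)}" by simp
          also have "\<dots> \<le> 4" by (simp add: card_insert_if)
          finally show False using k by simp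
        qed
        then obtain x where x: "x < k" "x \<notin> {ei ?e, ej ?e, ei (a m), ej (a m)}" by auto
        have "a x = ?e" using same[OF l x(1)] x(2) by (auto simp: val_def)
        moreover have "a x = a m" using same[OF m False x(1)] x(2) by (auto simp: val_def)
        ultimately have "?e = a m" by simp
        with w False show ?thesis by auto
      qed
    qed
    then show ?thesis using a[OF l(1)] by blast
  qed
  note main = this
  have "\<exists>b\<in>{..<num_elems}. \<forall>i<k. (b, as ! i) \<in> theta i"
    if as: "as \<in> tuples {..<num_elems} k"
      and join: "\<forall>i<k. \<forall>j<k. (as ! i, as ! j) \<in> cong_join (theta i) (theta j)" for as
  proof -
    have "as ! i < num_elems" if "i < k" for i
    proof -
      have "as ! i \<in> set as" using as that by (simp add: tuples_def)
      then show ?thesis using as by (auto simp: tuples_def)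
    qed
    then obtain b where "b < num_elems" "\<forall>i<k. (b, as ! i) \<in> theta i"
      using main[of "\<lambda>i. as ! i"] join by blast
    then show ?thesis by blast
  qed
  then show ?thesis
    using congruence_theta by (auto simp: CR_tuple_def table_algebra_def)
qed

theorem CR_iff_not_solution:
  "CR_tuple (table_algebra num_elems []) (map theta [0..<k]) \<longleftrightarrow> (\<nexists>s. solution s)"
  using solution_imp_not_CR not_solution_imp_CR by blast

end

section \<open>Head-relative tableaux of computations\<close>

text \<open>
  A computation is described relative to the heads: \<open>around tps p\<close> lists the symbols at distance \<open>p\<close> from the
  heads of the tapes, so that \<open>around tps 0\<close> is what the machine reads. The entry of a tableau at distance
  \<open>p\<close> consists of the class of \<open>p\<close>, the state, the symbols that are read, and the symbols at the distances
  \<open>p - 1\<close>, \<open>p\<close> and \<open>p + 1\<close>. This determines the symbols at distance \<open>p\<close> after one step.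
\<close>

type_synonym cellval = "nat \<times> nat \<times> nat list \<times> nat list \<times> nat list \<times> nat list"

definition around :: "tape list \<Rightarrow> int \<Rightarrow> nat list" where
  "around tps p = map (\<lambda>(c, h). c (h + p)) tps"

text \<open>
  A head that moves by one cell leaves the written symbol at distance \<open>-1\<close>, \<open>0\<close> or \<open>1\<close>; the other distances
  need not be told apart.
\<close>

definition offset_class :: "int \<Rightarrow> nat" where
  "offset_class p = (if p = -1 then 1 else if p = 0 then 2 else if p = 1 then 3 else 0)"

definition next_state :: "tm \<Rightarrow> nat \<Rightarrow> nat list \<Rightarrow> nat" where
  "next_state M q g = (if q < state_count M then fst (transition M q g) else q)"

text \<open>
  The symbols after one step at a distance of class \<open>k\<close>, where \<open>a\<close>, \<open>b\<close>, \<open>c\<close> are the symbols before it at the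
  preceding, the same and the following distance. The distance is taken from the new head position.
\<close>

definition next_cell :: "tm \<Rightarrow> nat \<Rightarrow> nat \<Rightarrow> nat list \<Rightarrow> nat list \<Rightarrow> nat list \<Rightarrow> nat list \<Rightarrow> nat list" where
  "next_cell M k q g a b c = (if q < state_count M then
     map (\<lambda>i. case snd (transition M q g) ! i of
         (s, Move_Left) \<Rightarrow> if k = 3 then s else a ! i
       | (s, Stay) \<Rightarrow> if k = 2 then s else b ! i
       | (s, Move_Right) \<Rightarrow> if k = 1 then s else c ! i) [0..<tape_count M]
     else b)"

definition syms :: "tm \<Rightarrow> nat list set" where
  "syms M = tuples {..<symbol_count M} (tape_count M)"

text \<open>
  Configurations whose symbols belong to the alphabet; this includes the right number of tapes.
\<close>

definition wf_config :: "tm \<Rightarrow> config \<Rightarrow> bool" where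
  "wf_config M = (\<lambda>(q, tps). q \<le> state_count M \<and> (\<forall>p. around tps p \<in> syms M))"

lemma syms_nth: "g \<in> syms M \<Longrightarrow> i < tape_count M \<Longrightarrow> g ! i < symbol_count M"
  using nth_mem[of i g] by (auto simp: syms_def tuples_def simp del: nth_mem)

lemma syms_intro: "length g = tape_count M \<Longrightarrow> (\<And>i. i < tape_count M \<Longrightarrow> g ! i < symbol_count M) \<Longrightarrow> g \<in> syms M"
  by (auto simp: syms_def tuples_def in_set_conv_nth)

lemma wf_length: "wf_config M (q, tps) \<Longrightarrow> length tps = tape_count M"
  by (auto simp: wf_config_def syms_def tuples_def around_def)

text \<open>One step in head-relative terms; it moves every head by at most one cell.\<close>

lemma around_step:
  assumes M: "is_tm M" and wf: "wf_config M (q, tps)" and st: "tm_step M (q, tps) = (q', tps')"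
  shows "q' = next_state M q (around tps 0)"
    "around tps' p = next_cell M (offset_class p) q (around tps 0) (around tps (p - 1)) (around tps p) (around tps (p + 1))"
    "wf_config M (q', tps')"
    "i < tape_count M \<Longrightarrow> \<bar>snd (tps' ! i)\<bar> \<le> \<bar>snd (tps ! i)\<bar> + 1"
proof -
  have len: "length tps = tape_count M" using wf by (rule wf_length)
  have g: "around tps 0 \<in> syms M" and q: "q \<le> state_count M" using wf by (auto simp: wf_config_def)
  have g': "around tps 0 = map (\<lambda>(t, h). t h) tps" by (simp add: around_def)
  obtain qn acts where tr: "transition M q (around tps 0) = (qn, acts)" by fastforce
  have ok: "qn \<le> state_count M" "length acts = tape_count M" "\<forall>(s, d)\<in>set acts. s < symbol_count M"
    if "q < state_count M"
    using M that g tr unfolding is_tm_def syms_def by fastforce+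
  show q': "q' = next_state M q (around tps 0)"
    using st tr by (auto simp: tm_step_def next_state_def g' split: if_splits)
  have tps': "tps' = (if q < state_count M then map2 act_on_tape acts tps else tps)"
    using st tr by (auto simp: tm_step_def g' split: if_splits)
  show around': "around tps' p = next_cell M (offset_class p) q (around tps 0) (around tps (p - 1)) (around tps p) (around tps (p + 1))" for p
  proof (cases "q < state_count M")
    case True
    show ?thesis
    proof (rule nth_equalityI)
      fix i assume "i < length (around tps' p)"
      then have i: "i < tape_count M" using True ok(2) len by (simp add: tps' around_def)
      obtain s d where a: "acts ! i = (s, d)" by fastforce
      obtain c h where th: "tps ! i = (c, h)" by fastforce
      have "around tps' p ! i = (c(h := s)) (h + displacement d + p)"
        using True i ok(2) len a th by (simp add: tps' around_def act_on_tape_def)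
      moreover have r: "around tps x ! i = c (h + x)" for x using i len th by (simp add: around_def)
      ultimately show "around tps' p ! i =
          next_cell M (offset_class p) q (around tps 0) (around tps (p - 1)) (around tps p) (around tps (p + 1)) ! i"
        using True i a tr
        by (cases d) (auto simp: next_cell_def r offset_class_def algebra_simps)
    qed (use True ok(2) len in \<open>simp add: tps' around_def next_cell_def\<close>)
  next
    case False
    then show ?thesis by (simp add: tps' next_cell_def)
  qed
  have "around tps' p \<in> syms M" for p
  proof (cases "q < state_count M")
    case True
    have r: "around tps x \<in> syms M" for x using wf by (auto simp: wf_config_def)
    show ?thesis
    proof (rule syms_intro)
      show "length (around tps' p) = tape_count M" using True by (simp add: around' next_cell_def)
      fix i assume i: "i < tape_count M"
      obtain s d where a: "acts ! i = (s, d)" by fastforce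
      have "(s, d) \<in> set acts" using a i ok(2)[OF True] by (metis nth_mem)
      then have "s < symbol_count M" using ok(3)[OF True] by blast
      then show "around tps' p ! i < symbol_count M"
        using True i a tr syms_nth[OF r i] by (cases d) (auto simp: around' next_cell_def)
    qed
  next
    case False
    then show ?thesis using wf by (simp add: tps' wf_config_def)
  qed
  moreover have "q' \<le> state_count M" using q ok(1) tr by (auto simp: q' next_state_def)
  ultimately show "wf_config M (q', tps')" by (simp add: wf_config_def)
  show "\<bar>snd (tps' ! i)\<bar> \<le> \<bar>snd (tps ! i)\<bar> + 1" if i: "i < tape_count M"
  proof (cases "q < state_count M")
    case True
    obtain s d where a: "acts ! i = (s, d)" by fastforce
    obtain c h where th: "tps ! i = (c, h)" by fastforce
    show ?thesis using True i ok(2) len a th by (cases d) (auto simp: tps' act_on_tape_def)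
  next
    case False
    then show ?thesis by (simp add: tps')
  qed
qed

lemma wf_initial:
  assumes "is_tm M"
  shows "wf_config M (initial M z)"
proof -
  have "1 \<le> tape_count M" "3 \<le> symbol_count M" using assms by (auto simp: is_tm_def)
  then show ?thesis
    by (auto simp: wf_config_def initial_def around_def syms_def tuples_def content_def)
qed

lemma computes_in_mono:
  assumes "computes_in M t x y" "t \<le> t'"
  shows "computes_in M t' x y"
proof -
  obtain q tps where c: "(tm_step M ^^ t) (initial M x) = (q, tps)" by fastforce
  then have q: "q = state_count M" using assms(1) by (simp add: computes_in_def)
  have "(tm_step M ^^ n) (q, tps) = (q, tps)" for n
    by (induction n) (auto simp: tm_step_def q)
  moreover have "(tm_step M ^^ t') (initial M x) = (tm_step M ^^ (t' - t)) ((tm_step M ^^ t) (initial M x))"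
    using assms(2) by (metis comp_apply funpow_add le_add_diff_inverse2)
  ultimately show ?thesis using assms(1) c by (simp add: computes_in_def)
qed

text \<open>
  The possible entries of a tableau.
\<close>

definition vals :: "tm \<Rightarrow> cellval set" where
  "vals M = {(k, q, g, a, b, c). k < 4 \<and> q \<le> state_count M \<and> g \<in> syms M \<and> a \<in> syms M \<and>
     b \<in> syms M \<and> c \<in> syms M \<and> (k = 2 \<longrightarrow> g = b)}"

lemma finite_vals: "finite (vals M)"
proof -
  have "finite (syms M)"
    unfolding syms_def tuples_def using finite_lists_length_eq[of "{..<symbol_count M}"] by simp
  moreover have "vals M \<subseteq> {..<4} \<times> {..state_count M} \<times> syms M \<times> syms M \<times> syms M \<times> syms M"
    by (auto simp: vals_def)
  ultimately show ?thesis by (meson finite_SigmaI finite_lessThan finite_atMost finite_subset)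
qed

text \<open>
  Consistency of neighbouring entries in a row (\<open>link1\<close>) and in a column (\<open>link2\<close>).
\<close>

definition link1 :: "cellval \<Rightarrow> cellval \<Rightarrow> bool" where
  "link1 = (\<lambda>(k, q, g, a, b, c) (k', q', g', a', b', c'). (q, g, b, c) = (q', g', a', b'))"

definition link2 :: "tm \<Rightarrow> cellval \<Rightarrow> cellval \<Rightarrow> bool" where
  "link2 M = (\<lambda>(k, q, g, a, b, c) (k', q', g', a', b', c').
     (next_state M q g, next_cell M k q g a b c) = (q', b'))"

text \<open>
  Conditions on the first row, where the first tape has the symbol \<open>s\<close> and the others are blank. Guessed
  symbols are bits or blanks, and after a blank comes another blank.
\<close>

definition start_ok :: "tm \<Rightarrow> nat \<Rightarrow> cellval \<Rightarrow> bool" where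
  "start_ok M s = (\<lambda>(k, q, g, a, b, c). q = 0 \<and> b = s # replicate (tape_count M - 1) 0)"

definition guess_ok :: "tm \<Rightarrow> cellval \<Rightarrow> bool" where
  "guess_ok M v \<longleftrightarrow> start_ok M 1 v \<or> start_ok M 2 v \<or>
     start_ok M 0 v \<and> (case v of (k, q, g, a, b, c) \<Rightarrow> hd c = 0)"

text \<open>
  A machine that decides a language ends with \<open>[True]\<close> or \<open>[False]\<close> on the last tape. The second case is the
  one in which the symbol \<open>1\<close> occurs.
\<close>

definition final_ok :: "cellval \<Rightarrow> bool" where
  "final_ok = (\<lambda>(k, q, g, a, b, c). last b \<noteq> 1)"

text \<open>
  The condition on a single entry in row \<open>t\<close> and column \<open>p\<close> of a tableau with last row \<open>T\<close>. Column \<open>2 * T\<close> is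
  below the head. The input consists of the fixed string \<open>w\<close> and at most \<open>Y\<close> guessed bits.
\<close>

definition legal_val :: "tm \<Rightarrow> bool list \<Rightarrow> nat \<Rightarrow> nat \<Rightarrow> nat \<Rightarrow> nat \<Rightarrow> cellval \<Rightarrow> bool" where
  "legal_val M w Y T t p v \<longleftrightarrow> fst v = offset_class (int p - int (2 * T)) \<and>
     (t = 0 \<longrightarrow> (if p < 2 * T then start_ok M 0 v
        else if p < 2 * T + length w then start_ok M (if w ! (p - 2 * T) then 2 else 1) v
        else if p < 2 * T + length w + Y then guess_ok M v else start_ok M 0 v)) \<and>
     (t = T \<longrightarrow> final_ok v)"

text \<open>
  The borders carry no condition. Wrong symbols can enter from there, but they come closer by only one
  cell per step and do not reach the columns within distance \<open>T\<close> of the head, where the output is.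
\<close>

definition tableau :: "tm \<Rightarrow> bool list \<Rightarrow> nat \<Rightarrow> nat \<Rightarrow> (nat \<Rightarrow> nat \<Rightarrow> cellval) \<Rightarrow> bool" where
  "tableau M w Y T s \<longleftrightarrow> (\<forall>t\<le>T. \<forall>p<4 * T + 1. s t p \<in> vals M \<and> legal_val M w Y T t p (s t p) \<and>
     (p + 1 < 4 * T + 1 \<longrightarrow> link1 (s t p) (s t (p + 1))) \<and>
     (t < T \<longrightarrow> link2 M (s t p) (s (t + 1) p)))"

lemma around_initial:
  "around (snd (initial M z)) p = content z p # replicate (tape_count M - 1) 0"
  by (simp add: initial_def around_def content_def)

lemma tableau_of_run:
  assumes M: "is_tm M" and T: "length w + Y \<le> T" and y: "length y \<le> Y"
    and acc: "computes_in M T (w @ y) [True]"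
  shows "\<exists>s. tableau M w Y T s"
proof -
  define C where "C = (\<lambda>t. (tm_step M ^^ t) (initial M (w @ y)))"
  define r where "r = (\<lambda>t. around (snd (C t)))"
  define s where "s = (\<lambda>t p. let i = int p - int (2 * T) in
    (offset_class i, fst (C t), r t 0, r t (i - 1), r t i, r t (i + 1)))"
  have wf: "wf_config M (C t)" for t
  proof (induction t)
    case 0
    then show ?case using wf_initial[OF M] by (simp add: C_def)
  next
    case (Suc t)
    have "C (Suc t) = tm_step M (C t)" by (simp add: C_def)
    then show ?case using around_step(3)[OF M] Suc by (metis prod.exhaust_sel)
  qed
  have step: "fst (C (t + 1)) = next_state M (fst (C t)) (r t 0)"
    "r (t + 1) p = next_cell M (offset_class p) (fst (C t)) (r t 0) (r t (p - 1)) (r t p) (r t (p + 1))" for t p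
  proof -
    have "tm_step M (fst (C t), snd (C t)) = (fst (C (t + 1)), snd (C (t + 1)))" by (simp add: C_def)
    from around_step(1,2)[OF M _ this] wf[of t]
    show "fst (C (t + 1)) = next_state M (fst (C t)) (r t 0)"
      "r (t + 1) p = next_cell M (offset_class p) (fst (C t)) (r t 0) (r t (p - 1)) (r t p) (r t (p + 1))"
      unfolding r_def by simp_all
  qed
  have "s t p \<in> vals M" for t p
    using wf[of t] by (auto simp: s_def vals_def Let_def wf_config_def r_def offset_class_def)
  moreover have "link1 (s t p) (s t (p + 1))" for t p
    by (simp add: s_def link1_def Let_def algebra_simps)
  moreover have "link2 M (s t p) (s (t + 1) p)" for t p
    using step[of t] by (simp add: s_def link2_def Let_def)
  moreover have "legal_val M w Y T t p (s t p)" if p: "p < 4 * T + 1" for t p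
  proof -
    have r0: "r 0 i = content (w @ y) i # replicate (tape_count M - 1) 0" for i
      by (simp add: r_def C_def around_initial)
    have c0: "fst (C 0) = 0" by (simp add: C_def initial_def)
    have st: "start_ok M x (s 0 p)" if "content (w @ y) (int p - int (2 * T)) = x" for x
      using that c0 by (simp add: start_ok_def s_def Let_def r0)
    have gs: "guess_ok M (s 0 p)" if "2 * T + length w \<le> p"
    proof -
      let ?i = "int p - int (2 * T)"
      have "content (w @ y) ?i \<in> {0, 1, 2}" by (auto simp: content_def)
      moreover have "content (w @ y) (?i + 1) = 0" if "content (w @ y) ?i = 0"
        using that \<open>2 * T + length w \<le> p\<close> by (auto simp: content_def split: if_splits)
      ultimately show ?thesis
        using st[of 0] st[of 1] st[of 2]
        by (auto simp: guess_ok_def s_def Let_def r0)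
    qed
    have first: "if p < 2 * T then start_ok M 0 (s 0 p)
        else if p < 2 * T + length w then start_ok M (if w ! (p - 2 * T) then 2 else 1) (s 0 p)
        else if p < 2 * T + length w + Y then guess_ok M (s 0 p) else start_ok M 0 (s 0 p)"
    proof -
      have n: "nat (int p - int (2 * T)) = p - 2 * T" by simp
      consider "p < 2 * T" | "2 * T \<le> p" "p < 2 * T + length w" | "2 * T + length w \<le> p" "p < 2 * T + length w + Y"
        | "2 * T + length w + Y \<le> p" by linarith
      then show ?thesis
      proof cases
        case 1
        then show ?thesis using st[of 0] by (simp add: content_def)
      next
        case 2
        then have "content (w @ y) (int p - int (2 * T)) = (if w ! (p - 2 * T) then 2 else 1)"
          unfolding content_def n by (simp add: nth_append less_diff_conv2)
        from st[OF this] 2 show ?thesis by simp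
      next
        case 3
        then show ?thesis using gs by simp
      next
        case 4
        then have "content (w @ y) (int p - int (2 * T)) = 0" using y by (simp add: content_def)
        from st[OF this] 4 show ?thesis by simp
      qed
    qed
    have final: "final_ok (s T p)"
    proof -
      obtain q tps where qt: "C T = (q, tps)" by fastforce
      have "q = state_count M" "fst (last tps) = content [True]"
        using acc qt by (simp_all add: computes_in_def C_def)
      moreover have "tps \<noteq> []"
        using wf_length[of M q tps] wf[of T] M qt by (auto simp: is_tm_def)
      ultimately have "last (around tps i) \<noteq> 1" for i
        by (simp add: around_def last_map case_prod_beta content_def)
      then show ?thesis by (simp add: final_ok_def s_def Let_def r_def qt)
    qed
    have "fst (s t p) = offset_class (int p - int (2 * T))" by (simp add: s_def Let_def)
    then show ?thesis unfolding legal_val_def using first final by blast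
  qed
  ultimately have "tableau M w Y T s" by (simp add: tableau_def)
  then show ?thesis by blast
qed

lemma run_of_tableau:
  assumes M: "is_tm M" and T: "length w + Y \<le> T" and s: "tableau M w Y T s"
    and run: "\<And>y. length y \<le> Y \<Longrightarrow> computes_in M T (w @ y) [acc y]"
  shows "\<exists>y. length y \<le> Y \<and> acc y"
proof -
  define kk where "kk = (\<lambda>t p. fst (s t p))"
  define qq where "qq = (\<lambda>t p. fst (snd (s t p)))"
  define gg where "gg = (\<lambda>t p. fst (snd (snd (s t p))))"
  define aa where "aa = (\<lambda>t p. fst (snd (snd (snd (s t p)))))"
  define bb where "bb = (\<lambda>t p. fst (snd (snd (snd (snd (s t p))))))"
  define cc where "cc = (\<lambda>t p. snd (snd (snd (snd (snd (s t p))))))"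
  have sv: "s t p = (kk t p, qq t p, gg t p, aa t p, bb t p, cc t p)" for t p
    by (simp add: kk_def qq_def gg_def aa_def bb_def cc_def)
  have vals: "s t p \<in> vals M" and legal: "legal_val M w Y T t p (s t p)"
    if "t \<le> T" "p < 4 * T + 1" for t p
    using s that by (simp_all add: tableau_def)
  have l1: "qq t p = qq t (p + 1)" "gg t p = gg t (p + 1)" "bb t p = aa t (p + 1)" "cc t p = bb t (p + 1)"
    if "t \<le> T" "p + 1 < 4 * T + 1" for t p
    using s that unfolding tableau_def link1_def sv by auto
  have l2: "qq (t + 1) p = next_state M (qq t p) (gg t p)"
    "bb (t + 1) p = next_cell M (kk t p) (qq t p) (gg t p) (aa t p) (bb t p) (cc t p)"
    if "t < T" "p < 4 * T + 1" for t p
    using s that unfolding tableau_def link2_def sv by auto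
  have kk: "kk t p = offset_class (int p - int (2 * T))" if "t \<le> T" "p < 4 * T + 1" for t p
    using legal[OF that] by (simp add: legal_val_def sv)
  have glob: "qq t p = qq t 0 \<and> gg t p = gg t 0" if "t \<le> T" "p < 4 * T + 1" for t p
    using that(2)
  proof (induction p)
    case (Suc p)
    then show ?case using l1(1,2)[OF that(1), of p] by simp
  qed simp
  have gb: "gg t p = bb t (2 * T)" if "t \<le> T" "p < 4 * T + 1" for t p
  proof -
    have "kk t (2 * T) = 2" using kk[OF that(1), of "2 * T"] by (simp add: offset_class_def)
    then have "gg t (2 * T) = bb t (2 * T)" using vals[OF that(1), of "2 * T"] by (simp add: vals_def sv)
    then show ?thesis using glob[OF that] glob[OF that(1), of "2 * T"] by simp
  qed
  \<comment> \<open>the guessed part of the input is read off the first row, up to its first blank\<close>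
  define sym where "sym = (\<lambda>i. hd (bb 0 (2 * T + length w + i)))"
  define y where "y = map (\<lambda>i. sym i = 2) [0..<(LEAST i. sym i = 0 \<or> i = Y)]"
  let ?Ly = "LEAST i. sym i = 0 \<or> i = Y"
  have LyY: "?Ly \<le> Y" by (rule Least_le) simp
  have ly: "length y = ?Ly" by (simp add: y_def)
  have Ly0: "sym ?Ly = 0 \<or> ?Ly = Y" by (rule LeastI[of _ Y]) simp
  have Ly1: "sym i \<noteq> 0" if "i < ?Ly" for i using not_less_Least[OF that] by simp
  have leg0: "if p < 2 * T then start_ok M 0 (s 0 p)
        else if p < 2 * T + length w then start_ok M (if w ! (p - 2 * T) then 2 else 1) (s 0 p)
        else if p < 2 * T + length w + Y then guess_ok M (s 0 p) else start_ok M 0 (s 0 p)"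
    if "p < 4 * T + 1" for p
    using legal[of 0 p] that unfolding legal_val_def by simp
  have gs: "guess_ok M (s 0 (2 * T + length w + i))" if "i < Y" for i
    using leg0[of "2 * T + length w + i"] that T by simp
  have beyond: "sym i = 0" if "?Ly \<le> i" "i \<le> Y" for i
    using that
  proof (induction i rule: dec_induct)
    case base
    then show ?case
    proof (cases "?Ly = Y")
      case True
      then show ?thesis using leg0[of "2 * T + length w + ?Ly"] T
        by (simp add: sym_def start_ok_def sv)
    qed (use Ly0 in simp)
  next
    case (step i)
    then have "sym i = 0" "i < Y" by simp_all
    then have "hd (cc 0 (2 * T + length w + i)) = 0"
      using gs[of i] by (auto simp: guess_ok_def start_ok_def sv sym_def)
    then show ?case using l1(4)[of 0 "2 * T + length w + i"] T step.prems by (simp add: sym_def)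
  qed
  have b0: "bb 0 p = content (w @ y) (int p - int (2 * T)) # replicate (tape_count M - 1) 0 \<and> qq 0 p = 0"
    if p: "p < 4 * T + 1" for p
  proof -
    have n: "nat (int p - int (2 * T)) = p - 2 * T" by simp
    consider "p < 2 * T" | "2 * T \<le> p" "p < 2 * T + length w" | "2 * T + length w \<le> p" "p < 2 * T + length w + Y"
        | "2 * T + length w + Y \<le> p" by linarith
    then show ?thesis
    proof cases
      case 1
      then show ?thesis using leg0[OF p] by (simp add: start_ok_def sv content_def)
    next
      case 2
      then have "content (w @ y) (int p - int (2 * T)) = (if w ! (p - 2 * T) then 2 else 1)"
        unfolding content_def n by (simp add: nth_append less_diff_conv2)
      then show ?thesis using 2 leg0[OF p] by (simp add: start_ok_def sv)
    next
      case 3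
      then obtain i where i: "p = 2 * T + length w + i" "i < Y" by (metis add_less_cancel_left le_Suc_ex)
      have "content (w @ y) (int p - int (2 * T)) = (if i < ?Ly then if sym i = 2 then 2 else 1 else 0)"
      proof -
        have pi: "int p - int (2 * T) = int (length w + i)" using i(1) by simp
        show ?thesis unfolding pi content_def nat_int using ly by (auto simp: y_def nth_append)
      qed
      moreover have "sym i = 0" if "\<not> i < ?Ly" using beyond[of i] that i(2) by simp
      moreover have "sym i \<noteq> 0" if "i < ?Ly" using Ly1 that .
      ultimately show ?thesis
        using gs[OF i(2)] by (auto simp: guess_ok_def start_ok_def sv sym_def i(1))
    next
      case 4
      then have "content (w @ y) (int p - int (2 * T)) = 0" using ly LyY by (simp add: content_def)
      then show ?thesis using 4 leg0[OF p] by (simp add: start_ok_def sv)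
    qed
  qed
  define C where "C = (\<lambda>t. (tm_step M ^^ t) (initial M (w @ y)))"
  define r where "r = (\<lambda>t. around (snd (C t)))"
  have CS: "tm_step M (fst (C t), snd (C t)) = (fst (C (t + 1)), snd (C (t + 1)))" for t
    by (simp add: C_def)
  have wf: "wf_config M (C t)" for t
  proof (induction t)
    case 0
    then show ?case using wf_initial[OF M] by (simp add: C_def)
  next
    case (Suc t)
    then show ?case using around_step(3)[OF M _ CS[of t]] by simp
  qed
  have step: "fst (C (t + 1)) = next_state M (fst (C t)) (r t 0)"
    "r (t + 1) p = next_cell M (offset_class p) (fst (C t)) (r t 0) (r t (p - 1)) (r t p) (r t (p + 1))" for t p
    using around_step(1,2)[OF M _ CS[of t]] wf[of t] unfolding r_def by simp_all
  \<comment> \<open>row \<open>t\<close> is correct within distance \<open>2 * T - t\<close> of the head\<close>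
  have main: "t \<le> T \<Longrightarrow> (\<forall>p<4 * T + 1. qq t p = fst (C t)) \<and>
      (\<forall>p<4 * T + 1. \<bar>int p - int (2 * T)\<bar> \<le> int (2 * T) - int t \<longrightarrow> bb t p = r t (int p - int (2 * T)))" for t
  proof (induction t)
    case 0
    then show ?case using b0 by (simp add: r_def C_def around_initial) (simp add: initial_def)
  next
    case (Suc t)
    then have t: "t < T" "t \<le> T" by simp_all
    have IH: "\<And>p. p < 4 * T + 1 \<Longrightarrow> qq t p = fst (C t)"
      "\<And>p. p < 4 * T + 1 \<Longrightarrow> \<bar>int p - int (2 * T)\<bar> \<le> int (2 * T) - int t \<Longrightarrow> bb t p = r t (int p - int (2 * T))"
      using Suc.IH[OF t(2)] by blast+
    have g: "gg t p = r t 0" if "p < 4 * T + 1" for p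
      using gb[OF t(2) that] IH(2)[of "2 * T"] t by simp
    have "qq (Suc t) p = fst (C (Suc t))" if "p < 4 * T + 1" for p
      using l2(1)[OF t(1) that] IH(1)[OF that] g[OF that] step(1)[of t] by simp
    moreover have "bb (Suc t) p = r (Suc t) (int p - int (2 * T))"
      if p: "p < 4 * T + 1" and c: "\<bar>int p - int (2 * T)\<bar> \<le> int (2 * T) - int (Suc t)" for p
    proof -
      obtain p' where p': "p = p' + 1" using c by (cases p) auto
      have p2: "p + 1 < 4 * T + 1" using c by linarith
      have "aa t p = bb t p'" using l1(3)[OF t(2), of p'] p p' by simp
      also have "\<dots> = r t (int p' - int (2 * T))"
        by (rule IH(2)) (use p p' c in linarith)+
      also have "int p' - int (2 * T) = int p - int (2 * T) - 1" using p' by simp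
      finally have a: "aa t p = r t (int p - int (2 * T) - 1)" .
      have "cc t p = bb t (p + 1)" using l1(4)[OF t(2) p2] .
      also have "\<dots> = r t (int (p + 1) - int (2 * T))"
        by (rule IH(2)) (use p2 c in linarith)+
      also have "int (p + 1) - int (2 * T) = int p - int (2 * T) + 1" by simp
      finally have c': "cc t p = r t (int p - int (2 * T) + 1)" .
      have b: "bb t p = r t (int p - int (2 * T))" by (rule IH(2)) (use p c in linarith)+
      show ?thesis
        using l2(2)[OF t(1) p] step(2)[of t "int p - int (2 * T)"]
        by (simp only: kk[OF t(2) p] IH(1)[OF p] g[OF p] a b c' Suc_eq_plus1)
    qed
    ultimately show ?case by blast
  qed
  obtain q tps where qt: "C T = (q, tps)" by fastforce
  have yY: "length y \<le> Y" using ly LyY by simp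
  have out: "fst (last tps) = content [acc y]"
    using run[OF yY] qt by (simp add: computes_in_def C_def)
  have kt: "1 \<le> tape_count M" using M by (simp add: is_tm_def)
  let ?k = "tape_count M - 1"
  have len: "length (snd (C t)) = tape_count M" for t
    using wf_length[of M "fst (C t)" "snd (C t)"] wf[of t] by simp
  \<comment> \<open>cell \<open>0\<close> of the output tape is within distance \<open>T\<close> of the head\<close>
  have hd: "\<bar>snd (snd (C t) ! ?k)\<bar> \<le> int t" for t
  proof (induction t)
    case 0
    have "snd (C 0) ! ?k \<in> set (snd (C 0))" using len[of 0] kt by simp
    then show ?case by (auto simp: C_def initial_def)
  next
    case (Suc t)
    have "\<bar>snd (snd (C (t + 1)) ! ?k)\<bar> \<le> \<bar>snd (snd (C t) ! ?k)\<bar> + 1"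
      by (rule around_step(4)[OF M _ CS]) (use wf[of t] kt in auto)
    with Suc show ?case by simp
  qed
  \<comment> \<open>the column of cell \<open>0\<close> of the output tape rules out the output \<open>[False]\<close>\<close>
  obtain c h where ch: "last tps = (c, h)" by fastforce
  have ne: "tps \<noteq> []" using len[of T] qt kt by auto
  have "last tps = snd (C T) ! ?k" using len[of T] qt ne by (simp add: last_conv_nth)
  then have h: "\<bar>h\<bar> \<le> int T" using hd[of T] ch by (metis snd_conv)
  define p where "p = nat (int (2 * T) - h)"
  have p: "p < 4 * T + 1" "int p - int (2 * T) = - h" using h by (auto simp: p_def)
  have "bb T p = r T (- h)" using main[of T] p h by auto
  moreover have "last (r T (- h)) = c 0"
    using ne ch by (simp add: r_def qt around_def last_map)
  moreover have "last (bb T p) \<noteq> 1"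
    using legal[of T p] p(1) by (simp add: legal_val_def final_ok_def sv)
  ultimately have "content [acc y] 0 \<noteq> 1" using out ch by simp
  then have "acc y" by (simp add: content_def split: if_splits)
  then show ?thesis using yY by blast
qed

section \<open>Tableaux as solutions of a constraint problem\<close>

text \<open>
  A numbering, possibly with repetitions, of the entries of tableaux.
\<close>

definition cell_list :: "tm \<Rightarrow> cellval list" where
  "cell_list M = (SOME vs. set vs = vals M)"

lemma set_cell_list: "set (cell_list M) = vals M"
  unfolding cell_list_def by (rule someI_ex) (rule finite_list[OF finite_vals])

definition ncells :: "tm \<Rightarrow> nat" where "ncells M = length (cell_list M)"

definition cell_val :: "tm \<Rightarrow> nat \<Rightarrow> cellval" where "cell_val M u = cell_list M ! u"

lemma cell_val_vals: "u < ncells M \<Longrightarrow> cell_val M u \<in> vals M"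
  by (simp add: cell_val_def ncells_def flip: set_cell_list)

lemma ex_cell_val: "v \<in> vals M \<Longrightarrow> \<exists>u<ncells M. cell_val M u = v"
  by (simp add: cell_val_def ncells_def in_set_conv_nth flip: set_cell_list)

definition width :: "nat \<Rightarrow> nat" where "width T = 4 * T + 1"

text \<open>
  There are four copies of the variable for each row and column of the tableau, which have consecutive
  numbers. Four copies leave one that differs from three given variables.
\<close>

definition nvars :: "nat \<Rightarrow> nat" where "nvars T = 4 * ((T + 1) * width T)"

definition row :: "nat \<Rightarrow> nat \<Rightarrow> nat" where "row T i = i div 4 div width T"

definition col :: "nat \<Rightarrow> nat \<Rightarrow> nat" where "col T i = i div 4 mod width T"

definition cell_legal :: "tm \<Rightarrow> bool list \<Rightarrow> nat \<Rightarrow> nat \<Rightarrow> nat \<Rightarrow> nat \<Rightarrow> bool" where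
  "cell_legal M w Y T i u \<longleftrightarrow> u < ncells M \<and> legal_val M w Y T (row T i) (col T i) (cell_val M u)"

type_synonym label = "nat + (nat \<times> nat list \<times> nat list \<times> nat list)"

text \<open>
  The information that the entries for two variables share. Labels of unrelated variables are constant.
\<close>

definition shared_label :: "tm \<Rightarrow> nat \<Rightarrow> nat \<Rightarrow> nat \<Rightarrow> nat \<Rightarrow> label" where
  "shared_label M T i j u = (case cell_val M u of (k, q, g, a, b, c) \<Rightarrow>
     if i div 4 = j div 4 then Inl u
     else if row T i = row T j \<and> col T j = col T i + 1 then Inr (q, g, b, c)
     else if row T i = row T j \<and> col T i = col T j + 1 then Inr (q, g, a, b)
     else if col T i = col T j \<and> row T j = row T i + 1
       then Inr (next_state M q g, next_cell M k q g a b c, [], [])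
     else if col T i = col T j \<and> row T i = row T j + 1 then Inr (q, b, [], [])
     else Inl 0)"

lemma width_pos: "0 < width T" by (simp add: width_def)

lemma row_less: "i < nvars T \<Longrightarrow> row T i \<le> T"
proof -
  assume "i < nvars T"
  then have "i div 4 < (T + 1) * width T" by (simp add: nvars_def less_mult_imp_div_less mult.commute)
  then have "row T i < T + 1" unfolding row_def by (rule less_mult_imp_div_less)
  then show ?thesis by simp
qed

lemma col_less: "col T i < width T"
  by (simp add: col_def width_pos)

definition var :: "nat \<Rightarrow> nat \<Rightarrow> nat \<Rightarrow> nat" where "var T t p = 4 * (t * width T + p)"

lemma var_row_col: "p < width T \<Longrightarrow> row T (var T t p) = t \<and> col T (var T t p) = p"
  by (simp add: row_def col_def var_def)

lemma row_var: "p < width T \<Longrightarrow> row T (var T t p) = t"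
  and col_var: "p < width T \<Longrightarrow> col T (var T t p) = p"
  using var_row_col by blast+

lemma var_less: "t \<le> T \<Longrightarrow> p < width T \<Longrightarrow> var T t p < nvars T"
  using mixed_radix_less[of t "T + 1" p "width T"] by (simp add: var_def nvars_def)

lemma base_eq: "i div 4 = j div 4 \<longleftrightarrow> row T i = row T j \<and> col T i = col T j"
  unfolding row_def col_def by (metis div_mod_decomp)

lemma csp_shared_label:
  assumes T: "1 \<le> T"
  shows "csp (nvars T) (shared_label M T)"
proof
  have "2 * 5 \<le> (T + 1) * width T" using T unfolding width_def by (intro mult_mono) auto
  then show "5 \<le> nvars T" by (simp add: nvars_def)
  fix m i j assume m: "m < nvars T"
  let ?b = "4 * (m div 4)"
  have b: "?b + 4 \<le> nvars T"
  proof -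
    have "m div 4 < (T + 1) * width T"
      using m by (simp add: nvars_def less_mult_imp_div_less mult.commute)
    then show ?thesis unfolding nvars_def by simp
  qed
  have "\<exists>m'\<in>{?b, ?b + 1, ?b + 2, ?b + 3}. m' \<noteq> m \<and> m' \<noteq> i \<and> m' \<noteq> j"
  proof (rule ccontr)
    assume "\<not> ?thesis"
    then have "{?b, ?b + 1, ?b + 2, ?b + 3} \<subseteq> {m, i, j}" by blast
    then have "card {?b, ?b + 1, ?b + 2, ?b + 3} \<le> card {m, i, j}" by (intro card_mono) auto
    moreover have "card {?b, ?b + 1, ?b + 2, ?b + 3} = 4" by simp
    moreover have "card {m, i, j} \<le> 3" by (simp add: card_insert_if)
    ultimately show False by simp
  qed
  then obtain m' where m': "m' \<in> {?b, ?b + 1, ?b + 2, ?b + 3}" "m' \<noteq> m" "m' \<noteq> i" "m' \<noteq> j" by blast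
  then have "m' < nvars T" "m div 4 = m' div 4" using b by auto
  moreover have "shared_label M T m m' u = Inl u" for u
    using \<open>m div 4 = m' div 4\<close> by (simp add: shared_label_def split: prod.splits)
  ultimately show "\<exists>m'<nvars T. m' \<noteq> m \<and> m' \<noteq> i \<and> m' \<noteq> j \<and>
      (\<forall>u w. shared_label M T m m' u = shared_label M T m m' w \<longrightarrow> u = w)"
    using m' by auto
qed

lemma shared_label_eq_iff:
  "shared_label M T i j u = shared_label M T j i v \<longleftrightarrow>
     (if i div 4 = j div 4 then u = v
      else if row T i = row T j \<and> col T j = col T i + 1 then link1 (cell_val M u) (cell_val M v)
      else if row T i = row T j \<and> col T i = col T j + 1 then link1 (cell_val M v) (cell_val M u)
      else if col T i = col T j \<and> row T j = row T i + 1 then link2 M (cell_val M u) (cell_val M v)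
      else if col T i = col T j \<and> row T i = row T j + 1 then link2 M (cell_val M v) (cell_val M u)
      else True)"
  by (auto simp: shared_label_def link1_def link2_def split: prod.splits)

lemma ex_solution_iff_tableau:
  assumes T: "1 \<le> T"
  shows "(\<exists>s. csp.solution (nvars T) (ncells M) (cell_legal M w Y T) (shared_label M T) s) \<longleftrightarrow>
    (\<exists>s. tableau M w Y T s)"
proof
  interpret csp "nvars T" "ncells M" "cell_legal M w Y T" "shared_label M T" using T by (rule csp_shared_label)
  {
    assume "\<exists>s. solution s"
    then obtain s where s: "solution s" by blast
    have v: "cell_legal M w Y T (var T t p) (s (var T t p))" if "t \<le> T" "p < width T" for t p
      using s var_less[OF that] by (simp add: solution_def)
    have l: "shared_label M T (var T t p) (var T t' p') (s (var T t p)) = shared_label M T (var T t' p') (var T t p) (s (var T t' p'))"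
      if "t \<le> T" "p < width T" "t' \<le> T" "p' < width T" "(t, p) \<noteq> (t', p')" for t p t' p'
    proof -
      have "var T t p \<noteq> var T t' p'" using that var_row_col by (metis prod.inject)
      then show ?thesis using s var_less[OF that(1,2)] var_less[OF that(3,4)] by (simp add: solution_def)
    qed
    have "tableau M w Y T (\<lambda>t p. cell_val M (s (var T t p)))"
      unfolding tableau_def width_def[symmetric]
    proof (intro allI impI conjI)
      fix t p assume tp: "t \<le> T" "p < width T"
      show "cell_val M (s (var T t p)) \<in> vals M" using v[OF tp] by (simp add: cell_legal_def cell_val_vals)
      show "legal_val M w Y T t p (cell_val M (s (var T t p)))"
        using v[OF tp] var_row_col[OF tp(2), of t] by (simp add: cell_legal_def)
      show "link1 (cell_val M (s (var T t p))) (cell_val M (s (var T t (p + 1))))" if "p + 1 < width T"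
        using l[OF tp tp(1) that]
        unfolding shared_label_eq_iff base_eq[where T = T] row_var[OF tp(2)] col_var[OF tp(2)] row_var[OF that] col_var[OF that]
        by simp
      show "link2 M (cell_val M (s (var T t p))) (cell_val M (s (var T (t + 1) p)))" if "t < T"
        using l[OF tp _ tp(2), of "t + 1"] that
        unfolding shared_label_eq_iff base_eq[where T = T] row_var[OF tp(2)] col_var[OF tp(2)] by simp
    qed
    then show "\<exists>s. tableau M w Y T s" by blast
  }
  {
    assume "\<exists>s. tableau M w Y T s"
    then obtain s where s: "tableau M w Y T s" by blast
    note s = s[unfolded tableau_def, folded width_def]
    have "\<exists>u. t \<le> T \<longrightarrow> p < width T \<longrightarrow> u < ncells M \<and> cell_val M u = s t p" for t p
      using s ex_cell_val by blast
    then obtain f' where f': "\<And>t p. t \<le> T \<longrightarrow> p < width T \<longrightarrow> f' t p < ncells M \<and> cell_val M (f' t p) = s t p"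
      by metis
    have f: "f' (row T i) (col T i) < ncells M \<and> cell_val M (f' (row T i) (col T i)) = s (row T i) (col T i)"
      if "i < nvars T" for i
      using f' row_less[OF that] col_less by blast
    have "solution (\<lambda>i. f' (row T i) (col T i))"
      unfolding solution_def
    proof (intro allI impI conjI)
      fix i assume i: "i < nvars T"
      show "f' (row T i) (col T i) < ncells M" using f[OF i] by blast
      show "cell_legal M w Y T i (f' (row T i) (col T i))"
        using f[OF i] s row_less[OF i] col_less[of T i] by (simp add: cell_legal_def)
      fix j assume j: "j < nvars T" and ij: "i \<noteq> j"
      have li: "row T i \<le> T" "col T i < width T" and lj: "row T j \<le> T" "col T j < width T"
        using row_less[OF i] row_less[OF j] col_less by blast+
      have L1: "link1 (s t p) (s t (p + 1))" if "t \<le> T" "p + 1 < width T" for t p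
        using s that by simp
      have L2: "link2 M (s t p) (s (t + 1) p)" if "t + 1 \<le> T" "p < width T" for t p
        using s that by simp
      show "shared_label M T i j (f' (row T i) (col T i)) = shared_label M T j i (f' (row T j) (col T j))"
        unfolding shared_label_eq_iff base_eq[where T = T] using f[OF i] f[OF j] L1 L2 li lj by auto
    qed
    then show "\<exists>s. solution s" by blast
  }
qed

section \<open>Printing the instance, and coNP-hardness\<close>

text \<open>
  The pairs of numbers below \<open>n\<close> that satisfy \<open>C\<close>, in lexicographic order.
\<close>

definition pairs :: "(nat \<Rightarrow> nat \<Rightarrow> bool) \<Rightarrow> nat \<Rightarrow> (nat \<times> nat) list" where
  "pairs C n = concat (map (\<lambda>a. concat (map (\<lambda>b. if C a b then [(a, b)] else []) [0..<n])) [0..<n])"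

lemma concat_map_concat: "concat (map h (concat xss)) = concat (map (\<lambda>xs. concat (map h xs)) xss)"
  by (induction xss) auto

lemma concat_map_pairs:
  "concat (map (\<lambda>a. concat (map (\<lambda>b. if C a b then g a b else []) [0..<n])) [0..<n]) =
   concat (map (\<lambda>(a, b). g a b) (pairs C n))"
proof -
  have "concat (map (\<lambda>(a, b). g a b) (if C a b then [(a, b)] else [])) = (if C a b then g a b else [])"
    for a b by simp
  then show ?thesis by (simp add: pairs_def concat_map_concat comp_def)
qed

lemma set_pairs: "set (pairs C n) = {(a, b). a < n \<and> b < n \<and> C a b}"
  by (auto simp: pairs_def)

text \<open>
  The part of \<open>pair_string x y\<close> that depends on \<open>x\<close>.
\<close>

definition code :: "bool list \<Rightarrow> bool list" where
  "code x = concat (map (\<lambda>b. [b, b]) x) @ [False, True]"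

lemma length_code: "length (code x) = 2 * length x + 2"
  by (induction x) (auto simp: code_def)

lemma pair_string_code: "pair_string x y = code x @ y"
  by (simp add: pair_string_def code_def)

lemma enc_instance_in_CRT:
  "enc_instance (n, ops, cs) \<in> CRT \<longleftrightarrow>
     valid_instance (n, ops, cs) \<and> CR_tuple (table_algebra n ops) (map set cs)"
proof
  assume "enc_instance (n, ops, cs) \<in> CRT"
  then obtain n' ops' cs' where "enc_instance (n, ops, cs) = enc_instance (n', ops', cs')"
    and *: "valid_instance (n', ops', cs')" "CR_tuple (table_algebra n' ops') (map set cs')"
    unfolding CRT_def by blast
  then have "(n, ops, cs) = (n', ops', cs')" using inj_enc_instance injD by metis
  with * show "valid_instance (n, ops, cs) \<and> CR_tuple (table_algebra n ops) (map set cs)" by simp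
qed (unfold CRT_def, blast)

definition p_code :: prog where
  "p_code = Seq (For 1 (Var 0) (If (Drop (Var 0) (Var 1)) (Seq (Emit True) (Emit True)) (Seq (Emit False) (Emit False))))
     (Seq (Emit False) (Emit True))"

lemma sem_p_code: "sem p_code e = code (e 0)"
proof -
  have "concat (map (\<lambda>i. [x ! i, x ! i]) [0..<length x]) = concat (map (\<lambda>b. [b, b]) x)" for x :: "bool list"
    by (metis (no_types, lifting) map_nth map_map comp_def map_eq_conv)
  moreover have "concat (map (\<lambda>i. sem (If (Drop (Var 0) (Var 1)) (Seq (Emit True) (Emit True)) (Seq (Emit False) (Emit False)))
      (bind 1 (replicate i True) e)) [0..<length (e 0)]) = concat (map (\<lambda>i. [e 0 ! i, e 0 ! i]) [0..<length (e 0)])"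
    by (intro arg_cong[where f = concat] map_cong) auto
  ultimately show ?thesis by (simp add: p_code_def code_def)
qed

locale reduction =
  fixes M :: tm and w :: "bool list" and Y T :: nat
  assumes M: "is_tm M" and T: "1 \<le> T"
begin

abbreviation "d \<equiv> ncells M"
abbreviation "k \<equiv> nvars T"

sublocale csp k d "cell_legal M w Y T" "shared_label M T"
  using T by (rule csp_shared_label)

lemma d_pos: "0 < d"
proof -
  let ?g = "replicate (tape_count M) 0"
  have "3 \<le> symbol_count M" using M by (simp add: is_tm_def)
  then have "?g \<in> syms M" by (auto simp: syms_def tuples_def)
  then have "(0, 0, ?g, ?g, ?g, ?g) \<in> vals M" by (simp add: vals_def)
  then show ?thesis using ex_cell_val by fastforce
qed

text \<open>
  The variables in which the printing program keeps the parameters of the instance.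
\<close>

definition env_ok :: "env \<Rightarrow> bool" where
  "env_ok e \<longleftrightarrow> e 1 = w \<and> length (e 2) = Y \<and> length (e 3) = T \<and> length (e 4) = width T \<and>
     length (e 5) = k \<and> length (e 6) = num_elems"

end

text \<open>
  Finite tables of entries, and of pairs of entries, with a given property.
\<close>

definition cells :: "tm \<Rightarrow> (cellval \<Rightarrow> bool) \<Rightarrow> nat list" where
  "cells M P = filter (\<lambda>u. P (cell_val M u)) [0..<ncells M]"

lemma set_cells[simp]: "u \<in> set (cells M P) \<longleftrightarrow> u < ncells M \<and> P (cell_val M u)"
  by (auto simp: cells_def)

definition cells2 :: "tm \<Rightarrow> (cellval \<Rightarrow> cellval \<Rightarrow> bool) \<Rightarrow> (nat \<times> nat) list" where
  "cells2 M P = pairs (\<lambda>u v. P (cell_val M u) (cell_val M v)) (ncells M)"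

lemma set_cells2[simp]:
  "(u, v) \<in> set (cells2 M P) \<longleftrightarrow> u < ncells M \<and> v < ncells M \<and> P (cell_val M u) (cell_val M v)"
  by (auto simp: cells2_def set_pairs)

definition p_row :: "prog \<Rightarrow> prog" where "p_row I = pdiv (pdiv I (pnat 4)) (Var 4)"

definition p_col :: "prog \<Rightarrow> prog" where "p_col I = pmod (pdiv I (pnat 4)) (Var 4)"

text \<open>
  The following programs decide the relations of the constraint problem and the congruences \<open>theta\<close>, for
  variables and entries that are given by their numbers.
\<close>

definition p_legal :: "tm \<Rightarrow> prog \<Rightarrow> prog \<Rightarrow> prog" where
  "p_legal M I U = (let p = p_col I; TT = pmul (pnat 2) (Var 3); N = Seq TT (Var 1) in
     pand (plt U (pnat (ncells M)))
    (pand (If (peq (padd p 1) TT) (pmem U (cells M (\<lambda>v. fst v = 1)))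
          (If (peq p TT) (pmem U (cells M (\<lambda>v. fst v = 2)))
          (If (peq p (padd TT 1)) (pmem U (cells M (\<lambda>v. fst v = 3))) (pmem U (cells M (\<lambda>v. fst v = 0))))))
    (pand (por (pnot (peq (p_row I) (pnat 0)))
            (If (plt p TT) (pmem U (cells M (start_ok M 0)))
            (If (plt p N) (If (Drop (Var 1) (Drop p TT)) (pmem U (cells M (start_ok M 2))) (pmem U (cells M (start_ok M 1))))
            (If (plt p (Seq N (Var 2))) (pmem U (cells M (guess_ok M))) (pmem U (cells M (start_ok M 0)))))))
          (por (pnot (peq (p_row I) (Var 3))) (pmem U (cells M final_ok))))))"

definition p_compat :: "tm \<Rightarrow> prog \<Rightarrow> prog \<Rightarrow> prog \<Rightarrow> prog \<Rightarrow> prog" where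
  "p_compat M I J U V =
     If (peq (pdiv I (pnat 4)) (pdiv J (pnat 4))) (peq U V)
    (If (pand (peq (p_row I) (p_row J)) (peq (p_col J) (padd (p_col I) 1))) (pmem2 U V (cells2 M link1))
    (If (pand (peq (p_row I) (p_row J)) (peq (p_col I) (padd (p_col J) 1))) (pmem2 V U (cells2 M link1))
    (If (pand (peq (p_col I) (p_col J)) (peq (p_row J) (padd (p_row I) 1))) (pmem2 U V (cells2 M (link2 M)))
    (If (pand (peq (p_col I) (p_col J)) (peq (p_row I) (padd (p_row J) 1))) (pmem2 V U (cells2 M (link2 M)))
    (Emit True)))))"

definition p_ei :: "tm \<Rightarrow> prog \<Rightarrow> prog" where
  "p_ei M E = pdiv (pdiv E (pnat (ncells M * ncells M))) (Var 5)"

definition p_ej :: "tm \<Rightarrow> prog \<Rightarrow> prog" where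
  "p_ej M E = pmod (pdiv E (pnat (ncells M * ncells M))) (Var 5)"

definition p_eu :: "tm \<Rightarrow> prog \<Rightarrow> prog" where
  "p_eu M E = pmod (pdiv E (pnat (ncells M))) (pnat (ncells M))"

definition p_ev :: "tm \<Rightarrow> prog \<Rightarrow> prog" where
  "p_ev M E = pmod E (pnat (ncells M))"

definition p_gen :: "tm \<Rightarrow> prog \<Rightarrow> prog" where
  "p_gen M E = pand (pnot (peq (p_ei M E) (p_ej M E)))
    (pand (p_legal M (p_ei M E) (p_eu M E)) (pand (p_legal M (p_ej M E) (p_ev M E))
      (p_compat M (p_ei M E) (p_ej M E) (p_eu M E) (p_ev M E))))"

definition p_val :: "tm \<Rightarrow> prog \<Rightarrow> prog \<Rightarrow> prog \<Rightarrow> prog" where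
  "p_val M E L U = pand (p_gen M E)
     (por (pand (peq L (p_ei M E)) (peq U (p_eu M E))) (pand (peq L (p_ej M E)) (peq U (p_ev M E))))"

definition p_theta :: "tm \<Rightarrow> prog" where
  "p_theta M = por (peq (Var 8) (Var 9))
     (pex 10 (pnat (ncells M)) (pand (p_val M (Var 8) (Var 7) (Var 10)) (p_val M (Var 9) (Var 7) (Var 10))))"

definition p_nat :: "prog \<Rightarrow> prog" where "p_nat P = Seq (ones P) (Emit False)"

lemma sem_p_nat[simp]: "sem (p_nat P) e = enc_nat (num P e)"
  by (simp add: p_nat_def enc_nat_def)

definition p_instance :: "tm \<Rightarrow> prog" where
  "p_instance M = Seq (p_nat (Var 6)) (Seq (p_nat Skip) (Seq (p_nat (Var 5))
     (For 7 (Var 5) (Seq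
       (p_nat (For 8 (Var 6) (For 9 (Var 6) (If (p_theta M) (Emit True) Skip))))
       (For 8 (Var 6) (For 9 (Var 6) (If (p_theta M) (Seq (p_nat (Var 8)) (p_nat (Var 9))) Skip)))))))"

context reduction
begin

lemma num_row_col:
  assumes "env_ok e"
  shows "num (p_row I) e = row T (num I e)" "num (p_col I) e = col T (num I e)"
  using assms width_pos[of T]
  by (simp_all add: env_ok_def p_row_def p_col_def row_def col_def num_pdiv num_pmod)

lemma offset_class_shift:
  "offset_class (int p - int m) = (if p + 1 = m then 1 else if p = m then 2 else if p = m + 1 then 3 else 0)"
  unfolding offset_class_def by (intro if_cong) auto

lemma holds_p_legal:
  assumes e: "env_ok e"
  shows "holds (p_legal M I U) e \<longleftrightarrow> cell_legal M w Y T (num I e) (num U e)"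
proof -
  let ?p = "col T (num I e)" and ?u = "num U e"
  have c: "fst (cell_val M ?u) = offset_class (int ?p - int (2 * T)) \<longleftrightarrow>
     (if ?p + 1 = 2 * T then fst (cell_val M ?u) = 1 else if ?p = 2 * T then fst (cell_val M ?u) = 2
      else if ?p = 2 * T + 1 then fst (cell_val M ?u) = 3 else fst (cell_val M ?u) = 0)"
    unfolding offset_class_shift by (cases "?p + 1 = 2 * T"; cases "?p = 2 * T"; cases "?p = 2 * T + 1"; simp)
  have e': "e 1 = w" "length (e 2) = Y" "length (e 3) = T" using e by (simp_all add: env_ok_def)
  have tests: "num (padd (p_col I) 1) e = ?p + 1" "num (pmul (pnat 2) (Var 3)) e = 2 * T"
    "num (padd (pmul (pnat 2) (Var 3)) 1) e = 2 * T + 1"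
    "num (Seq (pmul (pnat 2) (Var 3)) (Var 1)) e = 2 * T + length w"
    "num (Seq (Seq (pmul (pnat 2) (Var 3)) (Var 1)) (Var 2)) e = 2 * T + length w + Y"
    "num (pnat 0) e = 0" "num (pnat d) e = d" "num (Var 3) e = T"
    by (simp_all add: num_row_col[OF e] e' e'[simplified])
  have bit: "holds (Drop (Var 1) (Drop (p_col I) (pmul (pnat 2) (Var 3)))) e \<longleftrightarrow> w ! (?p - 2 * T)"
    if "\<not> ?p < 2 * T" "?p < 2 * T + length w"
    using that by (auto simp: num_row_col[OF e] e' e'[simplified])
  show ?thesis
  proof (cases "?u < d")
    case True
    let ?D = "Drop (Var 1) (Drop (p_col I) (pmul (pnat 2) (Var 3)))"
    have inner: "(if ?p < 2 * T then A else if ?p < 2 * T + length w then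
          if holds ?D e then start_ok M 2 (cell_val M ?u) else start_ok M 1 (cell_val M ?u) else B) =
        (if ?p < 2 * T then A else if ?p < 2 * T + length w then
          start_ok M (if w ! (?p - 2 * T) then 2 else 1) (cell_val M ?u) else B)" for A B
      using bit by (cases "?p < 2 * T"; cases "?p < 2 * T + length w"; simp del: holds_Drop)
    show ?thesis
      unfolding cell_legal_def legal_val_def c p_legal_def Let_def holds_logic holds_If holds_plt holds_peq
        tests num_row_col[OF e] holds_pmem set_cells
      by (simp only: True simp_thms imp_conv_disj inner)
  next
    case False
    then show ?thesis by (simp add: cell_legal_def p_legal_def Let_def)
  qed
qed

lemma holds_p_compat:
  assumes e: "env_ok e" and "num U e < d" "num V e < d"
  shows "holds (p_compat M I J U V) e \<longleftrightarrow>
    shared_label M T (num I e) (num J e) (num U e) = shared_label M T (num J e) (num I e) (num V e)"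
  unfolding shared_label_eq_iff using assms(2,3)
  by (simp add: p_compat_def num_row_col[OF e] num_pdiv)

lemma num_fields:
  assumes "env_ok e"
  shows "num (p_ei M E) e = ei (num E e)" "num (p_ej M E) e = ej (num E e)"
    "num (p_eu M E) e = eu (num E e)" "num (p_ev M E) e = ev (num E e)"
proof -
  have "length (e 5) = k" "0 < k" using assms k by (simp_all add: env_ok_def)
  then show "num (p_ei M E) e = ei (num E e)" "num (p_ej M E) e = ej (num E e)"
    "num (p_eu M E) e = eu (num E e)" "num (p_ev M E) e = ev (num E e)"
    using d_pos
    by (simp_all add: p_ei_def p_ej_def p_eu_def p_ev_def ei_def ej_def eu_def ev_def num_pdiv num_pmod)
qed

lemma holds_p_val:
  assumes e: "env_ok e"
  shows "holds (p_val M E L U) e \<longleftrightarrow> val (num E e) (num L e) (num U e)"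
proof -
  have "eu a < d" "ev a < d" for a using d_pos by (simp_all add: eu_def ev_def)
  then show ?thesis
    by (simp add: p_val_def p_gen_def val_def genuine_def num_fields[OF e] holds_p_legal[OF e] holds_p_compat[OF e])
qed

lemma env_ok_bind: "env_ok e \<Longrightarrow> 6 < v \<Longrightarrow> env_ok (bind v x e)"
  by (simp add: env_ok_def)

text \<open>
  The condition that defines \<open>theta l\<close>, with a bound on the value.
\<close>

definition related :: "nat \<Rightarrow> nat \<Rightarrow> nat \<Rightarrow> bool" where
  "related l a b \<longleftrightarrow> a = b \<or> (\<exists>u<d. val a l u \<and> val b l u)"

lemma holds_p_theta:
  assumes e: "env_ok e"
  shows "holds (p_theta M) e \<longleftrightarrow> related (length (e 7)) (length (e 8)) (length (e 9))"
  by (simp add: p_theta_def related_def holds_p_val[OF env_ok_bind[OF e]])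

lemma theta_pairs: "theta l = set (pairs (related l) num_elems)"
  unfolding theta_def set_pairs related_def using val_less by blast

text \<open>
  The instance that is printed.
\<close>

definition inst :: crt_instance where
  "inst = (num_elems, [], map (\<lambda>l. pairs (related l) num_elems) [0..<k])"

lemma inst_CRT: "enc_instance inst \<in> CRT \<longleftrightarrow> (\<nexists>s. tableau M w Y T s)"
proof -
  let ?cs = "map (\<lambda>l. pairs (related l) num_elems) [0..<k]"
  have th: "map set ?cs = map theta [0..<k]" by (simp add: theta_pairs comp_def)
  have "0 < num_elems" using d_pos k by (simp add: num_elems_def)
  then have "valid_instance inst"
    using congruence_theta k
    by (auto simp: valid_instance_def inst_def is_algebra_def theta_pairs[symmetric])
      (auto simp: table_algebra_def)
  then have "enc_instance inst \<in> CRT \<longleftrightarrow> CR_tuple (table_algebra num_elems []) (map set ?cs)"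
    unfolding inst_def enc_instance_in_CRT by blast
  also have "\<dots> \<longleftrightarrow> (\<nexists>s. tableau M w Y T s)"
    unfolding th CR_iff_not_solution ex_solution_iff_tableau[OF T] ..
  finally show ?thesis .
qed

lemma sem_p_instance:
  assumes e: "env_ok e"
  shows "sem (p_instance M) e = enc_instance inst"
proof -
  have len: "length (e 5) = k" "length (e 6) = num_elems" using e by (simp_all add: env_ok_def)
  let ?C = "\<lambda>l. related l"
  have body: "sem (For 8 (Var 6) (For 9 (Var 6) (If (p_theta M) P Skip))) (bind 7 (replicate l True) e) =
      concat (map (\<lambda>(a, b). g a b) (pairs (?C l) num_elems))"
    if "\<And>a b. sem P (bind 9 (replicate b True) (bind 8 (replicate a True) (bind 7 (replicate l True) e))) = g a b"
    for P g l
  proof -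
    have "holds (p_theta M) (bind 9 (replicate b True) (bind 8 (replicate a True) (bind 7 (replicate l True) e)))
        \<longleftrightarrow> ?C l a b" for a b
      using holds_p_theta[of "bind 9 (replicate b True) (bind 8 (replicate a True) (bind 7 (replicate l True) e))"]
      by (simp add: env_ok_bind e)
    then show ?thesis unfolding concat_map_pairs[symmetric] using len that by (simp cong: if_cong)
  qed
  have 1: "num (For 8 (Var 6) (For 9 (Var 6) (If (p_theta M) (Emit True) Skip))) (bind 7 (replicate l True) e) =
      length (pairs (?C l) num_elems)" for l
    unfolding num_def body[of "Emit True" l "\<lambda>_ _. [True]", OF sem.simps(2)]
    by (simp add: length_concat case_prod_beta comp_def sum_list_triv)
  have 2: "sem (For 8 (Var 6) (For 9 (Var 6) (If (p_theta M) (Seq (p_nat (Var 8)) (p_nat (Var 9))) Skip)))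
      (bind 7 (replicate l True) e) = concat (map (enc_pair enc_nat enc_nat) (pairs (?C l) num_elems))" for l
    by (subst body[where g = "\<lambda>a b. enc_nat a @ enc_nat b"]) (simp_all add: enc_pair_def)
  have "sem (p_instance M) e = enc_nat num_elems @ enc_nat 0 @ enc_nat k @
      concat (map (\<lambda>l. enc_nat (length (pairs (?C l) num_elems)) @
        concat (map (enc_pair enc_nat enc_nat) (pairs (?C l) num_elems))) [0..<k])"
    unfolding p_instance_def
    by (simp only: sem.simps(3,4) sem.simps(6)[of 7] sem_p_nat 1 2 num_Var num_Skip len)
  then show ?thesis
    by (simp add: inst_def enc_instance_def enc_pair_def enc_list_def comp_def)
qed

end

definition p_reduction :: "tm \<Rightarrow> prog \<Rightarrow> prog \<Rightarrow> prog" where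
  "p_reduction M P Q = Let 1 p_code (Let 2 P (Let 3 Q
     (Let 4 (padd (pmul (pnat 4) (Var 3)) 1)
     (Let 5 (pmul (pnat 4) (pmul (padd (Var 3) 1) (Var 4)))
     (Let 6 (pmul (pmul (pmul (Var 5) (Var 5)) (pnat (ncells M))) (pnat (ncells M)))
     (p_instance M))))))"

lemma sem_p_reduction:
  assumes M: "is_tm M" and P: "\<And>e. num P e = Y (length (e 0))"
    and Q: "\<And>e. num Q e = T (length (e 0)) (length (e 2))"
    and T: "1 \<le> T (length x) (Y (length x))"
  shows "sem (p_reduction M P Q) (\<lambda>_. x) =
    enc_instance (reduction.inst M (code x) (Y (length x)) (T (length x) (Y (length x))))"
proof -
  let ?Y = "Y (length x)" and ?T = "T (length x) (Y (length x))"
  interpret reduction M "code x" ?Y ?T using M T by unfold_locales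
  define e1 where "e1 = bind 1 (sem p_code (\<lambda>_. x)) (\<lambda>_. x)"
  define e2 where "e2 = bind 2 (sem P e1) e1"
  define e3 where "e3 = bind 3 (sem Q e2) e2"
  define e4 where "e4 = bind 4 (sem (padd (pmul (pnat 4) (Var 3)) 1) e3) e3"
  define e5 where "e5 = bind 5 (sem (pmul (pnat 4) (pmul (padd (Var 3) 1) (Var 4))) e4) e4"
  define e6 where "e6 = bind 6 (sem (pmul (pmul (pmul (Var 5) (Var 5)) (pnat (ncells M))) (pnat (ncells M))) e5) e5"
  have 1: "e1 0 = x" "e1 1 = code x" by (simp_all add: e1_def sem_p_code)
  have 2: "e2 0 = x" "e2 1 = code x" "length (e2 2) = ?Y"
    using P[of e1] 1 by (simp_all add: e2_def num_def)
  have 3: "e3 1 = code x" "length (e3 2) = ?Y" "length (e3 3) = ?T"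
    using Q[of e2] 2 by (simp_all add: e3_def num_def)
  have 4: "e4 1 = code x" "length (e4 2) = ?Y" "length (e4 3) = ?T" "length (e4 4) = width ?T"
    using 3 by (simp_all add: e4_def width_def flip: num_def)
  have 5: "e5 1 = code x" "length (e5 2) = ?Y" "length (e5 3) = ?T" "length (e5 4) = width ?T"
    "length (e5 5) = nvars ?T"
    using 4 by (simp_all add: e5_def nvars_def flip: num_def)
  have "env_ok e6"
    unfolding env_ok_def using 5 by (simp add: e6_def num_elems_def flip: num_def)
  then have "sem (p_instance M) e6 = enc_instance inst" by (rule sem_p_instance)
  then show ?thesis
    unfolding p_reduction_def sem.simps(5)
    by (simp only: e6_def e5_def e4_def e3_def e2_def e1_def)
qed

text \<open>
  A string \<open>x\<close> is outside \<open>L\<close> iff some certificate for it is accepted, iff a tableau for \<open>code x\<close> exists, iff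
  the printed instance is no Chinese Remainder tuple.
\<close>

theorem CRT_hard:
  assumes L: "L \<in> class_coNP"
  shows "karp_reducible L CRT"
proof -
  obtain V p where V: "V \<in> class_P"
    and p: "\<And>x. x \<notin> L \<longleftrightarrow> (\<exists>y. length y \<le> poly p (length x) \<and> pair_string x y \<in> V)"
    using L unfolding class_coNP_def class_NP_def by auto
  obtain M q where M: "is_tm M" and q: "\<And>z. computes_in M (poly q (length z)) z [z \<in> V]"
    using V unfolding class_P_def polytime_def by blast
  define Y where "Y = (\<lambda>n. poly p n)"
  define T where "T = (\<lambda>n m. poly q (2 * n + 2 + m) + (2 * n + 2 + m + 1))"
  obtain P where P: "\<And>e. num P e = poly p (num (Var 0) e)" using ex_ppoly by metis
  let ?B = "Seq (Seq (pmul (pnat 2) (Var 0)) (pnat 2)) (Var 2)"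
  obtain Q where Q: "\<And>e. num Q e = poly q (num ?B e)" using ex_ppoly by metis
  let ?Q = "Seq Q (padd ?B 1)"
  let ?R = "p_reduction M P ?Q"
  have "x \<in> L \<longleftrightarrow> sem ?R (\<lambda>_. x) \<in> CRT" for x
  proof -
    let ?Y = "Y (length x)" and ?T = "T (length x) (Y (length x))"
    interpret reduction M "code x" ?Y ?T using M by unfold_locales (auto simp: T_def)
    have le: "length (code x) + ?Y \<le> ?T" by (simp add: T_def length_code)
    have run: "computes_in M ?T (code x @ y) [pair_string x y \<in> V]" if "length y \<le> ?Y" for y
    proof -
      have "length (code x @ y) \<le> 2 * length x + 2 + ?Y" using that by (simp add: length_code)
      then have "poly q (length (code x @ y)) \<le> ?T"
        unfolding T_def using poly_nat_mono trans_le_add1 by blast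
      then show ?thesis using computes_in_mono[OF q[of "code x @ y"]] by (simp add: pair_string_code)
    qed
    have "x \<in> L \<longleftrightarrow> (\<nexists>s. tableau M (code x) ?Y ?T s)"
    proof
      assume x: "x \<in> L"
      show "\<nexists>s. tableau M (code x) ?Y ?T s"
      proof
        assume "\<exists>s. tableau M (code x) ?Y ?T s"
        then obtain s where "tableau M (code x) ?Y ?T s" by blast
        from run_of_tableau[OF M le this run] p[of x] x show False by (auto simp: Y_def)
      qed
    next
      assume no: "\<nexists>s. tableau M (code x) ?Y ?T s"
      show "x \<in> L"
      proof (rule ccontr)
        assume "x \<notin> L"
        then obtain y where y: "length y \<le> ?Y" "pair_string x y \<in> V" using p by (auto simp: Y_def)
        then have "computes_in M ?T (code x @ y) [True]" using run[OF y(1)] by simp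
        from tableau_of_run[OF M le y(1) this] no show False by blast
      qed
    qed
    moreover have "sem ?R (\<lambda>_. x) = enc_instance inst"
      by (rule sem_p_reduction[OF M, where Y = Y and T = T]) (simp_all add: P Q Y_def T_def)
    ultimately show ?thesis using inst_CRT by simp
  qed
  then show ?thesis unfolding karp_reducible_def using polytime_sem[of ?R] by blast
qed

theorem theorem3p1:
  shows "coNP_complete CRT"
  unfolding coNP_complete_def using CRT_coNP CRT_hard by blast

end
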